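(* Assume that the following (the Penrose inequality conjectured by X. Wang) is true: for every asymptotically hyperbolic $3$-manifold $(M,g)$ with scalar curvature $R\geq -6$ and mass $\mathcal M$, if $\Sigma_0$ is an outermost sphere with $H(\Sigma_0)=2$, then $$\mathcal M\geq\left(\frac{|\Sigma_0|}{16\pi}\right)^{1/2},$$ and if equality holds then $(M,g)$ is isometric to an Anti-de Sitter-Schwarzschild manifold outside $\Sigma_0$. Then for every smooth function $f$ on $S^2$ with $$\frac{1}{4\pi}\int_{S^2}\exp(2f)\,d\mu_0=1$$ one has $$\left(\frac1{4\pi}\int_{S^2}K_f\exp(3f)\,d\mu_0\right)^2-\sum_{i=1}^3\left(\frac1{4\pi}\int_{S^2}K_f\exp(3f)\,x_i\,d\mu_0\right)^2\geq 1,$$ where $K_f$ denotes the Gaussian curvature of the metric $\exp(2f)g_0$ on $S^2$.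
   Context: $g_0$ is the round metric on the unit sphere $S^2\subset\mathbb R^3$, $d\mu_0$ its area form, and $(x_1,x_2,x_3)$ are the standard coordinate functions of $\mathbb R^3$ restricted to $S^2$. A complete noncompact Riemannian $3$-manifold $(M,g)$ (possibly with compact boundary) is asymptotically hyperbolic if: (i) there is a compact set $K\subset M$ such that $M\setminus K$ is diffeomorphic to $\mathbb R^3$ minus an open ball; (ii) in the induced spherical coordinates, $g=dr^2+\sinh^2 r\,g_0+h/(3\sinh r)+Q$, where $h$ is a symmetric $2$-tensor on $S^2$ and $|Q|+|DQ|+|D^2Q|+|D^3Q|\leq C\exp(-4r)$ for some constant $C$. Its mass (when $R\ge -6$) is $$\mathcal M=\frac1{16\pi}\left[\left(\int_{S^2}\mathrm{tr}_{g_0}h\,d\mu_0\right)^2-\sum_{i=1}^3\left(\int_{S^2}\mathrm{tr}_{g_0}h\;x_i\,d\mu_0\right)^2\right]^{1/2}.$$ $H$ is the mean curvature with respect to the exterior unit normal and $|\Sigma_0|$ is the area. A sphere $\Sigma_0\subset M$ with $H(\Sigma_0)=2$ is outermost if it is the boundary of a compact set and the region outside it contains no other spheres with $H=2$. The Anti-de Sitter-Schwarzschild manifold of parameter $m$ is $S^2\times[t_0,\infty)$ with metric $g_m=\frac{dt^2}{1+t^2-m/t}+t^2g_0$, where $t_0$ is chosen so that $\{t=t_0\}$ has mean curvature $2$. *)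

theory Defs
  imports "HOL-Analysis.Analysis"
begin

section \<open>Calculus on subsets of Euclidean space\<close>

text \<open>
  All derivatives are taken within the domain \<open>U\<close>. For the domains that occur below (open sets,
  relatively open subsets of half-spaces, exteriors of balls) the derivative within \<open>U\<close> is
  unique, also at boundary points.
\<close>

definition partial_deriv ::
  "(real^'n) set \<Rightarrow> 'n::finite \<Rightarrow> (real^'n \<Rightarrow> 'b::real_normed_vector) \<Rightarrow> real^'n \<Rightarrow> 'b" where
  "partial_deriv U i F x = frechet_derivative F (at x within U) (axis i 1)"

primrec Ck_on ::
  "nat \<Rightarrow> (real^'n::finite) set \<Rightarrow> (real^'n \<Rightarrow> 'b::real_normed_vector) \<Rightarrow> bool" where
  "Ck_on 0 U F = continuous_on U F"
| "Ck_on (Suc k) U F = (F differentiable_on U \<and> (\<forall>i. Ck_on k U (partial_deriv U i F)))"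

text \<open>Smoothness on a set that need not be open: local extendability to a smooth function.\<close>

definition smooth_on :: "(real^'n::finite) set \<Rightarrow> (real^'n \<Rightarrow> 'b::real_normed_vector) \<Rightarrow> bool" where
  "smooth_on U F \<longleftrightarrow>
     (\<forall>x\<in>U. \<exists>V G. open V \<and> x \<in> V \<and> (\<forall>k. Ck_on k V G) \<and> (\<forall>y\<in>U \<inter> V. G y = F y))"


section \<open>Curvature in local coordinates\<close>

definition sym_pos_def :: "real^'n^'n::finite \<Rightarrow> bool" where
  "sym_pos_def A \<longleftrightarrow> transpose A = A \<and> (\<forall>v. v \<noteq> 0 \<longrightarrow> v \<bullet> (A *v v) > 0)"

text \<open>\<open>christoffel U G k i j\<close> is \<open>\<Gamma>\<close> with upper index \<open>k\<close> and lower indices \<open>i j\<close>.\<close>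

definition christoffel ::
  "(real^'n) set \<Rightarrow> (real^'n \<Rightarrow> real^'n^'n) \<Rightarrow> 'n::finite \<Rightarrow> 'n \<Rightarrow> 'n \<Rightarrow> real^'n \<Rightarrow> real" where
  "christoffel U G k i j x =
     1/2 * (\<Sum>l\<in>UNIV. matrix_inv (G x) $ k $ l *
       (partial_deriv U i (\<lambda>z. G z $ j $ l) x
        + partial_deriv U j (\<lambda>z. G z $ i $ l) x
        - partial_deriv U l (\<lambda>z. G z $ i $ j) x))"

text \<open>\<open>riemann U G l k i j\<close> is the \<open>l\<close>-th component of \<open>R(\<partial>\<^sub>i, \<partial>\<^sub>j) \<partial>\<^sub>k\<close>, where
  \<open>R(X,Y)Z = \<nabla>\<^sub>X \<nabla>\<^sub>Y Z - \<nabla>\<^sub>Y \<nabla>\<^sub>X Z - \<nabla>\<^sub>[\<^sub>X\<^sub>,\<^sub>Y\<^sub>] Z\<close>.\<close>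

definition riemann ::
  "(real^'n) set \<Rightarrow> (real^'n \<Rightarrow> real^'n^'n) \<Rightarrow> 'n::finite \<Rightarrow> 'n \<Rightarrow> 'n \<Rightarrow> 'n \<Rightarrow> real^'n \<Rightarrow> real" where
  "riemann U G l k i j x =
     partial_deriv U i (christoffel U G l j k) x - partial_deriv U j (christoffel U G l i k) x
     + (\<Sum>m\<in>UNIV. christoffel U G l i m x * christoffel U G m j k x
                - christoffel U G l j m x * christoffel U G m i k x)"

definition scalar_curv ::
  "(real^'n) set \<Rightarrow> (real^'n \<Rightarrow> real^'n^'n) \<Rightarrow> real^'n::finite \<Rightarrow> real" where
  "scalar_curv U G x =
     (\<Sum>j\<in>UNIV. \<Sum>k\<in>UNIV. matrix_inv (G x) $ j $ k * (\<Sum>i\<in>UNIV. riemann U G i k i j x))"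

text \<open>\<open>\<langle>R(\<partial>\<^sub>1,\<partial>\<^sub>2)\<partial>\<^sub>2, \<partial>\<^sub>1\<rangle> / det G\<close>\<close>

definition gauss_curv ::
  "(real^2) set \<Rightarrow> (real^2 \<Rightarrow> real^2^2) \<Rightarrow> real^2 \<Rightarrow> real" where
  "gauss_curv U G x = (\<Sum>l\<in>UNIV. G x $ 1 $ l * riemann U G l 2 1 2 x) / det (G x)"

text \<open>
  Mean curvature, at the parameter \<open>y \<in> W\<close>, of the immersed hypersurface \<open>F : W \<rightarrow> (U,G)\<close> with
  respect to the unit normal \<open>v\<close>: the trace of \<open>- \<langle>\<nabla>\<^sub>a \<partial>\<^sub>b F, v\<rangle>\<close>, i.e. the divergence
  of the normal. A sphere of radius \<open>r\<close> in flat space has mean curvature \<open>2/r\<close> with respect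
  to the outward normal.
\<close>

definition mean_curv ::
  "(real^'n) set \<Rightarrow> (real^'n \<Rightarrow> real^'n^'n) \<Rightarrow> (real^'m) set \<Rightarrow> (real^'m \<Rightarrow> real^'n)
     \<Rightarrow> real^'n::finite \<Rightarrow> real^'m::finite \<Rightarrow> real" where
  "mean_curv U G W F v y =
     (let J = jacobian F (at y within W);
          \<gamma> = transpose J ** G (F y) ** J
      in - (\<Sum>a\<in>UNIV. \<Sum>b\<in>UNIV. matrix_inv \<gamma> $ a $ b *
             (\<Sum>k\<in>UNIV. (G (F y) *v v) $ k *
               (partial_deriv W a (partial_deriv W b (\<lambda>z. F z $ k)) y
                + (\<Sum>i\<in>UNIV. \<Sum>j\<in>UNIV.
                     christoffel U G k i j (F y) * (J $ i $ a) * (J $ j $ b))))))"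

definition is_unit_normal ::
  "(real^'n \<Rightarrow> real^'n^'n) \<Rightarrow> (real^'m) set \<Rightarrow> (real^'m \<Rightarrow> real^'n)
     \<Rightarrow> real^'n::finite \<Rightarrow> real^'m::finite \<Rightarrow> bool" where
  "is_unit_normal G W F v y \<longleftrightarrow>
     v \<bullet> (G (F y) *v v) = 1 \<and> transpose (jacobian F (at y within W)) *v (G (F y) *v v) = 0"

text \<open>
  A covariant tensor field of rank \<open>k\<close> is represented by its components
  \<open>T x [i\<^sub>1, \<dots>, i\<^sub>k]\<close>; the covariant derivative puts the new index first.
\<close>

definition cov_deriv ::
  "(real^'n) set \<Rightarrow> (real^'n \<Rightarrow> real^'n^'n) \<Rightarrow> (real^'n \<Rightarrow> 'n list \<Rightarrow> real)
     \<Rightarrow> real^'n \<Rightarrow> 'n::finite list \<Rightarrow> real" where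
  "cov_deriv U G T x I =
     partial_deriv U (hd I) (\<lambda>z. T z (tl I)) x
     - (\<Sum>s<length (tl I). \<Sum>l\<in>UNIV.
          christoffel U G l (hd I) (tl I ! s) x * T x ((tl I)[s := l]))"

definition tensor_norm ::
  "(real^'n \<Rightarrow> real^'n^'n) \<Rightarrow> nat \<Rightarrow> (real^'n \<Rightarrow> 'n list \<Rightarrow> real) \<Rightarrow> real^'n::finite \<Rightarrow> real" where
  "tensor_norm G k T x =
     sqrt (\<Sum>I\<in>{I. length I = k}. \<Sum>J\<in>{J. length J = k}.
             (\<Prod>s<k. matrix_inv (G x) $ (I ! s) $ (J ! s)) * T x I * T x J)"


section \<open>Smooth manifolds with boundary\<close>

type_synonym ('a, 'n) chart = "'a set \<times> ('a \<Rightarrow> real^'n)"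

record ('a, 'n::finite) manifold =
  mtop :: "'a topology"
  charts :: "('a, 'n) chart set"

definition cimage :: "('a, 'n::finite) chart \<Rightarrow> (real^'n) set" where
  "cimage c = snd c ` fst c"

definition cinv :: "('a, 'n::finite) chart \<Rightarrow> real^'n \<Rightarrow> 'a" where
  "cinv c = inv_into (fst c) (snd c)"

definition smooth_manifold :: "('a, 'n::finite) manifold \<Rightarrow> bool" where
  "smooth_manifold M \<longleftrightarrow>
     Hausdorff_space (mtop M) \<and> second_countable (mtop M) \<and>
     \<Union> (fst ` charts M) = topspace (mtop M) \<and>
     (\<forall>c\<in>charts M.
        openin (mtop M) (fst c) \<and>
        (open (cimage c) \<or> (\<exists>k. openin (top_of_set {y. 0 \<le> y $ k}) (cimage c))) \<and>
        homeomorphic_map (subtopology (mtop M) (fst c)) (top_of_set (cimage c)) (snd c)) \<and>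
     (\<forall>c\<in>charts M. \<forall>c'\<in>charts M. smooth_on (snd c ` (fst c \<inter> fst c')) (snd c' \<circ> cinv c))"

definition boundary :: "('a, 'n::finite) manifold \<Rightarrow> 'a set" where
  "boundary M = {p. \<exists>c\<in>charts M. p \<in> fst c \<and> snd c p \<notin> interior (cimage c)}"

definition chart_at :: "('a, 'n::finite) manifold \<Rightarrow> 'a \<Rightarrow> ('a, 'n) chart" where
  "chart_at M p = (SOME c. c \<in> charts M \<and> p \<in> fst c)"

definition smooth_into ::
  "('a, 'n::finite) manifold \<Rightarrow> (real^'m::finite) set \<Rightarrow> (real^'m \<Rightarrow> 'a) \<Rightarrow> bool" where
  "smooth_into M U Y \<longleftrightarrow>
     continuous_map (top_of_set U) (mtop M) Y \<and>
     (\<forall>c\<in>charts M. smooth_on {z\<in>U. Y z \<in> fst c} (snd c \<circ> Y))"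

definition smooth_map ::
  "('a, 'm::finite) manifold \<Rightarrow> ('b, 'n::finite) manifold \<Rightarrow> ('a \<Rightarrow> 'b) \<Rightarrow> bool" where
  "smooth_map N M \<iota> \<longleftrightarrow>
     continuous_map (mtop N) (mtop M) \<iota> \<and> (\<forall>c\<in>charts N. smooth_into M (cimage c) (\<iota> \<circ> cinv c))"

definition smooth_fun :: "('a, 'n::finite) manifold \<Rightarrow> ('a \<Rightarrow> 'b::real_normed_vector) \<Rightarrow> bool" where
  "smooth_fun M f \<longleftrightarrow> (\<forall>c\<in>charts M. smooth_on (cimage c) (f \<circ> cinv c))"


section \<open>Riemannian metrics\<close>

text \<open>
  A metric is given by its component matrix in each chart; \<open>pullback\<close> expresses it in the
  coordinates provided by a map \<open>Y : U \<rightarrow> M\<close>.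
\<close>

type_synonym ('a, 'n) metric_field = "('a, 'n) chart \<Rightarrow> real^'n \<Rightarrow> real^'n^'n"

definition pullback ::
  "('a, 'n::finite) manifold \<Rightarrow> ('a, 'n) metric_field
     \<Rightarrow> (real^'m::finite) set \<Rightarrow> (real^'m \<Rightarrow> 'a) \<Rightarrow> real^'m \<Rightarrow> real^'m^'m" where
  "pullback M g U Y x =
     (let c = chart_at M (Y x);
          J = jacobian (snd c \<circ> Y) (at x within {z\<in>U. Y z \<in> fst c})
      in transpose J ** g c (snd c (Y x)) ** J)"

definition riemannian :: "('a, 'n::finite) manifold \<Rightarrow> ('a, 'n) metric_field \<Rightarrow> bool" where
  "riemannian M g \<longleftrightarrow>
     (\<forall>c\<in>charts M. smooth_on (cimage c) (g c) \<and> (\<forall>x\<in>cimage c. sym_pos_def (g c x))) \<and>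
     (\<forall>c\<in>charts M. \<forall>c'\<in>charts M. \<forall>p\<in>fst c \<inter> fst c'.
        (let J = jacobian (snd c' \<circ> cinv c) (at (snd c p) within snd c ` (fst c \<inter> fst c'))
         in g c (snd c p) = transpose J ** g c' (snd c' p) ** J))"

definition C1_curve :: "('a, 'n::finite) manifold \<Rightarrow> (real \<Rightarrow> 'a) \<Rightarrow> bool" where
  "C1_curve M \<gamma> \<longleftrightarrow>
     continuous_map (top_of_set {0..1}) (mtop M) \<gamma> \<and>
     (\<forall>c\<in>charts M. let T = {t\<in>{0..1}. \<gamma> t \<in> fst c} in
        \<exists>v. continuous_on T v \<and>
            (\<forall>t\<in>T. ((snd c \<circ> \<gamma>) has_vector_derivative v t) (at t within T)))"

definition speed ::
  "('a, 'n::finite) manifold \<Rightarrow> ('a, 'n) metric_field \<Rightarrow> (real \<Rightarrow> 'a) \<Rightarrow> real \<Rightarrow> real" where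
  "speed M g \<gamma> t =
     (let c = chart_at M (\<gamma> t);
          v = vector_derivative (snd c \<circ> \<gamma>) (at t within {s\<in>{0..1}. \<gamma> s \<in> fst c})
      in sqrt (v \<bullet> (g c (snd c (\<gamma> t)) *v v)))"

definition riem_dist ::
  "('a, 'n::finite) manifold \<Rightarrow> ('a, 'n) metric_field \<Rightarrow> 'a \<Rightarrow> 'a \<Rightarrow> real" where
  "riem_dist M g p q =
     Inf {integral {0..1} (speed M g \<gamma>) | \<gamma>. C1_curve M \<gamma> \<and> \<gamma> 0 = p \<and> \<gamma> 1 = q}"

definition complete_riemannian ::
  "('a, 'n::finite) manifold \<Rightarrow> ('a, 'n) metric_field \<Rightarrow> bool" where
  "complete_riemannian M g \<longleftrightarrow> Metric_space.mcomplete (topspace (mtop M)) (riem_dist M g)"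

definition scalar_curvature ::
  "('a, 'n::finite) manifold \<Rightarrow> ('a, 'n) metric_field \<Rightarrow> 'a \<Rightarrow> real" where
  "scalar_curvature M g p =
     (let c = chart_at M p in scalar_curv (cimage c) (g c) (snd c p))"

definition gauss_curvature :: "('a, 2) manifold \<Rightarrow> ('a, 2) metric_field \<Rightarrow> 'a \<Rightarrow> real" where
  "gauss_curvature S g p =
     (let c = chart_at S p in gauss_curv (cimage c) (g c) (snd c p))"


section \<open>The round sphere\<close>

text \<open>Stereographic projections from the poles \<open>(0,0,1)\<close> and \<open>(0,0,-1)\<close>\<close>

definition stereo_chart :: "real \<Rightarrow> (real^3, 2) chart" where
  "stereo_chart s =
     (sphere 0 1 - {vector [0, 0, s]}, \<lambda>p. vector [p $ 1 / (1 - s * p $ 3), p $ 2 / (1 - s * p $ 3)])"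

definition S2 :: "(real^3, 2) manifold" where
  "S2 = \<lparr> mtop = top_of_set (sphere 0 1), charts = {stereo_chart 1, stereo_chart (-1)} \<rparr>"

text \<open>The metric induced from the Euclidean metric of the ambient space\<close>

definition round_metric :: "(real^3, 2) metric_field" where
  "round_metric c y =
     (let J = jacobian (cinv c) (at y within cimage c) in transpose J ** J)"

definition conformal_metric :: "(real^3 \<Rightarrow> real) \<Rightarrow> (real^3, 2) metric_field" where
  "conformal_metric f c y = exp (2 * f (cinv c y)) *\<^sub>R round_metric c y"

text \<open>Integral against the area form of a metric on the sphere; the chart misses only one
  point.\<close>

definition area_integral :: "(real^3, 2) metric_field \<Rightarrow> (real^3 \<Rightarrow> real) \<Rightarrow> real" where
  "area_integral g F =
     (let c = stereo_chart 1
      in integral\<^sup>L lborel (\<lambda>y. F (cinv c y) * sqrt (det (g c y))))"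

abbreviation sphere_integral :: "(real^3 \<Rightarrow> real) \<Rightarrow> real" where
  "sphere_integral \<equiv> area_integral round_metric"


section \<open>Embedded spheres\<close>

definition embedded_sphere :: "('a, 3) manifold \<Rightarrow> (real^3 \<Rightarrow> 'a) \<Rightarrow> bool" where
  "embedded_sphere M \<iota> \<longleftrightarrow>
     smooth_map S2 M \<iota> \<and> inj_on \<iota> (sphere 0 1) \<and>
     (\<forall>c\<in>charts S2. \<forall>c'\<in>charts M. \<forall>q\<in>fst c. \<iota> q \<in> fst c' \<longrightarrow>
        inj (frechet_derivative (snd c' \<circ> \<iota> \<circ> cinv c)
               (at (snd c q) within {y\<in>cimage c. \<iota> (cinv c y) \<in> fst c'})))"

definition surface_area ::
  "('a, 3) manifold \<Rightarrow> ('a, 3) metric_field \<Rightarrow> (real^3 \<Rightarrow> 'a) \<Rightarrow> real" where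
  "surface_area M g \<iota> =
     area_integral (\<lambda>c. pullback M g (cimage c) (\<iota> \<circ> cinv c)) (\<lambda>_. 1)"

text \<open>The part of \<open>M - \<Sigma>\<close> that reaches infinity, i.e. the union of the components of
  \<open>M - \<Sigma>\<close> that are not relatively compact\<close>

definition exterior :: "('a, 'n::finite) manifold \<Rightarrow> 'a set \<Rightarrow> 'a set" where
  "exterior M \<Sigma> =
     {p \<in> topspace (mtop M) - \<Sigma>.
        \<not> compactin (mtop M) (mtop M closure_of
             connected_component_of_set (subtopology (mtop M) (topspace (mtop M) - \<Sigma>)) p)}"

text \<open>
  \<open>H = H0\<close> on the embedded sphere \<open>\<iota>\<close>, with respect to the unit normal pointing into the
  exterior.
\<close>

definition has_mean_curvature ::
  "('a, 3) manifold \<Rightarrow> ('a, 3) metric_field \<Rightarrow> (real^3 \<Rightarrow> 'a) \<Rightarrow> real \<Rightarrow> bool" where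
  "has_mean_curvature M g \<iota> H0 \<longleftrightarrow>
     (\<forall>q\<in>sphere 0 1.
        let c = chart_at S2 q;
            c' = chart_at M (\<iota> q);
            W = {y\<in>cimage c. \<iota> (cinv c y) \<in> fst c'};
            F = snd c' \<circ> \<iota> \<circ> cinv c;
            y = snd c q
        in \<exists>v. is_unit_normal (g c') W F v y \<and>
               (\<forall>\<^sub>F t in at_right 0.
                  F y + t *\<^sub>R v \<in> cimage c' \<and>
                  cinv c' (F y + t *\<^sub>R v) \<in> exterior M (\<iota> ` sphere 0 1)) \<and>
               mean_curv (cimage c') (g c') W F v y = H0)"

text \<open>
  The compact set \<open>\<Omega>\<close> contains the boundary of \<open>M\<close>, so that the region outside \<open>\<Sigma>\<close> has no other
  boundary than \<open>\<Sigma>\<close>; if \<open>\<Sigma>\<close> is itself the boundary of \<open>M\<close>, then \<open>\<Omega> = \<Sigma>\<close>. The last condition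
  excludes the degenerate choice \<open>\<Omega> = \<Sigma>\<close> for \<open>\<Sigma>\<close> in the interior of \<open>M\<close>.
\<close>

definition bounds_compact_set :: "('a, 3) manifold \<Rightarrow> 'a set \<Rightarrow> bool" where
  "bounds_compact_set M \<Sigma> \<longleftrightarrow>
     (\<exists>\<Omega>. compactin (mtop M) \<Omega> \<and> boundary M \<subseteq> \<Omega> \<and> mtop M frontier_of \<Omega> = \<Sigma> \<and>
          \<Sigma> - boundary M \<subseteq> mtop M closure_of (mtop M interior_of \<Omega>))"

definition outermost ::
  "('a, 3) manifold \<Rightarrow> ('a, 3) metric_field \<Rightarrow> (real^3 \<Rightarrow> 'a) \<Rightarrow> bool" where
  "outermost M g \<iota> \<longleftrightarrow>
     embedded_sphere M \<iota> \<and> has_mean_curvature M g \<iota> 2 \<and>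
     bounds_compact_set M (\<iota> ` sphere 0 1) \<and>
     (\<forall>\<kappa>. embedded_sphere M \<kappa> \<and> has_mean_curvature M g \<kappa> 2 \<and>
          \<kappa> ` sphere 0 1 \<subseteq> exterior M (\<iota> ` sphere 0 1) \<union> \<iota> ` sphere 0 1
          \<longrightarrow> \<kappa> ` sphere 0 1 = \<iota> ` sphere 0 1)"


section \<open>Asymptotically hyperbolic manifolds\<close>

text \<open>
  Polar coordinates \<open>x = r \<omega>\<close> on the punctured space: the Cartesian components of \<open>dr\<^sup>2\<close> and
  of the pullback of the round metric under \<open>x \<mapsto> x / |x|\<close>.
\<close>

definition dr_sq :: "real^3 \<Rightarrow> real^3^3" where
  "dr_sq x = (\<chi> i j. x $ i * x $ j / (norm x)\<^sup>2)"

definition polar_round :: "real^3 \<Rightarrow> real^3^3" where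
  "polar_round x = (1 / (norm x)\<^sup>2) *\<^sub>R (mat 1 - dr_sq x)"

definition hyperbolic_metric :: "real^3 \<Rightarrow> real^3^3" where
  "hyperbolic_metric x = dr_sq x + (sinh (norm x))\<^sup>2 *\<^sub>R polar_round x"

text \<open>
  A symmetric 2-tensor on the sphere is represented by the symmetric bilinear forms on the
  ambient space that extend it by zero in the normal direction. Its pullback under
  \<open>x \<mapsto> x / |x|\<close> then has components \<open>h (x/|x|) / |x|\<^sup>2\<close>, and its trace with respect to the round
  metric is the trace of the matrix.
\<close>

definition sphere_sym_tensor :: "(real^3 \<Rightarrow> real^3^3) \<Rightarrow> bool" where
  "sphere_sym_tensor h \<longleftrightarrow>
     smooth_fun S2 h \<and> (\<forall>\<omega>\<in>sphere 0 1. transpose (h \<omega>) = h \<omega> \<and> h \<omega> *v \<omega> = 0)"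

definition polar_pullback :: "(real^3 \<Rightarrow> real^3^3) \<Rightarrow> real^3 \<Rightarrow> real^3^3" where
  "polar_pullback h x = (1 / (norm x)\<^sup>2) *\<^sub>R h ((1 / norm x) *\<^sub>R x)"

text \<open>
  \<open>Y\<close> is the inverse of the diffeomorphism from \<open>M - K\<close> onto the complement \<open>U\<close> of a ball. The
  ball may be open or closed: if \<open>M\<close> has no boundary, then \<open>M - K\<close> can only be the complement of
  a closed ball. Norms and covariant derivatives of \<open>Q\<close> are those of the hyperbolic metric.
\<close>

definition asymptotically_hyperbolic ::
  "('a, 3) manifold \<Rightarrow> ('a, 3) metric_field \<Rightarrow> (real^3 \<Rightarrow> real^3^3) \<Rightarrow> bool" where
  "asymptotically_hyperbolic M g h \<longleftrightarrow>
     smooth_manifold M \<and> riemannian M g \<and> connected_space (mtop M) \<and>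
     \<not> compact_space (mtop M) \<and> complete_riemannian M g \<and> compactin (mtop M) (boundary M) \<and>
     sphere_sym_tensor h \<and>
     (\<exists>K r0 U Y Q. compactin (mtop M) K \<and> 0 < r0 \<and> (U = - ball 0 r0 \<or> U = - cball 0 r0) \<and>
        homeomorphic_map (top_of_set U) (subtopology (mtop M) (topspace (mtop M) - K)) Y \<and>
        smooth_into M U Y \<and>
        (\<forall>c\<in>charts M. smooth_on (snd c ` (fst c - K)) (inv_into U Y \<circ> cinv c)) \<and>
        (\<forall>x\<in>U. pullback M g U Y x =
           hyperbolic_metric x + (1 / (3 * sinh (norm x))) *\<^sub>R polar_pullback h x + Q x) \<and>
        (\<exists>C. \<forall>x\<in>U.
           (\<Sum>k\<le>3. tensor_norm hyperbolic_metric (k + 2)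
              ((cov_deriv U hyperbolic_metric ^^ k) (\<lambda>z I. Q z $ (I ! 0) $ (I ! 1))) x)
           \<le> C * exp (- 4 * norm x)))"

definition ah_mass :: "(real^3 \<Rightarrow> real^3^3) \<Rightarrow> real" where
  "ah_mass h =
     1 / (16 * pi) * sqrt ((sphere_integral (\<lambda>\<omega>. trace (h \<omega>)))\<^sup>2
       - (\<Sum>i\<in>UNIV. (sphere_integral (\<lambda>\<omega>. trace (h \<omega>) * \<omega> $ i))\<^sup>2))"


section \<open>Anti-de Sitter-Schwarzschild manifolds and the Penrose inequality\<close>

text \<open>\<open>S\<^sup>2 \<times> [t0, \<infinity>)\<close> is identified with the complement of \<open>ball 0 t0\<close> by polar coordinates
  \<open>x = t \<omega>\<close>.\<close>

definition adss_metric :: "real \<Rightarrow> real^3 \<Rightarrow> real^3^3" where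
  "adss_metric m x =
     (let t = norm x in (1 / (1 + t\<^sup>2 - m / t)) *\<^sub>R dr_sq x + t\<^sup>2 *\<^sub>R polar_round x)"

text \<open>The sphere \<open>t = t0\<close> has mean curvature 2 with respect to the unit normal in direction of
  increasing \<open>t\<close>.\<close>

definition adss_inner_radius :: "real \<Rightarrow> real \<Rightarrow> bool" where
  "adss_inner_radius m t0 \<longleftrightarrow>
     0 < t0 \<and> (\<forall>t\<ge>t0. 0 < 1 + t\<^sup>2 - m / t) \<and>
     (\<forall>c\<in>charts S2. \<forall>y\<in>cimage c.
        let F = (\<lambda>z. t0 *\<^sub>R cinv c z);
            v = sqrt (1 + t0\<^sup>2 - m / t0) *\<^sub>R cinv c y
        in mean_curv (- ball 0 t0) (adss_metric m) (cimage c) F v y = 2)"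

definition isometric_to_adss_outside ::
  "('a, 3) manifold \<Rightarrow> ('a, 3) metric_field \<Rightarrow> 'a set \<Rightarrow> bool" where
  "isometric_to_adss_outside M g \<Sigma> \<longleftrightarrow>
     (\<exists>m t0 Y. adss_inner_radius m t0 \<and>
        homeomorphic_map (top_of_set (- ball 0 t0))
          (subtopology (mtop M) (exterior M \<Sigma> \<union> \<Sigma>)) Y \<and>
        smooth_into M (- ball 0 t0) Y \<and>
        (\<forall>x\<in>- ball 0 t0. pullback M g (- ball 0 t0) Y x = adss_metric m x))"

text \<open>
  Points of the manifolds quantified over are taken from the type \<open>real\<close>, used merely as a
  set of size continuum: \<open>mtop M\<close> is an arbitrary topology, unrelated to that of the real line.
  As second countable Hausdorff spaces have at most continuum many points, every manifold is
  isomorphic to one of this form.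
\<close>

definition penrose_inequality :: bool where
  "penrose_inequality \<longleftrightarrow>
     (\<forall>(M :: (real, 3) manifold) g h \<iota>.
        asymptotically_hyperbolic M g h \<and>
        (\<forall>p\<in>topspace (mtop M). scalar_curvature M g p \<ge> -6) \<and>
        outermost M g \<iota> \<longrightarrow>
        ah_mass h \<ge> sqrt (surface_area M g \<iota> / (16 * pi)) \<and>
        (ah_mass h = sqrt (surface_area M g \<iota> / (16 * pi)) \<longrightarrow>
           isometric_to_adss_outside M g (\<iota> ` sphere 0 1)))"

end

(*  Idea.  Write 4 pi P for the 4-vector whose components are the integrals of K_f exp(3f)
    against 1, x_1, x_2, x_3.  The claim is that P is timelike of Minkowski length at least 1,
    which follows once t P_0 - b.P >= 1 for every unit timelike (t,b) with t > 0.

    In the stereographic coordinate z, the weight t - b.x is a multiple of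
    (1 + a^2 |z - c|^2) / (1 + |z|^2) with a = t - b_3, so the affine substitution
    z |-> a (z - c), which is a conformal map of the sphere, reduces everything to (t,b) = (1,0).
    There the inequality reads avg w + avg |grad w|^2 / w >= (avg w^2)^(1/2) on the round sphere
    for w = exp f, and it follows by Cauchy-Schwarz from the L^1 Poincare inequality
    Var w <= (avg |grad w|)^2.

    The latter comes from an explicit kernel: with d = d/dz and d' = d/dq the mixed derivative
    d d' of (q - z) / ((cnj q - cnj z) (1 + |z|^2) (1 + |q|^2)) is, up to sign and a factor, the
    Dirac measure of the diagonal minus the normalised area form, while the kernel itself has
    modulus 1 / ((1 + |z|^2) (1 + |q|^2)).  Integrating by parts twice turns Var w into a double
    integral of dw(z) d'w(q) against a kernel of constant modulus relative to the metric.  *)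

theory Submission
  imports Defs "HOL-Real_Asymp.Real_Asymp"
begin

section \<open>Integration over the plane\<close>

text \<open>The affine maps z \<mapsto> a (z - c) with a > 0 correspond one to one to the unit
  timelike vectors with t > 0, so rotations of the sphere never enter. The price is analysis on a
  noncompact plane: every integration by parts needs decay at infinity, and that decay is read off
  from the opposite chart. Sobolev enters because K_f exp(3f) = w (1 - Lap ln w) for w = exp f and -
  w Lap ln w = - Lap w + |grad w|^2 / w, where Lap w integrates to zero. The Dirac measure is never
  handled as such. The variance is half the double average of (w z - w q)^2. This factor vanishes to
  second order on the diagonal and so tames the double pole in the derivative of the kernel. After
  the integration by parts in z one factor w z - w q is left; it suffices for the integration by
  parts in q, where the derivative of the kernel has only a simple pole. Cauchy-Schwarz is applied
  as (avg |grad w|)^2 \<le> avg w * avg (|grad w|^2 / w).\<close>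

lemma has_bochner_integral_FTC_line_nonneg:
  fixes F f :: "real \<Rightarrow> real"
  assumes der: "\<And>x. (F has_real_derivative f x) (at x)"
    and cont: "\<And>x. isCont f x" and nonneg: "\<And>x. f x \<ge> 0"
    and lim: "(F \<longlongrightarrow> A) at_bot" "(F \<longlongrightarrow> B) at_top"
  shows "has_bochner_integral lborel f (B - A)"
proof -
  have lims: "((F \<circ> real_of_ereal) \<longlongrightarrow> A) (at_right (-\<infinity>))" "((F \<circ> real_of_ereal) \<longlongrightarrow> B) (at_left \<infinity>)"
    using lim by (simp_all add: ereal_tendsto_simps1)
  have ae: "AE x in lborel. -\<infinity> < ereal x \<longrightarrow> ereal x < \<infinity> \<longrightarrow> 0 \<le> f x" using nonneg by simp
  have 1: "set_integrable lborel (einterval (-\<infinity>) \<infinity>) f"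
    using interval_integral_FTC_nonneg(1)[OF _ der cont ae lims] by simp
  have 2: "interval_lebesgue_integral lborel (-\<infinity>) \<infinity> f = B - A"
    using interval_integral_FTC_nonneg(2)[OF _ der cont ae lims] by simp
  show ?thesis using 1 2
    by (simp add: has_bochner_integral_iff set_integrable_def interval_lebesgue_integral_def set_lebesgue_integral_def)
qed

lemma integral_FTC_line:
  fixes F :: "real \<Rightarrow> 'a::euclidean_space"
  assumes der: "\<And>x. (F has_vector_derivative f x) (at x)"
    and cont: "\<And>x. isCont f x" and int: "integrable lborel f"
    and lim: "(F \<longlongrightarrow> A) at_bot" "(F \<longlongrightarrow> B) at_top"
  shows "integral\<^sup>L lborel f = B - A"
proof -
  have lims: "((F \<circ> real_of_ereal) \<longlongrightarrow> A) (at_right (-\<infinity>))" "((F \<circ> real_of_ereal) \<longlongrightarrow> B) (at_left \<infinity>)"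
    using lim by (simp_all add: ereal_tendsto_simps1)
  have "interval_lebesgue_integral lborel (-\<infinity>) \<infinity> f = B - A"
    by (rule interval_integral_FTC_integrable[OF _ der cont _ lims])
       (use int in \<open>simp_all add: set_integrable_def\<close>)
  then show ?thesis
    by (simp add: interval_lebesgue_integral_def set_lebesgue_integral_def)
qed

lemma measurable_case_prod_Complex [measurable]: "case_prod Complex \<in> borel \<rightarrow>\<^sub>M borel"
proof -
  have "continuous_on UNIV (\<lambda>p. Complex (fst p) (snd p))"
    by (intro continuous_intros)
  then show ?thesis by (simp add: case_prod_unfold borel_measurable_continuous_onI)
qed

text \<open>Both measures give a box the product of its side lengths. This transports Fubini from
  pairs of reals to \<open>complex\<close>.\<close>

lemma lborel_complex_eq: "(lborel :: complex measure) = distr lborel borel (case_prod Complex)"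
proof (rule lborel_eqI)
  fix l u :: complex
  assume le: "\<And>b. b \<in> Basis \<Longrightarrow> l \<bullet> b \<le> u \<bullet> b"
  have "case_prod Complex -` box l u = box (Re l, Im l) (Re u, Im u)"
    by (auto simp: box_def Basis_complex_def Basis_prod_def)
  then show "emeasure (distr lborel borel (case_prod Complex)) (box l u) = ennreal (prod ((\<bullet>) (u - l)) Basis)"
    using le[of 1] le[of \<i>]
    by (simp add: emeasure_distr emeasure_lborel_box_eq Basis_prod_def Basis_complex_def prod.union_disjoint inner_Pair)
qed simp

lemma nn_integral_complex:
  assumes [measurable]: "g \<in> borel_measurable borel"
  shows "(\<integral>\<^sup>+z. g z \<partial>lborel) = (\<integral>\<^sup>+y. \<integral>\<^sup>+x. g (Complex x y) \<partial>lborel \<partial>lborel)"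
proof -
  have "(\<integral>\<^sup>+z. g z \<partial>lborel) = (\<integral>\<^sup>+p. g (case_prod Complex p) \<partial>(lborel \<Otimes>\<^sub>M lborel))"
    by (subst lborel_complex_eq, subst nn_integral_distr) (auto simp: lborel_prod)
  also have "\<dots> = (\<integral>\<^sup>+y. \<integral>\<^sup>+x. g (Complex x y) \<partial>lborel \<partial>lborel)"
    by (subst lborel_pair.nn_integral_snd[symmetric]) (auto simp: lborel_prod)
  finally show ?thesis .
qed

lemma integrable_complex_iff:
  fixes g :: "complex \<Rightarrow> 'b::{banach,second_countable_topology}"
  assumes [measurable]: "g \<in> borel_measurable borel"
  shows "integrable lborel g \<longleftrightarrow> integrable (lborel \<Otimes>\<^sub>M lborel) (\<lambda>p. g (case_prod Complex p))"
  by (subst lborel_complex_eq, subst integrable_distr_eq) (auto simp: lborel_prod)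

text \<open>Both orders are recorded because a derivative in direction 1 has to be integrated along
  horizontal lines first and one in direction \<open>\<i>\<close> along vertical lines
  first.\<close>

lemma integral_complex_swap:
  fixes g :: "complex \<Rightarrow> 'b::{banach,second_countable_topology}"
  assumes "integrable lborel g"
  shows "integral\<^sup>L lborel g = (\<integral>y. \<integral>x. g (Complex x y) \<partial>lborel \<partial>lborel)" (is ?A)
    and "integral\<^sup>L lborel g = (\<integral>x. \<integral>y. g (Complex x y) \<partial>lborel \<partial>lborel)" (is ?B)
    and "AE y in lborel. integrable lborel (\<lambda>x. g (Complex x y))" (is ?C)
    and "AE x in lborel. integrable lborel (\<lambda>y. g (Complex x y))" (is ?D)
proof -
  have [measurable]: "g \<in> borel_measurable borel" using assms by auto
  have int: "integrable (lborel \<Otimes>\<^sub>M lborel) (\<lambda>p. g (case_prod Complex p))"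
    using integrable_complex_iff[THEN iffD1, OF _ assms] by simp
  then have int': "integrable (lborel \<Otimes>\<^sub>M lborel) (\<lambda>(x,y). g (Complex x y))"
    by (simp add: case_prod_unfold)
  have eq: "integral\<^sup>L lborel g = integral\<^sup>L (lborel \<Otimes>\<^sub>M lborel) (\<lambda>p. g (case_prod Complex p))"
    by (subst lborel_complex_eq, subst integral_distr) (auto simp: lborel_prod)
  show ?B using lborel_pair.integral_fst'[OF int] eq by simp
  show ?A using lborel_pair.Fubini_integral[OF int'] \<open>?B\<close> by simp
  show ?C using lborel_pair.AE_integrable_snd[OF int'] .
  show ?D using lborel_pair.AE_integrable_fst[OF int'] .
qed

text \<open>In the stereographic coordinate the round metric is \<open>(2 / wt z)\<^sup>2 |dz|\<^sup>2\<close>.\<close>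

abbreviation wt :: "complex \<Rightarrow> real" where "wt z \<equiv> 1 + (norm z)\<^sup>2"

lemma wt_pos: "wt z > 0" "wt z \<ge> 1"
  by (simp_all add: add_pos_nonneg)

section \<open>Integrals of negative powers of the weight\<close>

lemma has_bochner_integral_line_power_3_2:
  assumes "c > 0"
  shows "has_bochner_integral lborel (\<lambda>x::real. 1 / ((c + x\<^sup>2) * sqrt (c + x\<^sup>2))) (2 / c)"
proof -
  have pos: "c + x\<^sup>2 > 0" for x :: real using assms by (simp add: add_pos_nonneg)
  \<comment> \<open>The derivative of x / sqrt (c + x^2) is c / (c + x^2)^(3/2).\<close>
  define F where "F x = x / (c * sqrt (c + x\<^sup>2))" for x :: real
  have "has_bochner_integral lborel (\<lambda>x::real. 1 / ((c + x\<^sup>2) * sqrt (c + x\<^sup>2))) (inverse c - (- inverse c))"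
  proof (rule has_bochner_integral_FTC_line_nonneg)
    fix x :: real
    have s: "sqrt (c + x\<^sup>2) * sqrt (c + x\<^sup>2) = c + x\<^sup>2" "sqrt (c + x\<^sup>2) > 0" using pos[of x] by simp_all
    let ?S = "sqrt (c + x\<^sup>2)"
    have r: "((\<lambda>x. sqrt (c + x\<^sup>2)) has_real_derivative x / ?S) (at x)"
    proof (rule DERIV_cong)
      have "((\<lambda>x. c + x\<^sup>2) has_real_derivative 2 * x) (at x)"
        by (auto intro!: derivative_eq_intros)
      from DERIV_chain2[OF DERIV_real_sqrt[OF pos] this]
      show "((\<lambda>x. sqrt (c + x\<^sup>2)) has_real_derivative inverse ?S / 2 * (2 * x)) (at x)" .
    qed (simp add: field_simps)
    have 1: "(F has_real_derivative (1 * (c * ?S) - x * (c * (x / ?S))) / ((c * ?S) * (c * ?S))) (at x)"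
      unfolding F_def
      by (rule DERIV_divide[OF DERIV_ident DERIV_cmult[OF r]]) (use s assms in simp)
    have "1 * (c * ?S) - x * (c * (x / ?S)) = c * (?S * ?S - x * x) / ?S"
      using s by (simp add: field_simps)
    also have "\<dots> = c * c / ?S" unfolding s(1) by (simp add: power2_eq_square)
    finally have "(1 * (c * ?S) - x * (c * (x / ?S))) / ((c * ?S) * (c * ?S)) = (c * c / ?S) / ((c * c) * (?S * ?S))"
      by (simp add: mult_ac)
    also have "\<dots> = 1 / ((c + x\<^sup>2) * ?S)" unfolding s(1) using assms by simp
    finally show "(F has_real_derivative 1 / ((c + x\<^sup>2) * sqrt (c + x\<^sup>2))) (at x)"
      using 1 by simp
    show "isCont (\<lambda>x. 1 / ((c + x\<^sup>2) * sqrt (c + x\<^sup>2))) x"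
      using pos[of x] by (auto intro!: continuous_intros)
    show "0 \<le> 1 / ((c + x\<^sup>2) * sqrt (c + x\<^sup>2))" using pos[of x] by simp
  next
    show "(F \<longlongrightarrow> - inverse c) at_bot" unfolding F_def using assms by real_asymp
    show "(F \<longlongrightarrow> inverse c) at_top" unfolding F_def using assms by real_asymp
  qed
  then show ?thesis by (simp add: field_simps)
qed

lemma has_bochner_integral_line_power_2:
  assumes "c > 0"
  shows "has_bochner_integral lborel (\<lambda>x::real. 1 / (c\<^sup>2 + x\<^sup>2)\<^sup>2) (pi / (2 * c^3))"
proof -
  have pos: "c\<^sup>2 + x\<^sup>2 > 0" for x :: real using assms by (simp add: add_pos_nonneg)
  \<comment> \<open>The primitive given by the usual reduction formula for powers of a
    quadratic.\<close>
  define F where "F x = x / (2 * c\<^sup>2 * (c\<^sup>2 + x\<^sup>2)) + arctan (x / c) / (2 * c^3)" for x :: real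
  have "has_bochner_integral lborel (\<lambda>x::real. 1 / (c\<^sup>2 + x\<^sup>2)\<^sup>2) (pi * inverse (c^3) / 4 - (- (pi * inverse (c^3) / 4)))"
  proof (rule has_bochner_integral_FTC_line_nonneg)
    fix x :: real
    let ?u = "c\<^sup>2 + x\<^sup>2"
    have u: "?u \<noteq> 0" using pos[of x] by linarith
    have r: "((\<lambda>x. c\<^sup>2 + x\<^sup>2) has_real_derivative 2 * x) (at x)"
      by (auto intro!: derivative_eq_intros)
    have 1: "((\<lambda>x. x / (2 * c\<^sup>2 * (c\<^sup>2 + x\<^sup>2))) has_real_derivative
        (1 * (2 * c\<^sup>2 * ?u) - x * (2 * c\<^sup>2 * (2 * x))) / ((2 * c\<^sup>2 * ?u) * (2 * c\<^sup>2 * ?u))) (at x)"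
      by (rule DERIV_divide[OF DERIV_ident DERIV_cmult[OF r]]) (use u assms in simp)
    have "((\<lambda>x. arctan (x / c)) has_real_derivative inverse (1 + (x/c)\<^sup>2) * (1/c)) (at x)"
      by (rule DERIV_chain2[OF DERIV_arctan DERIV_cdivide[OF DERIV_ident]])
    from DERIV_add[OF 1 DERIV_cdivide[OF this, of "2 * c^3"]]
    have 2: "(F has_real_derivative (1 * (2 * c\<^sup>2 * ?u) - x * (2 * c\<^sup>2 * (2 * x))) / ((2 * c\<^sup>2 * ?u) * (2 * c\<^sup>2 * ?u))
         + inverse (1 + (x/c)\<^sup>2) * (1/c) / (2 * c^3)) (at x)"
      unfolding F_def .
    have "1 + (x/c)\<^sup>2 = ?u / c\<^sup>2" using assms by (simp add: field_simps)
    then have 3: "inverse (1 + (x/c)\<^sup>2) * (1/c) / (2 * c^3) = ?u / (2 * c\<^sup>2 * ?u\<^sup>2)"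
      using assms u by (simp add: power2_eq_square power3_eq_cube)
    have "1 * (2 * c\<^sup>2 * ?u) - x * (2 * c\<^sup>2 * (2 * x)) = 2 * c\<^sup>2 * (c\<^sup>2 - x\<^sup>2)"
      by (simp add: algebra_simps power2_eq_square)
    then have 4: "(1 * (2 * c\<^sup>2 * ?u) - x * (2 * c\<^sup>2 * (2 * x))) / ((2 * c\<^sup>2 * ?u) * (2 * c\<^sup>2 * ?u))
       = (c\<^sup>2 - x\<^sup>2) / (2 * c\<^sup>2 * ?u\<^sup>2)"
    proof -
      have "A * B / ((A * v) * (A * v)) = B / (A * v\<^sup>2)" if "A \<noteq> 0" for A B v :: real
        using that by (simp add: power2_eq_square mult_ac)
      from this[of "2 * c\<^sup>2" "c\<^sup>2 - x\<^sup>2" ?u] show ?thesis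
        using assms \<open>1 * (2 * c\<^sup>2 * ?u) - x * (2 * c\<^sup>2 * (2 * x)) = 2 * c\<^sup>2 * (c\<^sup>2 - x\<^sup>2)\<close> by simp
    qed
    have "(c\<^sup>2 - x\<^sup>2) / (2 * c\<^sup>2 * ?u\<^sup>2) + ?u / (2 * c\<^sup>2 * ?u\<^sup>2) = (2 * c\<^sup>2) / (2 * c\<^sup>2 * ?u\<^sup>2)"
      unfolding add_divide_distrib[symmetric] by simp
    also have "\<dots> = 1 / ?u\<^sup>2" using assms by simp
    finally show "(F has_real_derivative 1 / (c\<^sup>2 + x\<^sup>2)\<^sup>2) (at x)"
      using 2 unfolding 3 4 by simp
    show "isCont (\<lambda>x. 1 / (c\<^sup>2 + x\<^sup>2)\<^sup>2) x"
      using pos[of x] by (auto intro!: continuous_intros)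
    show "0 \<le> 1 / (c\<^sup>2 + x\<^sup>2)\<^sup>2" by simp
  next
    show "(F \<longlongrightarrow> - (pi * inverse (c^3) / 4)) at_bot" unfolding F_def using assms by real_asymp
    show "(F \<longlongrightarrow> pi * inverse (c^3) / 4) at_top" unfolding F_def using assms by real_asymp
  qed
  then show ?thesis by (simp add: inverse_eq_divide)
qed

lemma nn_integral_eq_has_bochner:
  assumes "has_bochner_integral M f (r::real)" "\<And>x. f x \<ge> 0"
  shows "(\<integral>\<^sup>+x. ennreal (f x) \<partial>M) = ennreal r"
  using nn_integral_eq_integral[of M f] assms by (simp add: has_bochner_integral_iff)

text \<open>A quarter of the area of the unit sphere. Integrating in x with c = sqrt (1 + y^2)
  leaves a multiple of (1 + y^2)^(-3/2), which is the preceding line integral with c = 1.\<close>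

lemma has_bochner_integral_wt_power_2:
  "has_bochner_integral lborel (\<lambda>z. 1 / (wt z)\<^sup>2) pi"
proof (rule has_bochner_integral_nn_integral)
  have sq: "wt (Complex x y) = (sqrt (1 + y\<^sup>2))\<^sup>2 + x\<^sup>2" for x y
    by (simp add: cmod_power2 add_nonneg_nonneg)
  have c3: "sqrt (1 + y\<^sup>2) ^ 3 = (1 + y\<^sup>2) * sqrt (1 + y\<^sup>2)" for y :: real
    by (simp add: power3_eq_cube)
  have "(\<integral>\<^sup>+z. ennreal (1 / (wt z)\<^sup>2) \<partial>lborel) = (\<integral>\<^sup>+y. \<integral>\<^sup>+x. ennreal (1 / (wt (Complex x y))\<^sup>2) \<partial>lborel \<partial>lborel)"
    by (rule nn_integral_complex) simp
  also have "\<dots> = (\<integral>\<^sup>+y. ennreal (pi / 2 * (1 / ((1 + y\<^sup>2) * sqrt (1 + y\<^sup>2)))) \<partial>lborel)"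
  proof (rule nn_integral_cong)
    fix y :: real
    have "sqrt (1 + y\<^sup>2) > 0" by (simp add: add_pos_nonneg)
    from nn_integral_eq_has_bochner[OF has_bochner_integral_line_power_2[OF this]]
    show "(\<integral>\<^sup>+x. ennreal (1 / (wt (Complex x y))\<^sup>2) \<partial>lborel) = ennreal (pi / 2 * (1 / ((1 + y\<^sup>2) * sqrt (1 + y\<^sup>2))))"
      unfolding sq by (simp add: c3)
  qed
  also have "\<dots> = ennreal pi"
    using nn_integral_eq_has_bochner[OF has_bochner_integral_mult_right[OF has_bochner_integral_line_power_3_2[of 1], where c = "pi / 2"]]
    by (simp add: add_nonneg_nonneg)
  finally show "(\<integral>\<^sup>+z. ennreal (1 / (wt z)\<^sup>2) \<partial>lborel) = ennreal pi" .
qed auto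

text \<open>The decay |z|^(-3) is that of second derivatives of a smooth function on the sphere.
  This function dominates every derivative that is integrated below.\<close>

lemma integrable_wt_power_3_2: "integrable lborel (\<lambda>z. 1 / (wt z * sqrt (wt z)))"
proof -
  have sq: "wt (Complex x y) = (1 + y\<^sup>2) + x\<^sup>2" for x y
    by (simp add: cmod_power2)
  have "has_bochner_integral lborel (\<lambda>x::real. 1 / (1 + x\<^sup>2)) (pi/2 - (- (pi/2)))"
  proof (rule has_bochner_integral_FTC_line_nonneg)
    fix x :: real
    have "1 + x\<^sup>2 > 0" by (simp add: add_pos_nonneg)
    then show "isCont (\<lambda>x. 1 / (1 + x\<^sup>2)) x" "0 \<le> 1 / (1 + x\<^sup>2)"
      by (auto intro!: continuous_intros)
    show "(arctan has_real_derivative 1 / (1 + x\<^sup>2)) (at x)"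
      using DERIV_arctan[of x] by (simp add: inverse_eq_divide)
  next
    show "(arctan \<longlongrightarrow> - (pi/2)) at_bot" by (rule tendsto_arctan_at_bot)
    show "(arctan \<longlongrightarrow> pi/2) at_top" by (rule tendsto_arctan_at_top)
  qed
  note 1 = nn_integral_eq_has_bochner[OF has_bochner_integral_mult_right[OF this, where c = 2]]
  have "has_bochner_integral lborel (\<lambda>z. 1 / (wt z * sqrt (wt z))) (2 * pi)"
  proof (rule has_bochner_integral_nn_integral)
    have "(\<integral>\<^sup>+z. ennreal (1 / (wt z * sqrt (wt z))) \<partial>lborel)
       = (\<integral>\<^sup>+y. \<integral>\<^sup>+x. ennreal (1 / (wt (Complex x y) * sqrt (wt (Complex x y)))) \<partial>lborel \<partial>lborel)"
      by (rule nn_integral_complex) simp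
    also have "\<dots> = (\<integral>\<^sup>+y. ennreal (2 * (1 / (1 + y\<^sup>2))) \<partial>lborel)"
    proof (rule nn_integral_cong)
      fix y :: real
      have "1 + y\<^sup>2 > 0" by (simp add: add_pos_nonneg)
      from nn_integral_eq_has_bochner[OF has_bochner_integral_line_power_3_2[OF this]] this
      show "(\<integral>\<^sup>+x. ennreal (1 / (wt (Complex x y) * sqrt (wt (Complex x y)))) \<partial>lborel) = ennreal (2 * (1 / (1 + y\<^sup>2)))"
        unfolding sq by (simp add: add_nonneg_nonneg)
    qed
    also have "\<dots> = ennreal (2 * pi)"
      using 1 by (simp add: add_nonneg_nonneg)
    finally show "(\<integral>\<^sup>+z. ennreal (1 / (wt z * sqrt (wt z))) \<partial>lborel) = ennreal (2 * pi)" .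
  qed auto
  then show ?thesis by (simp add: has_bochner_integral_iff)
qed

lemma sqrt_wt: "sqrt (wt z) \<ge> 1" "sqrt (wt z) * sqrt (wt z) = wt z" "(sqrt (wt z))\<^sup>2 = wt z"
  "sqrt (wt z) > 0" "norm z \<le> sqrt (wt z)"
  by (simp_all add: add_nonneg_nonneg add_pos_nonneg real_le_rsqrt)

lemma borel_measurable_continuous_except_point:
  fixes p :: complex and f :: "complex \<Rightarrow> complex"
  assumes "continuous_on (- {p}) f"
  shows "f \<in> borel_measurable borel"
  by (rule borel_measurable_continuous_countable_exceptions[of "{p}"]) (use assms in auto)

section \<open>Vanishing integrals of total derivatives\<close>

text \<open>
  The exceptional point \<open>p\<close> costs nothing: the fundamental theorem of calculus is applied on
  horizontal and vertical lines, almost all of which miss \<open>p\<close>.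
\<close>

context
  fixes \<phi> :: "complex \<Rightarrow> complex" and D :: "complex \<Rightarrow> complex \<Rightarrow> complex" and p :: complex and B C :: real
  assumes der: "\<And>z. z \<noteq> p \<Longrightarrow> (\<phi> has_derivative D z) (at z)"
    and cont: "\<And>h. continuous_on (- {p}) (\<lambda>z. D z h)"
    and bound: "\<And>z h. z \<noteq> p \<Longrightarrow> norm (D z h) \<le> C * norm h / (wt z * sqrt (wt z))"
    and decay: "\<And>z. z \<noteq> p \<Longrightarrow> norm (\<phi> z) \<le> B / sqrt (wt z)"
begin

lemma integrable_derivative: "integrable lborel (\<lambda>z. D z h)"
proof (rule Bochner_Integration.integrable_bound)
  show "integrable lborel (\<lambda>z. C * norm h * (1 / (wt z * sqrt (wt z))))"
    by (intro integrable_mult_right integrable_wt_power_3_2)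
  show "(\<lambda>z. D z h) \<in> borel_measurable lborel"
    using borel_measurable_continuous_except_point[OF cont] by simp
  have "AE z in lborel. z \<noteq> p" by (rule AE_lborel_singleton)
  then show "AE z in lborel. norm (D z h) \<le> norm (C * norm h * (1 / (wt z * sqrt (wt z))))"
  proof eventually_elim
    case (elim z)
    show ?case using order_trans[OF bound[OF elim, of h] abs_ge_self] by simp
  qed
qed

text \<open>For \<open>b\<close> orthogonal to the unit vector \<open>u\<close> one has |b + t u|^2
  = |b|^2 + t^2, so the decay of \<phi> makes both boundary terms on the line vanish.\<close>

lemma integral_derivative_line:
  assumes u: "norm u = 1" "b \<bullet> u = 0" and off: "\<And>t. b + t *\<^sub>R u \<noteq> p"
    and int: "integrable lborel (\<lambda>t. D (b + t *\<^sub>R u) u)"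
  shows "(\<integral>t. D (b + t *\<^sub>R u) u \<partial>lborel) = 0"
proof -
  have wt: "wt (b + t *\<^sub>R u) = 1 + ((norm b)\<^sup>2 + t\<^sup>2)" for t
    using u by (simp add: power2_norm_eq_inner inner_add_left inner_add_right inner_commute[of u b])
       (simp add: power2_eq_square flip: power2_norm_eq_inner)
  have "(\<integral>t. D (b + t *\<^sub>R u) u \<partial>lborel) = 0 - 0"
  proof (rule integral_FTC_line[OF _ _ int])
    fix t :: real
    have "((\<lambda>t. \<phi> (b + t *\<^sub>R u)) has_derivative (\<lambda>h. D (b + t *\<^sub>R u) (h *\<^sub>R u))) (at t)"
      by (rule has_derivative_compose[where f = "\<lambda>t. b + t *\<^sub>R u" and f' = "\<lambda>h. h *\<^sub>R u", OF _ der[OF off]])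
        (auto intro!: derivative_eq_intros)
    moreover have "D (b + t *\<^sub>R u) (h *\<^sub>R u) = h *\<^sub>R D (b + t *\<^sub>R u) u" for h
      using has_derivative_linear[OF der[OF off]] by (rule linear_cmul)
    ultimately show "((\<lambda>t. \<phi> (b + t *\<^sub>R u)) has_vector_derivative D (b + t *\<^sub>R u) u) (at t)"
      by (simp add: has_vector_derivative_def)
    have "isCont (\<lambda>z. D z u) (b + t *\<^sub>R u)"
      using cont[of u] off[of t] continuous_on_eq_continuous_at[of "- {p}" "\<lambda>z. D z u"] by auto
    then show "isCont (\<lambda>t. D (b + t *\<^sub>R u) u) t"
      by (rule isCont_o2[rotated]) (auto intro!: continuous_intros)
  next
    have le: "norm (\<phi> (b + t *\<^sub>R u)) \<le> B / sqrt (1 + ((norm b)\<^sup>2 + t\<^sup>2))" for t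
      using decay[OF off[of t]] unfolding wt .
    show "((\<lambda>t. \<phi> (b + t *\<^sub>R u)) \<longlongrightarrow> 0) at_bot"
      by (rule Lim_null_comparison[OF always_eventually[OF allI[OF le]]]) real_asymp
    show "((\<lambda>t. \<phi> (b + t *\<^sub>R u)) \<longlongrightarrow> 0) at_top"
      by (rule Lim_null_comparison[OF always_eventually[OF allI[OF le]]]) real_asymp
  qed
  then show ?thesis by simp
qed

lemma integral_derivative_eq_0:
  shows "(\<integral>z. D z 1 \<partial>lborel) = 0" and "(\<integral>z. D z \<i> \<partial>lborel) = 0"
proof -
  have eq1: "Complex 0 y + x *\<^sub>R 1 = Complex x y" and eq2: "Complex x 0 + y *\<^sub>R \<i> = Complex x y" for x y
    by (simp_all add: complex_eq_iff)
  have "AE y in lborel. (\<integral>x. D (Complex x y) 1 \<partial>lborel) = 0"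
    using integral_complex_swap(3)[OF integrable_derivative[of 1]] AE_lborel_singleton[of "Im p"]
  proof eventually_elim
    case (elim y)
    then show ?case using integral_derivative_line[of 1 "Complex 0 y"]
      unfolding eq1 by (force simp: inner_complex_def)
  qed
  then have "(\<integral>y. \<integral>x. D (Complex x y) 1 \<partial>lborel \<partial>lborel) = 0"
    by (rule integral_eq_zero_AE)
  then show "(\<integral>z. D z 1 \<partial>lborel) = 0"
    by (simp add: integral_complex_swap(1)[OF integrable_derivative])
  have "AE x in lborel. (\<integral>y. D (Complex x y) \<i> \<partial>lborel) = 0"
    using integral_complex_swap(4)[OF integrable_derivative[of \<i>]] AE_lborel_singleton[of "Re p"]
  proof eventually_elim
    case (elim x)
    then show ?case using integral_derivative_line[of \<i> "Complex x 0"]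
      unfolding eq2 by (force simp: inner_complex_def)
  qed
  then have "(\<integral>x. \<integral>y. D (Complex x y) \<i> \<partial>lborel \<partial>lborel) = 0"
    by (rule integral_eq_zero_AE)
  then show "(\<integral>z. D z \<i> \<partial>lborel) = 0"
    by (simp add: integral_complex_swap(2)[OF integrable_derivative])
qed

end

section \<open>The kernel on the sphere\<close>

text \<open>Half of the chordal distance of the corresponding points of the unit sphere\<close>

definition chd :: "complex \<Rightarrow> complex \<Rightarrow> real" where
  "chd z q = norm (z - q) / (sqrt (wt z) * sqrt (wt q))"

text \<open>Lagrange's identity. Divided by the right-hand side it reads cos^2 + sin^2 = 1 for half
  the angle between the two points of the sphere.\<close>

lemma norm_polarized:
  "(norm (1 + z * cnj q))\<^sup>2 + (norm (z - q))\<^sup>2 = wt z * wt q"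
  unfolding cmod_power2 by (simp add: power2_eq_square algebra_simps)

lemma norm_polarized_wt_le: "norm (1 + z * cnj q) \<le> sqrt (wt z) * sqrt (wt q)"
  and norm_diff_le: "norm (z - q) \<le> sqrt (wt z) * sqrt (wt q)"
proof -
  have "(norm (1 + z * cnj q))\<^sup>2 \<le> wt z * wt q" "(norm (z - q))\<^sup>2 \<le> wt z * wt q"
    using norm_polarized[of z q] zero_le_power2[of "norm (1 + z * cnj q)"] zero_le_power2[of "norm (z - q)"]
    by linarith+
  then show "norm (1 + z * cnj q) \<le> sqrt (wt z) * sqrt (wt q)" "norm (z - q) \<le> sqrt (wt z) * sqrt (wt q)"
    by (simp_all add: real_sqrt_mult[symmetric] real_le_rsqrt)
qed

lemma chd_bounds: "0 \<le> chd z q" "chd z q \<le> 1" "z \<noteq> q \<Longrightarrow> 0 < chd z q"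
  "norm (z - q) = chd z q * sqrt (wt z) * sqrt (wt q)"
  using norm_diff_le[of z q] sqrt_wt(4)[of z] sqrt_wt(4)[of q]
  by (auto simp: chd_def divide_le_eq)

lemma chd_commute: "chd z q = chd q z"
  by (simp add: chd_def norm_minus_commute mult.commute)

lemma of_real_wt: "complex_of_real (wt z) = 1 + z * cnj z"
  unfolding of_real_add of_real_1 complex_norm_square ..

text \<open>Equals z / wt z + 1 / (cnj q - cnj z). The first summand has d/dz equal to 1 / (wt z)^2;
  the second is antiholomorphic, hence invisible to d/dz off the diagonal, and cancels the leading
  term at infinity, which improves the decay from |z|^(-1) to |z|^(-2).\<close>

definition kap :: "complex \<Rightarrow> complex \<Rightarrow> complex" where
  "kap q z = (1 + z * cnj q) / ((cnj q - cnj z) * of_real (wt z))"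

text \<open>The coefficients of \<open>h\<close> and \<open>cnj h\<close> are the Wirtinger
  derivatives with respect to z and its conjugate.\<close>

definition kap' :: "complex \<Rightarrow> complex \<Rightarrow> complex \<Rightarrow> complex" where
  "kap' q z h = h / (of_real (wt z))\<^sup>2 + cnj h * ((1 + z * cnj q) * (of_real (wt z) - z * (cnj q - cnj z))
      / ((cnj q - cnj z)\<^sup>2 * (of_real (wt z))\<^sup>2))"

text \<open>
  With respect to \<open>q\<close>, the holomorphic derivative of \<open>mu z q\<close> is \<open>wt z * kap q z / (wt q)\<^sup>2\<close>; with respect to
  \<open>z\<close>, that of \<open>kap q z\<close> is \<open>1 / (wt z)\<^sup>2\<close> away from the diagonal.
\<close>

definition mu :: "complex \<Rightarrow> complex \<Rightarrow> complex" where
  "mu z q = (q - z) / ((cnj q - cnj z) * of_real (wt q))"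

definition mu' :: "complex \<Rightarrow> complex \<Rightarrow> complex \<Rightarrow> complex" where
  "mu' z q h = h * ((1 + z * cnj q) / ((cnj q - cnj z) * (of_real (wt q))\<^sup>2))
     - cnj h * ((q - z) * (of_real (wt q) + q * (cnj q - cnj z)) / ((cnj q - cnj z)\<^sup>2 * (of_real (wt q))\<^sup>2))"

lemma wt_nz: "1 + z * cnj z \<noteq> 0"
  using of_real_wt[of z] wt_pos(1)[of z] by (metis less_irrefl of_real_eq_0_iff)

lemma kap_has_derivative:
  assumes "z \<noteq> q"
  shows "(kap q has_derivative kap' q z) (at z)"
proof -
  have nz: "cnj q - cnj z \<noteq> 0" using assms by simp
  have 1: "((\<lambda>z. 1 + z * cnj q) has_derivative (\<lambda>h. h * cnj q)) (at z)"
    by (auto intro!: derivative_eq_intros)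
  have 2: "((\<lambda>z. (cnj q - cnj z) * (1 + z * cnj z)) has_derivative
      (\<lambda>h. (cnj q - cnj z) * (h * cnj z + z * cnj h) - cnj h * (1 + z * cnj z))) (at z)"
    by (rule derivative_eq_intros has_derivative_cnj refl | simp)+ (auto simp: algebra_simps)
  have 3: "(h * cnj q * ((cnj q - cnj z) * (1 + z * cnj z))
       - (1 + z * cnj q) * ((cnj q - cnj z) * (h * cnj z + z * cnj h) - cnj h * (1 + z * cnj z)))
       / (((cnj q - cnj z) * (1 + z * cnj z)) * ((cnj q - cnj z) * (1 + z * cnj z))) = kap' q z h" for h
  proof -
    \<comment> \<open>Conjugates are replaced by independent variables \<open>Z\<close>,
      \<open>Q\<close>, \<open>k\<close>, so that a rational identity remains whose numerators
      \<open>algebra\<close> can compare.\<close>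
    have alg: "(h * Q * ((Q - Z) * (1 + z * Z)) - (1 + z * Q) * ((Q - Z) * (h * Z + z * k) - k * (1 + z * Z)))
       / (((Q - Z) * (1 + z * Z)) * ((Q - Z) * (1 + z * Z)))
       = h / (1 + z * Z)\<^sup>2 + k * ((1 + z * Q) * ((1 + z * Z) - z * (Q - Z)) / ((Q - Z)\<^sup>2 * (1 + z * Z)\<^sup>2))"
      if "1 + z * Z \<noteq> 0" "Q - Z \<noteq> 0" for h k z Z Q :: complex
    proof -
      have "h / (1 + z * Z)\<^sup>2 = h * (Q - Z)\<^sup>2 / ((Q - Z)\<^sup>2 * (1 + z * Z)\<^sup>2)" using that by simp
      then have "h / (1 + z * Z)\<^sup>2 + k * ((1 + z * Q) * ((1 + z * Z) - z * (Q - Z)) / ((Q - Z)\<^sup>2 * (1 + z * Z)\<^sup>2))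
        = (h * (Q - Z)\<^sup>2 + k * ((1 + z * Q) * ((1 + z * Z) - z * (Q - Z)))) / ((Q - Z)\<^sup>2 * (1 + z * Z)\<^sup>2)"
        by (simp add: add_divide_distrib)
      moreover have "h * (Q - Z)\<^sup>2 + k * ((1 + z * Q) * ((1 + z * Z) - z * (Q - Z)))
         = h * Q * ((Q - Z) * (1 + z * Z)) - (1 + z * Q) * ((Q - Z) * (h * Z + z * k) - k * (1 + z * Z))"
        by algebra
      moreover have "(Q - Z)\<^sup>2 * (1 + z * Z)\<^sup>2 = ((Q - Z) * (1 + z * Z)) * ((Q - Z) * (1 + z * Z))"
        by algebra
      ultimately show ?thesis by simp
    qed
    show ?thesis unfolding kap'_def of_real_wt by (rule alg[OF wt_nz nz])
  qed
  have "((\<lambda>z. (1 + z * cnj q) / ((cnj q - cnj z) * (1 + z * cnj z))) has_derivative kap' q z) (at z)"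
    using has_derivative_divide'[OF 1 2] nz wt_nz unfolding 3 by simp
  then show ?thesis by (simp only: kap_def[abs_def] of_real_wt)
qed

lemma mu_has_derivative:
  assumes "z \<noteq> q"
  shows "(mu z has_derivative mu' z q) (at q)"
proof -
  have nz: "cnj q - cnj z \<noteq> 0" using assms by simp
  have 1: "((\<lambda>q. q - z) has_derivative (\<lambda>h. h)) (at q)"
    by (auto intro!: derivative_eq_intros)
  have 2: "((\<lambda>q. (cnj q - cnj z) * (1 + q * cnj q)) has_derivative
      (\<lambda>h. (cnj q - cnj z) * (h * cnj q + q * cnj h) + cnj h * (1 + q * cnj q))) (at q)"
    by (rule derivative_eq_intros has_derivative_cnj refl | simp)+ (auto simp: algebra_simps)
  have 3: "(h * ((cnj q - cnj z) * (1 + q * cnj q))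
       - (q - z) * ((cnj q - cnj z) * (h * cnj q + q * cnj h) + cnj h * (1 + q * cnj q)))
       / (((cnj q - cnj z) * (1 + q * cnj q)) * ((cnj q - cnj z) * (1 + q * cnj q))) = mu' z q h" for h
  proof -
    have alg: "(h * ((Q - Z) * (1 + q * Q)) - (q - z) * ((Q - Z) * (h * Q + q * k) + k * (1 + q * Q)))
       / (((Q - Z) * (1 + q * Q)) * ((Q - Z) * (1 + q * Q)))
       = h * ((1 + z * Q) / ((Q - Z) * (1 + q * Q)\<^sup>2))
         - k * ((q - z) * ((1 + q * Q) + q * (Q - Z)) / ((Q - Z)\<^sup>2 * (1 + q * Q)\<^sup>2))"
      if "1 + q * Q \<noteq> 0" "Q - Z \<noteq> 0" for h k z q Z Q :: complex
    proof -
      have "(1 + z * Q) / ((Q - Z) * (1 + q * Q)\<^sup>2) = (1 + z * Q) * (Q - Z) / ((Q - Z)\<^sup>2 * (1 + q * Q)\<^sup>2)"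
        using that by (simp add: power2_eq_square)
      then have "h * ((1 + z * Q) / ((Q - Z) * (1 + q * Q)\<^sup>2))
         - k * ((q - z) * ((1 + q * Q) + q * (Q - Z)) / ((Q - Z)\<^sup>2 * (1 + q * Q)\<^sup>2))
        = (h * ((1 + z * Q) * (Q - Z)) - k * ((q - z) * ((1 + q * Q) + q * (Q - Z)))) / ((Q - Z)\<^sup>2 * (1 + q * Q)\<^sup>2)"
        by (simp add: diff_divide_distrib)
      moreover have "h * ((1 + z * Q) * (Q - Z)) - k * ((q - z) * ((1 + q * Q) + q * (Q - Z)))
         = h * ((Q - Z) * (1 + q * Q)) - (q - z) * ((Q - Z) * (h * Q + q * k) + k * (1 + q * Q))"
        by algebra
      moreover have "(Q - Z)\<^sup>2 * (1 + q * Q)\<^sup>2 = ((Q - Z) * (1 + q * Q)) * ((Q - Z) * (1 + q * Q))"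
        by algebra
      ultimately show ?thesis by simp
    qed
    show ?thesis unfolding mu'_def of_real_wt by (rule alg[OF wt_nz nz])
  qed
  have "((\<lambda>q. (q - z) / ((cnj q - cnj z) * (1 + q * cnj q))) has_derivative mu' z q) (at q)"
    using has_derivative_divide'[OF 1 2] nz wt_nz unfolding 3 by simp
  then show ?thesis by (simp only: mu_def[abs_def] of_real_wt)
qed

text \<open>In terms of the chordal distance the kernel has a simple pole, with a constant that is
  uniform over the whole sphere, infinity included.\<close>

lemma norm_kap_le:
  assumes "z \<noteq> q" shows "norm (kap q z) \<le> 1 / (chd z q * wt z)"
proof -
  have s: "norm (cnj q - cnj z) = norm (z - q)"
    by (metis complex_cnj_diff complex_mod_cnj norm_minus_commute)
  have "norm (kap q z) = norm (1 + z * cnj q) / (norm (z - q) * wt z)"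
    unfolding kap_def norm_divide norm_mult norm_of_real s by (simp add: abs_of_pos[OF wt_pos(1)])
  also have "\<dots> \<le> (sqrt (wt z) * sqrt (wt q)) / (norm (z - q) * wt z)"
    using assms wt_pos[of z] by (intro divide_right_mono norm_polarized_wt_le) auto
  also have "\<dots> = 1 / (chd z q * wt z)" using assms by (simp add: chd_def)
  finally show ?thesis .
qed

text \<open>A double pole on the diagonal and cubic decay. The constant 3 is 1 for the holomorphic
  part plus 2 for the other, where both 1 / \<open>be\<close> and the chordal distance
  \<open>c\<close> are at most 1.\<close>

lemma norm_kap'_le:
  assumes "z \<noteq> q" shows "norm (kap' q z h) \<le> 3 * norm h / ((chd z q)\<^sup>2 * (wt z * sqrt (wt z)))"
proof -
  define al be s c where "al = sqrt (wt z)" and "be = sqrt (wt q)" and "s = norm (z - q)" and "c = chd z q"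
  have pos: "al \<ge> 1" "be \<ge> 1" "c > 0" "c \<le> 1" using sqrt_wt chd_bounds assms by (auto simp: al_def be_def c_def)
  have s: "s = c * al * be" unfolding s_def al_def be_def c_def by (rule chd_bounds)
  have wt: "wt z = al\<^sup>2" by (simp add: al_def add_nonneg_nonneg)
  have ns: "norm (cnj q - cnj z) = s"
    unfolding s_def by (metis complex_cnj_diff complex_mod_cnj norm_minus_commute)
  have n1: "norm (1 + z * cnj q) \<le> al * be" unfolding al_def be_def by (rule norm_polarized_wt_le)
  have n2: "norm (of_real (wt z) - z * (cnj q - cnj z)) \<le> al\<^sup>2 + al * s"
  proof -
    have "norm (of_real (wt z) - z * (cnj q - cnj z)) \<le> norm (complex_of_real (wt z)) + norm z * s"
      using norm_triangle_ineq4[of "complex_of_real (wt z)" "z * (cnj q - cnj z)"] unfolding norm_mult ns .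
    moreover have "norm (complex_of_real (wt z)) = al\<^sup>2" unfolding wt norm_of_real by simp
    moreover have "norm z * s \<le> al * s" using sqrt_wt(5)[of z] by (intro mult_right_mono) (auto simp: al_def s_def)
    ultimately show ?thesis by linarith
  qed
  have "norm (kap' q z h) \<le> norm (h / (of_real (wt z))\<^sup>2) + norm (cnj h * ((1 + z * cnj q) * (of_real (wt z) - z * (cnj q - cnj z))
      / ((cnj q - cnj z)\<^sup>2 * (of_real (wt z))\<^sup>2)))"
    unfolding kap'_def by (rule norm_triangle_ineq)
  also have "\<dots> = norm h * (1 / al^4) + norm h * (norm (1 + z * cnj q) * norm (of_real (wt z) - z * (cnj q - cnj z)) / (s\<^sup>2 * al^4))"
    unfolding norm_divide norm_mult norm_power ns complex_mod_cnj norm_of_real wt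
    by (simp flip: power_mult)
  also have "\<dots> \<le> norm h * (1 / al^4) + norm h * ((al * be) * (al\<^sup>2 + al * s) / (s\<^sup>2 * al^4))"
    using n1 n2 pos by (intro add_left_mono mult_left_mono divide_right_mono mult_mono) (auto simp: s)
  also have "(al * be) * (al\<^sup>2 + al * s) / (s\<^sup>2 * al^4) = (1 / be + c) / (c\<^sup>2 * al^3)"
    using pos unfolding s by (simp add: field_simps power2_eq_square power3_eq_cube power4_eq_xxxx)
  also have "norm h * (1 / al^4) + norm h * ((1 / be + c) / (c\<^sup>2 * al^3)) \<le> norm h * (1 / (c\<^sup>2 * al^3)) + norm h * (2 / (c\<^sup>2 * al^3))"
  proof -
    have "c\<^sup>2 \<le> 1" using pos by (simp add: power_le_one)
    then have "c\<^sup>2 * al^3 \<le> 1 * al^4" using pos by (intro mult_mono power_increasing) auto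
    then have "1 / al^4 \<le> 1 / (c\<^sup>2 * al^3)" using pos by (intro divide_left_mono) auto
    then have "norm h * (1 / al^4) \<le> norm h * (1 / (c\<^sup>2 * al^3))" by (rule mult_left_mono) simp
    moreover have "1 / be \<le> 1" using pos by simp
    then have "1 / be + c \<le> 2" using pos by linarith
    then have "norm h * ((1 / be + c) / (c\<^sup>2 * al^3)) \<le> norm h * (2 / (c\<^sup>2 * al^3))"
      using pos by (intro mult_left_mono divide_right_mono) auto
    ultimately show ?thesis by (rule add_mono)
  qed
  also have "\<dots> = 3 * norm h / (c\<^sup>2 * (al\<^sup>2 * al))"
    by (simp add: power2_eq_square power3_eq_cube add_divide_distrib[symmetric])
  finally show ?thesis unfolding wt[symmetric] al_def[symmetric] c_def[symmetric] .
qed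

lemma norm_mu: "z \<noteq> q \<Longrightarrow> norm (mu z q) = 1 / wt q"
proof -
  assume "z \<noteq> q"
  have "norm (cnj q - cnj z) = norm (q - z)" by (metis complex_cnj_diff complex_mod_cnj)
  then show ?thesis using \<open>z \<noteq> q\<close>
    unfolding mu_def norm_divide norm_mult norm_of_real by (simp add: abs_of_pos[OF wt_pos(1)])
qed

text \<open>Only a simple pole: \<open>mu\<close> itself stays bounded at the diagonal, where merely
  the direction of q - z makes it discontinuous.\<close>

lemma norm_mu'_le:
  assumes "z \<noteq> q" shows "norm (mu' z q h) \<le> 3 * norm h / (chd z q * (wt q * sqrt (wt q)))"
proof -
  define al be s c where "al = sqrt (wt z)" and "be = sqrt (wt q)" and "s = norm (z - q)" and "c = chd z q"
  have pos: "al \<ge> 1" "be \<ge> 1" "c > 0" "c \<le> 1" using sqrt_wt chd_bounds assms by (auto simp: al_def be_def c_def)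
  have s: "s = c * al * be" unfolding s_def al_def be_def c_def by (rule chd_bounds)
  have wt: "wt q = be\<^sup>2" by (simp add: be_def add_nonneg_nonneg)
  have ns: "norm (cnj q - cnj z) = s" "norm (q - z) = s"
    unfolding s_def by (metis complex_cnj_diff complex_mod_cnj norm_minus_commute)+
  have n1: "norm (1 + z * cnj q) \<le> al * be" unfolding al_def be_def by (rule norm_polarized_wt_le)
  have n2: "norm (of_real (wt q) + q * (cnj q - cnj z)) \<le> be\<^sup>2 + be * s"
  proof -
    have "norm (of_real (wt q) + q * (cnj q - cnj z)) \<le> norm (complex_of_real (wt q)) + norm q * s"
      using norm_triangle_ineq[of "complex_of_real (wt q)" "q * (cnj q - cnj z)"] unfolding norm_mult ns .
    moreover have "norm (complex_of_real (wt q)) = be\<^sup>2" unfolding wt norm_of_real by simp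
    moreover have "norm q * s \<le> be * s" using sqrt_wt(5)[of q] by (intro mult_right_mono) (auto simp: be_def s_def)
    ultimately show ?thesis by linarith
  qed
  have "norm (mu' z q h) \<le> norm (h * ((1 + z * cnj q) / ((cnj q - cnj z) * (of_real (wt q))\<^sup>2)))
     + norm (cnj h * ((q - z) * (of_real (wt q) + q * (cnj q - cnj z)) / ((cnj q - cnj z)\<^sup>2 * (of_real (wt q))\<^sup>2)))"
    unfolding mu'_def by (rule norm_triangle_ineq4)
  also have "\<dots> = norm h * (norm (1 + z * cnj q) / (s * be^4))
      + norm h * (s * norm (of_real (wt q) + q * (cnj q - cnj z)) / (s\<^sup>2 * be^4))"
    unfolding norm_divide norm_mult norm_power ns complex_mod_cnj norm_of_real wt
    by (simp flip: power_mult)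
  also have "\<dots> \<le> norm h * (al * be / (s * be^4)) + norm h * (s * (be\<^sup>2 + be * s) / (s\<^sup>2 * be^4))"
    using n1 n2 pos by (intro add_mono mult_left_mono divide_right_mono mult_mono) (auto simp: s)
  also have "al * be / (s * be^4) = 1 / (c * be^4)"
    using pos unfolding s by (simp add: field_simps)
  also have "s * (be\<^sup>2 + be * s) / (s\<^sup>2 * be^4) = (1 / al + c) / (c * be^3)"
    using pos unfolding s by (simp add: field_simps power2_eq_square power3_eq_cube power4_eq_xxxx)
  also have "norm h * (1 / (c * be^4)) + norm h * ((1 / al + c) / (c * be^3)) \<le> norm h * (1 / (c * be^3)) + norm h * (2 / (c * be^3))"
  proof -
    have "c * be^3 \<le> c * be^4" using pos by (intro mult_left_mono power_increasing) auto
    then have "1 / (c * be^4) \<le> 1 / (c * be^3)" using pos by (intro divide_left_mono) auto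
    moreover have "1 / al \<le> 1" using pos by simp
    then have "1 / al + c \<le> 2" using pos by linarith
    then have "(1 / al + c) / (c * be^3) \<le> 2 / (c * be^3)"
      using pos by (intro divide_right_mono) auto
    ultimately show ?thesis by (intro add_mono mult_left_mono) auto
  qed
  also have "\<dots> = 3 * norm h / (c * (be\<^sup>2 * be))"
    by (simp add: power2_eq_square power3_eq_cube add_divide_distrib[symmetric])
  finally show ?thesis unfolding wt[symmetric] be_def[symmetric] c_def[symmetric] .
qed

lemma borel_measurable_kap: "(\<lambda>(q,z). kap q z) \<in> borel_measurable (lborel \<Otimes>\<^sub>M lborel)"
proof -
  have "(\<lambda>p. (1 + snd p * cnj (fst p))) \<in> borel_measurable (borel :: (complex \<times> complex) measure)"
    "(\<lambda>p. (cnj (fst p) - cnj (snd p)) * of_real (wt (snd p))) \<in> borel_measurable (borel :: (complex \<times> complex) measure)"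
    by (intro borel_measurable_continuous_onI continuous_intros)+
  then have "(\<lambda>p. kap (fst p) (snd p)) \<in> borel_measurable borel"
    unfolding kap_def by (rule borel_measurable_divide)
  then show ?thesis by (simp add: lborel_prod case_prod_unfold)
qed

lemma integral_lincomb:
  fixes f g h :: "'a \<Rightarrow> real"
  assumes "integrable N f" "integrable N g" "integrable N h"
  shows "(\<integral>z. a * f z - b * g z + c * h z \<partial>N) = a * integral\<^sup>L N f - b * integral\<^sup>L N g + c * integral\<^sup>L N h"
  using assms by simp

lemma integral_complex_real_lincomb:
  fixes f :: "'a \<Rightarrow> complex" and g :: "'a \<Rightarrow> real"
  assumes "integrable N f" "integrable N g"
  shows "(\<integral>z. 2 * f z + of_real (2 * g z) \<partial>N) = 2 * integral\<^sup>L N f + of_real (2 * integral\<^sup>L N g)"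
  using assms by simp

section \<open>The Sobolev inequality\<close>

text \<open>
  The bounds are what smoothness on the whole sphere means for \<open>w\<close> in the stereographic
  coordinate; they are invariant under affine substitutions, up to the constants.
\<close>

locale sphere_profile =
  fixes w :: "complex \<Rightarrow> real" and g :: "complex \<Rightarrow> complex" and H :: "complex \<Rightarrow> complex \<Rightarrow> complex"
    and C m :: real
  assumes w_deriv: "\<And>z. (w has_derivative (\<lambda>h. g z \<bullet> h)) (at z)"
    and g_deriv: "\<And>z. (g has_derivative H z) (at z)"
    and H_cont: "\<And>h. continuous_on UNIV (\<lambda>z. H z h)"
    and g_bound: "\<And>z. norm (g z) \<le> C / wt z"
    and H_bound: "\<And>z h. norm (H z h) \<le> C * norm h / (wt z * sqrt (wt z))"
    and w_chordal: "\<And>z q. \<bar>w z - w q\<bar> \<le> C * chd z q"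
    and w_lower: "0 < m" "\<And>z. m \<le> w z"
begin

lemma C_nonneg: "0 \<le> C"
  using order_trans[OF norm_ge_zero g_bound[of 0]] by simp

lemma g_cont: "continuous_on UNIV g"
  by (meson g_deriv has_derivative_continuous continuous_at_imp_continuous_on)

lemma w_cont: "continuous_on UNIV w"
  by (meson w_deriv has_derivative_continuous continuous_at_imp_continuous_on)

lemma profile_measurable [measurable]: "w \<in> borel_measurable borel" "g \<in> borel_measurable borel"
  by (simp_all add: borel_measurable_continuous_onI w_cont g_cont)

lemma w_diff_le: "\<bar>w z - w q\<bar> \<le> C"
proof -
  have "C * chd z q \<le> C * 1" using chd_bounds(2)[of z q] C_nonneg by (rule mult_left_mono)
  then show ?thesis using w_chordal[of z q] by simp
qed

lemma w_pos: "0 < w z" using w_lower(1) w_lower(2)[of z] by linarith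

lemma w_upper: "w z \<le> w 0 + C" using w_diff_le[of z 0] by linarith

lemma integrable_if_le_wt_power_2:
  fixes F :: "complex \<Rightarrow> 'b::euclidean_space"
  assumes [measurable]: "F \<in> borel_measurable borel" and "\<And>z. norm (F z) \<le> A / (wt z)\<^sup>2"
  shows "integrable lborel F"
proof (rule Bochner_Integration.integrable_bound)
  show "integrable lborel (\<lambda>z. A * (1 / (wt z)\<^sup>2))"
    using has_bochner_integral_wt_power_2 unfolding has_bochner_integral_iff by (intro integrable_mult_right) auto
  show "AE z in lborel. norm (F z) \<le> norm (A * (1 / (wt z)\<^sup>2))"
  proof (rule AE_I2)
    show "norm (F z) \<le> norm (A * (1 / (wt z)\<^sup>2))" for z
      using order_trans[OF assms(2) abs_ge_self] by simp
  qed
qed auto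

section \<open>Two integrations by parts against the kernels\<close>

definition cross_term :: "complex \<Rightarrow> complex \<Rightarrow> complex" where
  "cross_term q z = of_real (w z - w q) * cnj (g z) * kap q z"

text \<open>The chordal Lipschitz bound on \<open>w\<close> cancels the simple pole of
  \<open>kap\<close>. The result is uniform in \<open>q\<close>, which later gives integrability in
  both variables.\<close>

lemma norm_cross_term_le: "norm (cross_term q z) \<le> C\<^sup>2 / (wt z)\<^sup>2"
proof (cases "z = q")
  case True then show ?thesis by (simp add: cross_term_def)
next
  case False
  have "norm (cross_term q z) = \<bar>w z - w q\<bar> * norm (g z) * norm (kap q z)"
    by (simp only: cross_term_def norm_mult norm_of_real complex_mod_cnj)
  also have "\<dots> \<le> (C * chd z q) * (C / wt z) * (1 / (chd z q * wt z))"
    using C_nonneg chd_bounds[of z q] wt_pos(1)[of z]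
    by (intro mult_mono w_chordal g_bound norm_kap_le False mult_nonneg_nonneg divide_nonneg_pos) auto
  also have "\<dots> = C\<^sup>2 / (wt z)\<^sup>2"
    using chd_bounds(3)[OF False] by (simp add: power2_eq_square)
  finally show ?thesis .
qed

lemma cross_term_measurable: "(\<lambda>(q,z). cross_term q z) \<in> borel_measurable (lborel \<Otimes>\<^sub>M lborel)"
proof -
  have "(\<lambda>p. cross_term (fst p) (snd p)) \<in> borel_measurable (lborel \<Otimes>\<^sub>M lborel)"
    unfolding cross_term_def
  proof (intro borel_measurable_times)
    show "(\<lambda>p. kap (fst p) (snd p)) \<in> borel_measurable (lborel \<Otimes>\<^sub>M lborel)"
      using borel_measurable_kap by (simp add: case_prod_unfold)
    show "(\<lambda>p. complex_of_real (w (snd p) - w (fst p))) \<in> borel_measurable (lborel \<Otimes>\<^sub>M lborel)"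
      by measurable
    have "continuous_on UNIV (\<lambda>z. cnj (g z))" using g_cont by (intro continuous_intros)
    then have "(\<lambda>z. cnj (g z)) \<in> borel_measurable borel" by (rule borel_measurable_continuous_onI)
    then show "(\<lambda>p. cnj (g (snd p))) \<in> borel_measurable (lborel \<Otimes>\<^sub>M lborel)" by measurable
  qed
  then show ?thesis by (simp add: case_prod_unfold)
qed

lemma cross_term_measurable_snd: "cross_term q \<in> borel_measurable borel"
  using measurable_compose_Pair1[of q lborel, OF _ cross_term_measurable] by simp

lemma integrable_cross_term: "integrable lborel (cross_term q)"
  by (rule integrable_if_le_wt_power_2[OF cross_term_measurable_snd norm_cross_term_le])

lemma integrable_diff_sq: "integrable lborel (\<lambda>z. (w z - w q)\<^sup>2 / (wt z)\<^sup>2)"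
proof (rule integrable_if_le_wt_power_2)
  show "norm ((w z - w q)\<^sup>2 / (wt z)\<^sup>2) \<le> C\<^sup>2 / (wt z)\<^sup>2" for z
    using power_mono[OF w_diff_le abs_ge_zero, of z q 2] by (simp add: divide_right_mono)
qed measurable

lemma continuous_kap': "continuous_on (- {q}) (\<lambda>z. kap' q z h)"
  unfolding kap'_def of_real_wt by (intro continuous_intros) (auto simp: wt_nz)

lemma continuous_kap: "continuous_on (- {q}) (kap q)"
  unfolding kap_def[abs_def] of_real_wt by (intro continuous_intros) (auto simp: wt_nz)

lemma continuous_mu': "continuous_on (- {z}) (\<lambda>q. mu' z q h)"
  unfolding mu'_def of_real_wt by (intro continuous_intros) (auto simp: wt_nz)

lemma continuous_mu: "continuous_on (- {z}) (mu z)"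
  unfolding mu_def[abs_def] of_real_wt by (intro continuous_intros) (auto simp: wt_nz)

lemma inv_wt_mono: "1 / (wt z)\<^sup>2 \<le> 1 / (wt z * sqrt (wt z))" "1 / wt z \<le> 1 / sqrt (wt z)"
proof -
  have s: "sqrt (wt z) \<ge> 1" by (rule sqrt_wt)
  have w: "sqrt (wt z) * sqrt (wt z) = wt z" by (rule sqrt_wt)
  have "sqrt (wt z) * 1 \<le> sqrt (wt z) * sqrt (wt z)" using s by (intro mult_left_mono) auto
  then have le: "sqrt (wt z) \<le> wt z" using w by simp
  show "1 / wt z \<le> 1 / sqrt (wt z)" using le s by (intro divide_left_mono) (auto simp: wt_pos)
  have "wt z * sqrt (wt z) \<le> (wt z)\<^sup>2" using le wt_pos(1)[of z] unfolding power2_eq_square by (intro mult_left_mono) auto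
  then show "1 / (wt z)\<^sup>2 \<le> 1 / (wt z * sqrt (wt z))" using s wt_pos(1)[of z] by (intro divide_left_mono mult_pos_pos zero_less_power) auto
qed

text \<open>
  Integrates the \<open>z\<close>-derivative of \<open>(w z - w q)\<^sup>2 * kap q z\<close>. The factor \<open>(w z - w q)\<^sup>2\<close> removes the
  singularity of the kernel, so that no boundary term appears at \<open>q\<close>.
\<close>

lemma integral_diff_sq_eq:
  "of_real (\<integral>z. (w z - w q)\<^sup>2 / (wt z)\<^sup>2 \<partial>lborel) = - (\<integral>z. cross_term q z \<partial>lborel)"
proof -
  define \<phi> where "\<phi> z = (complex_of_real (w z - w q))\<^sup>2 * kap q z" for z
  define D where "D z h = (complex_of_real (w z - w q))\<^sup>2 * kap' q z h
      + 2 * of_real (w z - w q) * of_real (g z \<bullet> h) * kap q z" for z h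
  have der: "(\<phi> has_derivative D z) (at z)" if "z \<noteq> q" for z
  proof -
    have 1: "((\<lambda>z. complex_of_real (w z - w q)) has_derivative (\<lambda>h. of_real (g z \<bullet> h))) (at z)"
      by (intro has_derivative_of_real) (auto intro!: derivative_eq_intros w_deriv)
    have 2: "((\<lambda>z. (complex_of_real (w z - w q))\<^sup>2) has_derivative (\<lambda>h. 2 * of_real (w z - w q) * of_real (g z \<bullet> h))) (at z)"
      using has_derivative_mult[OF 1 1] by (simp add: power2_eq_square algebra_simps)
    show ?thesis unfolding \<phi>_def D_def
      using has_derivative_mult[OF 2 kap_has_derivative[OF that]] by simp
  qed
  have cont: "continuous_on (- {q}) (\<lambda>z. D z h)" for h
    unfolding D_def
    by (intro continuous_intros continuous_kap continuous_kap' continuous_on_subset[OF w_cont] continuous_on_subset[OF g_cont]) auto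
  \<comment> \<open>The square of the difference absorbs the double pole of \<open>kap'\<close>. Of
    the constant 5, the part 3 comes from \<open>norm_kap'_le\<close> and 2 from differentiating the
    square.\<close>
  have bound: "norm (D z h) \<le> (5 * C\<^sup>2) * norm h / (wt z * sqrt (wt z))" if zq: "z \<noteq> q" for z h
  proof -
    let ?c = "chd z q"
    have c: "0 < ?c" "?c \<le> 1" using chd_bounds zq by auto
    have "norm (D z h) \<le> \<bar>w z - w q\<bar>\<^sup>2 * norm (kap' q z h) + 2 * \<bar>w z - w q\<bar> * \<bar>g z \<bullet> h\<bar> * norm (kap q z)"
      unfolding D_def by (rule order_trans[OF norm_triangle_ineq]) (simp only: norm_mult norm_power norm_of_real norm_numeral order_refl)
    also have "\<dots> \<le> (C * ?c)\<^sup>2 * (3 * norm h / (?c\<^sup>2 * (wt z * sqrt (wt z)))) + 2 * (C * ?c) * ((C / wt z) * norm h) * (1 / (?c * wt z))"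
    proof (intro add_mono mult_mono power_mono w_chordal norm_kap'_le norm_kap_le zq order_refl)
      show "\<bar>g z \<bullet> h\<bar> \<le> C / wt z * norm h"
        by (rule order_trans[OF Cauchy_Schwarz_ineq2]) (intro mult_right_mono g_bound norm_ge_zero)
    qed (use c C_nonneg wt_pos(1)[of z] in auto)
    also have "(C * ?c)\<^sup>2 * (3 * norm h / (?c\<^sup>2 * (wt z * sqrt (wt z)))) = 3 * C\<^sup>2 * norm h / (wt z * sqrt (wt z))"
      using c by (simp add: power_mult_distrib)
    also have "2 * (C * ?c) * ((C / wt z) * norm h) * (1 / (?c * wt z)) = 2 * C\<^sup>2 * norm h * (1 / (wt z)\<^sup>2)"
      using c by (simp add: power2_eq_square)
    also have "3 * C\<^sup>2 * norm h / (wt z * sqrt (wt z)) + 2 * C\<^sup>2 * norm h * (1 / (wt z)\<^sup>2)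
       \<le> 3 * C\<^sup>2 * norm h / (wt z * sqrt (wt z)) + 2 * C\<^sup>2 * norm h * (1 / (wt z * sqrt (wt z)))"
      by (intro add_left_mono mult_left_mono inv_wt_mono) auto
    finally show ?thesis by (simp add: add_divide_distrib[symmetric] mult_ac)
  qed
  have decay: "norm (\<phi> z) \<le> C\<^sup>2 / sqrt (wt z)" if zq: "z \<noteq> q" for z
  proof -
    let ?c = "chd z q"
    have c: "0 < ?c" "?c \<le> 1" using chd_bounds zq by auto
    have "norm (\<phi> z) = \<bar>w z - w q\<bar>\<^sup>2 * norm (kap q z)"
      unfolding \<phi>_def by (simp only: norm_mult norm_power norm_of_real)
    also have "\<dots> \<le> (C * ?c)\<^sup>2 * (1 / (?c * wt z))"
      using c C_nonneg by (intro mult_mono power_mono w_chordal norm_kap_le zq) auto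
    also have "\<dots> = C\<^sup>2 * ?c * (1 / wt z)" using c by (simp add: power2_eq_square)
    also have "\<dots> \<le> C\<^sup>2 * 1 * (1 / sqrt (wt z))"
      using c wt_pos(1)[of z] by (intro mult_mono inv_wt_mono) auto
    finally show ?thesis by simp
  qed
  note I = integrable_derivative[OF der cont bound decay] integral_derivative_eq_0[OF der cont bound decay]
  \<comment> \<open>\<open>D z 1 - \<i> * D z \<i>\<close> is twice the Wirtinger derivative d/dz.
    It discards the \<open>cnj h\<close> part of \<open>kap'\<close>, and it turns the real gradient
    into \<open>cnj (g z)\<close>, twice d/dz of \<open>w\<close>.\<close>
  have "(\<integral>z. D z 1 - \<i> * D z \<i> \<partial>lborel) = 0"
    using I by simp
  moreover have "D z 1 - \<i> * D z \<i> = 2 * cross_term q z + of_real (2 * ((w z - w q)\<^sup>2 / (wt z)\<^sup>2))" for z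
  proof -
    have k: "kap' q z 1 - \<i> * kap' q z \<i> = 2 / (of_real (wt z))\<^sup>2"
    proof -
      have "1 / a + 1 * b - \<i> * (\<i> / a + (- \<i>) * b) = 2 / a" for a b :: complex
        by (simp add: algebra_simps add_divide_distrib[symmetric])
      then show ?thesis unfolding kap'_def complex_cnj_one complex_cnj_i .
    qed
    have gz: "of_real (g z \<bullet> 1) - \<i> * of_real (g z \<bullet> \<i>) = cnj (g z)"
      by (simp add: inner_complex_def complex_eq_iff)
    have "D z 1 - \<i> * D z \<i> = (of_real (w z - w q))\<^sup>2 * (kap' q z 1 - \<i> * kap' q z \<i>)
        + 2 * of_real (w z - w q) * (of_real (g z \<bullet> 1) - \<i> * of_real (g z \<bullet> \<i>)) * kap q z"
      unfolding D_def by algebra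
    then show ?thesis unfolding k gz cross_term_def by (simp add: algebra_simps)
  qed
  ultimately have "0 = (\<integral>z. 2 * cross_term q z + of_real (2 * ((w z - w q)\<^sup>2 / (wt z)\<^sup>2)) \<partial>lborel)" by simp
  also have "\<dots> = 2 * (\<integral>z. cross_term q z \<partial>lborel) + of_real (2 * (\<integral>z. (w z - w q)\<^sup>2 / (wt z)\<^sup>2 \<partial>lborel))"
    by (rule integral_complex_real_lincomb[OF integrable_cross_term integrable_diff_sq])
  finally have *: "0 = 2 * (\<integral>z. cross_term q z \<partial>lborel) + of_real (2 * (\<integral>z. (w z - w q)\<^sup>2 / (wt z)\<^sup>2 \<partial>lborel))" .
  have "of_real b = - a" if "0 = 2 * a + of_real (2 * b)" for a :: complex and b
    using that by (auto simp: complex_eq_iff)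
  from this[OF *] show ?thesis .
qed

text \<open>\<open>mu z\<close> is a primitive in q of \<open>kap q z / (wt q)^2\<close> up to the
  factor \<open>wt z\<close>. Integrating the q-derivative of (w z - w q) * \<open>mu z q\<close>
  therefore moves the derivative onto \<open>w\<close>; the simple zero of the difference suffices
  against the simple pole of \<open>mu'\<close>.\<close>

lemma integral_diff_kap:
  "(\<integral>q. of_real (w z - w q) * kap q z / (of_real (wt q))\<^sup>2 \<partial>lborel)
     = 1 / (2 * of_real (wt z)) * (\<integral>q. cnj (g q) * mu z q \<partial>lborel)"
  and integrable_g_mu: "integrable lborel (\<lambda>q. cnj (g q) * mu z q)"
proof -
  define \<phi> where "\<phi> q = complex_of_real (w z - w q) * mu z q" for q
  define D where "D q h = of_real (w z - w q) * mu' z q h - of_real (g q \<bullet> h) * mu z q" for q h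
  have der: "(\<phi> has_derivative D q) (at q)" if "q \<noteq> z" for q
  proof -
    have 1: "((\<lambda>q. complex_of_real (w z - w q)) has_derivative (\<lambda>h. of_real (- (g q \<bullet> h)))) (at q)"
      by (intro has_derivative_of_real) (auto intro!: derivative_eq_intros w_deriv)
    show ?thesis unfolding \<phi>_def D_def
      using has_derivative_mult[OF 1 mu_has_derivative[OF that[symmetric]]] by simp
  qed
  have cont: "continuous_on (- {z}) (\<lambda>q. D q h)" for h
    unfolding D_def
    by (intro continuous_intros continuous_mu continuous_mu' continuous_on_subset[OF w_cont] continuous_on_subset[OF g_cont]) auto
  have bound: "norm (D q h) \<le> (4 * C) * norm h / (wt q * sqrt (wt q))" if zq: "q \<noteq> z" for q h
  proof -
    let ?c = "chd z q"
    have c: "0 < ?c" "?c \<le> 1" using chd_bounds zq by auto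
    have "norm (D q h) \<le> \<bar>w z - w q\<bar> * norm (mu' z q h) + \<bar>g q \<bullet> h\<bar> * norm (mu z q)"
      unfolding D_def by (rule order_trans[OF norm_triangle_ineq4]) (simp only: norm_mult norm_of_real order_refl)
    also have "\<dots> \<le> (C * ?c) * (3 * norm h / (?c * (wt q * sqrt (wt q)))) + ((C / wt q) * norm h) * (1 / wt q)"
    proof (intro add_mono mult_mono w_chordal norm_mu'_le zq[symmetric] order_refl)
      show "\<bar>g q \<bullet> h\<bar> \<le> C / wt q * norm h"
        by (rule order_trans[OF Cauchy_Schwarz_ineq2]) (intro mult_right_mono g_bound norm_ge_zero)
      show "norm (mu z q) \<le> 1 / wt q" using norm_mu[OF zq[symmetric]] by simp
    qed (use c C_nonneg wt_pos(1)[of q] in auto)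
    also have "(C * ?c) * (3 * norm h / (?c * (wt q * sqrt (wt q)))) = 3 * C * norm h / (wt q * sqrt (wt q))"
      using c by simp
    also have "((C / wt q) * norm h) * (1 / wt q) = C * norm h * (1 / (wt q)\<^sup>2)"
      by (simp add: power2_eq_square)
    also have "3 * C * norm h / (wt q * sqrt (wt q)) + C * norm h * (1 / (wt q)\<^sup>2)
       \<le> 3 * C * norm h / (wt q * sqrt (wt q)) + C * norm h * (1 / (wt q * sqrt (wt q)))"
      using C_nonneg by (intro add_left_mono mult_left_mono inv_wt_mono) auto
    finally show ?thesis by (simp add: add_divide_distrib[symmetric])
  qed
  have decay: "norm (\<phi> q) \<le> C / sqrt (wt q)" if zq: "q \<noteq> z" for q
  proof -
    have "norm (\<phi> q) = \<bar>w z - w q\<bar> * (1 / wt q)"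
      unfolding \<phi>_def norm_mult norm_of_real norm_mu[OF zq[symmetric]] ..
    also have "\<dots> \<le> C * (1 / sqrt (wt q))"
      using wt_pos(1)[of q] C_nonneg by (intro mult_mono w_diff_le inv_wt_mono) auto
    finally show ?thesis by simp
  qed
  note I = integrable_derivative[OF der cont bound decay] integral_derivative_eq_0[OF der cont bound decay]
  have gc: "continuous_on UNIV (\<lambda>q. cnj (g q))" using g_cont by (intro continuous_intros)
  show int: "integrable lborel (\<lambda>q. cnj (g q) * mu z q)"
  proof (rule integrable_if_le_wt_power_2)
    show "(\<lambda>q. cnj (g q) * mu z q) \<in> borel_measurable borel"
      by (rule borel_measurable_continuous_except_point[of z])
         (intro continuous_intros continuous_mu continuous_on_subset[OF g_cont] subset_UNIV)
    show "norm (cnj (g q) * mu z q) \<le> C / (wt q)\<^sup>2" for q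
    proof (cases "q = z")
      case False
      have "norm (cnj (g q) * mu z q) = norm (g q) * (1 / wt q)"
        unfolding norm_mult complex_mod_cnj norm_mu[OF False[symmetric]] ..
      also have "\<dots> \<le> C / wt q * (1 / wt q)"
        using wt_pos(1)[of q] by (intro mult_right_mono g_bound) auto
      finally show ?thesis by (simp add: power2_eq_square)
    qed (use C_nonneg in \<open>simp add: mu_def\<close>)
  qed
  let ?J = "\<lambda>q. of_real (w z - w q) * kap q z / (of_real (wt q))\<^sup>2"
  have "(\<integral>q. D q 1 - \<i> * D q \<i> \<partial>lborel) = 0"
    using I by simp
  moreover have int2: "integrable lborel (\<lambda>q. D q 1 - \<i> * D q \<i>)"
    using I by simp
  moreover have eq: "D q 1 - \<i> * D q \<i> = 2 * of_real (wt z) * ?J q - cnj (g q) * mu z q" for q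
  proof -
    have k: "mu' z q 1 - \<i> * mu' z q \<i> = 2 * of_real (wt z) * kap q z / (of_real (wt q))\<^sup>2"
    proof -
      have "1 * a - 1 * b - \<i> * (\<i> * a - (- \<i>) * b) = 2 * a" for a b :: complex
        by (simp add: algebra_simps)
      then have "mu' z q 1 - \<i> * mu' z q \<i> = 2 * ((1 + z * cnj q) / ((cnj q - cnj z) * (of_real (wt q))\<^sup>2))"
        unfolding mu'_def complex_cnj_one complex_cnj_i .
      also have "\<dots> = 2 * of_real (wt z) * kap q z / (of_real (wt q))\<^sup>2"
      proof -
        have "A * (x / (y * A)) = x / y" if "A \<noteq> 0" for A x y :: complex
          using that by simp
        from this[OF wt_nz[of z]] have "of_real (wt z) * kap q z = (1 + z * cnj q) / (cnj q - cnj z)"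
          unfolding kap_def of_real_wt .
        then show ?thesis by (simp del: of_real_add add: mult.assoc)
      qed
      finally show ?thesis .
    qed
    have gz: "of_real (g q \<bullet> 1) - \<i> * of_real (g q \<bullet> \<i>) = cnj (g q)"
      by (simp add: inner_complex_def complex_eq_iff)
    have "D q 1 - \<i> * D q \<i> = of_real (w z - w q) * (mu' z q 1 - \<i> * mu' z q \<i>)
        - (of_real (g q \<bullet> 1) - \<i> * of_real (g q \<bullet> \<i>)) * mu z q"
      unfolding D_def by algebra
    then show ?thesis unfolding k gz by simp
  qed
  ultimately have 0: "(\<integral>q. 2 * of_real (wt z) * ?J q - cnj (g q) * mu z q \<partial>lborel) = 0"
    and "integrable lborel (\<lambda>q. 2 * of_real (wt z) * ?J q - cnj (g q) * mu z q)" by simp_all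
  from Bochner_Integration.integrable_add[OF this(2) int]
  have "integrable lborel (\<lambda>q. 2 * of_real (wt z) * ?J q)" by simp
  with 0 int have "(\<integral>q. 2 * of_real (wt z) * ?J q \<partial>lborel) = (\<integral>q. cnj (g q) * mu z q \<partial>lborel)"
    by simp
  then show "(\<integral>q. ?J q \<partial>lborel) = 1 / (2 * of_real (wt z)) * (\<integral>q. cnj (g q) * mu z q \<partial>lborel)"
  proof -
    assume a: "(\<integral>q. 2 * of_real (wt z) * ?J q \<partial>lborel) = (\<integral>q. cnj (g q) * mu z q \<partial>lborel)"
    have "(\<integral>q. 2 * of_real (wt z) * ?J q \<partial>lborel) = 2 * of_real (wt z) * (\<integral>q. ?J q \<partial>lborel)"
      by (rule integral_mult_right_zero)
    then have "(\<integral>q. cnj (g q) * mu z q \<partial>lborel) = 2 * of_real (wt z) * (\<integral>q. ?J q \<partial>lborel)"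
      using a by simp
    moreover have "complex_of_real (wt z) \<noteq> 0" using wt_nz[of z] unfolding of_real_wt .
    ultimately show ?thesis by (simp del: of_real_add)
  qed
qed

section \<open>The variance inequality and the energy\<close>

lemma w_bound: "\<bar>w z\<bar> \<le> w 0 + C"
  using w_upper[of z] w_pos[of z] by simp

lemma integrable_w:
  "integrable lborel (\<lambda>z. 1 / (wt z)\<^sup>2)"
  "integrable lborel (\<lambda>z. w z / (wt z)\<^sup>2)"
  "integrable lborel (\<lambda>z. (w z)\<^sup>2 / (wt z)\<^sup>2)"
  "integrable lborel (\<lambda>z. norm (g z) / wt z)"
  "integrable lborel (\<lambda>z. (norm (g z))\<^sup>2 / w z)"
proof -
  show "integrable lborel (\<lambda>z. 1 / (wt z)\<^sup>2)"
    using has_bochner_integral_wt_power_2 by (simp add: has_bochner_integral_iff)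
  show "integrable lborel (\<lambda>z. w z / (wt z)\<^sup>2)"
    by (rule integrable_if_le_wt_power_2[where A = "w 0 + C"]) (measurable, simp add: w_bound divide_right_mono)
  show "integrable lborel (\<lambda>z. (w z)\<^sup>2 / (wt z)\<^sup>2)"
  proof (rule integrable_if_le_wt_power_2[where A = "(w 0 + C)\<^sup>2"])
    show "norm ((w z)\<^sup>2 / (wt z)\<^sup>2) \<le> (w 0 + C)\<^sup>2 / (wt z)\<^sup>2" for z
      using power_mono[OF w_bound abs_ge_zero, of z 2] by (simp add: divide_right_mono)
  qed measurable
  show "integrable lborel (\<lambda>z. norm (g z) / wt z)"
  proof (rule integrable_if_le_wt_power_2[where A = C])
    show "norm (norm (g z) / wt z) \<le> C / (wt z)\<^sup>2" for z
      using divide_right_mono[OF g_bound[of z], of "wt z"] wt_pos(1)[of z]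
      by (simp add: power2_eq_square abs_of_pos)
  qed measurable
  show "integrable lborel (\<lambda>z. (norm (g z))\<^sup>2 / w z)"
  proof (rule integrable_if_le_wt_power_2[where A = "C\<^sup>2 / m"])
    fix z
    have "(norm (g z))\<^sup>2 / w z \<le> (C / wt z)\<^sup>2 / m"
      using w_lower by (intro frac_le power_mono g_bound) auto
    then show "norm ((norm (g z))\<^sup>2 / w z) \<le> C\<^sup>2 / m / (wt z)\<^sup>2"
      using w_pos[of z] by (simp add: power_divide mult.commute)
  qed measurable
qed

text \<open>Up to constant factors the integrals of w, w^2, |grad w| and |grad w|^2 / w over the
  round sphere. The last has no weight because |grad w|^2 times the area element is conformally
  invariant in dimension two.\<close>

definition "M = (\<integral>z. w z / (wt z)\<^sup>2 \<partial>lborel)"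
definition "Q = (\<integral>z. (w z)\<^sup>2 / (wt z)\<^sup>2 \<partial>lborel)"
definition "G = (\<integral>z. norm (g z) / wt z \<partial>lborel)"
definition "P = (\<integral>z. (norm (g z))\<^sup>2 / w z \<partial>lborel)"

lemma integral_wt_power_2: "(\<integral>z. 1 / (wt z)\<^sup>2 \<partial>lborel) = pi"
  using has_bochner_integral_wt_power_2 by (simp add: has_bochner_integral_iff)

lemma integral_diff_sq: "(\<integral>z. (w z - w q)\<^sup>2 / (wt z)\<^sup>2 \<partial>lborel) = Q - 2 * w q * M + (w q)\<^sup>2 * pi"
proof -
  have "(\<integral>z. (w z - w q)\<^sup>2 / (wt z)\<^sup>2 \<partial>lborel)
     = (\<integral>z. 1 * ((w z)\<^sup>2 / (wt z)\<^sup>2) - (2 * w q) * (w z / (wt z)\<^sup>2) + (w q)\<^sup>2 * (1 / (wt z)\<^sup>2) \<partial>lborel)"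
    by (rule Bochner_Integration.integral_cong)
       (simp_all add: power2_diff add_divide_distrib diff_divide_distrib algebra_simps)
  also have "\<dots> = (Q - (2 * w q) * M) + (w q)\<^sup>2 * pi"
    using integral_lincomb[OF integrable_w(3,2,1), of 1 "2 * w q" "(w q)\<^sup>2"]
    unfolding Q_def M_def integral_wt_power_2 by simp
  finally show ?thesis by simp
qed

text \<open>Symmetrised form of the variance: expanding the square gives it twice, here multiplied
  by pi^2 because the reference measure has mass pi.\<close>

lemma double_integral_diff_sq:
  "(\<integral>q. (\<integral>z. (w z - w q)\<^sup>2 / (wt z)\<^sup>2 \<partial>lborel) / (wt q)\<^sup>2 \<partial>lborel) = 2 * (pi * Q - M\<^sup>2)"
proof -
  have "(\<integral>q. (\<integral>z. (w z - w q)\<^sup>2 / (wt z)\<^sup>2 \<partial>lborel) / (wt q)\<^sup>2 \<partial>lborel)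
     = (\<integral>q. (Q * (1 / (wt q)\<^sup>2) - (2 * M) * (w q / (wt q)\<^sup>2)) + pi * ((w q)\<^sup>2 / (wt q)\<^sup>2) \<partial>lborel)"
    unfolding integral_diff_sq
    by (rule Bochner_Integration.integral_cong)
       (simp_all add: add_divide_distrib diff_divide_distrib algebra_simps)
  also have "\<dots> = (Q * pi - (2 * M) * M) + pi * Q"
    using integral_lincomb[OF integrable_w(1,2,3), of Q "2 * M" pi]
    unfolding integral_wt_power_2 Q_def[symmetric] M_def[symmetric] by simp
  finally show ?thesis by (simp add: power2_eq_square algebra_simps)
qed

text \<open>The \<open>L\<^sup>1\<close> Poincare inequality: the round averages are \<open>M / pi\<close>, \<open>Q / pi\<close>, \<open>G / (2 * pi)\<close>.\<close>

lemma variance_le: "pi * Q - M\<^sup>2 \<le> G\<^sup>2 / 4"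
proof -
  let ?F = "\<lambda>q z. cross_term q z / (of_real (wt q))\<^sup>2"
  have F_le: "norm (?F q z) \<le> C\<^sup>2 / (wt q)\<^sup>2 * (1 / (wt z)\<^sup>2)" for q z
  proof -
    have "norm (?F q z) = norm (cross_term q z) / (wt q)\<^sup>2"
      unfolding norm_divide norm_power norm_of_real abs_of_pos[OF wt_pos(1)] ..
    also have "\<dots> \<le> C\<^sup>2 / (wt z)\<^sup>2 / (wt q)\<^sup>2"
      by (intro divide_right_mono norm_cross_term_le) auto
    finally show ?thesis by (simp add: mult.commute)
  qed
  have F_meas: "(\<lambda>p. ?F (fst p) (snd p)) \<in> borel_measurable (lborel \<Otimes>\<^sub>M lborel)"
  proof (rule borel_measurable_divide)
    show "(\<lambda>p. cross_term (fst p) (snd p)) \<in> borel_measurable (lborel \<Otimes>\<^sub>M lborel)"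
      using cross_term_measurable by (simp add: case_prod_unfold)
  qed measurable
  have int_q: "integrable lborel (\<lambda>z. norm (?F q z))" for q
    using integrable_norm[OF integrable_divide[OF integrable_cross_term, of q "(of_real (wt q))\<^sup>2"]] by simp
  \<comment> \<open>The bound \<open>F_le\<close> is a product of integrable functions of
    \<open>q\<close> and of \<open>z\<close>, which licenses the exchange of the integrals.\<close>
  have F_int: "integrable (lborel \<Otimes>\<^sub>M lborel) (\<lambda>p. ?F (fst p) (snd p))"
  proof (rule lborel_pair.Fubini_integrable[OF F_meas])
    show "AE q in lborel. integrable lborel (\<lambda>z. ?F (fst (q, z)) (snd (q, z)))"
      using integrable_divide[OF integrable_cross_term] by simp
    show "integrable lborel (\<lambda>q. \<integral>z. norm (?F (fst (q, z)) (snd (q, z))) \<partial>lborel)"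
    proof (rule integrable_if_le_wt_power_2[where A = "C\<^sup>2 * pi"])
      show "(\<lambda>q. \<integral>z. norm (?F (fst (q, z)) (snd (q, z))) \<partial>lborel) \<in> borel_measurable borel"
        using lborel.borel_measurable_lebesgue_integral[of "\<lambda>q z. norm (?F q z)" lborel] measurable_compose[OF F_meas borel_measurable_norm]
        by (simp add: case_prod_unfold)
      fix q
      have "(\<integral>z. norm (?F q z) \<partial>lborel) \<le> (\<integral>z. C\<^sup>2 / (wt q)\<^sup>2 * (1 / (wt z)\<^sup>2) \<partial>lborel)"
        by (intro integral_mono F_le int_q integrable_mult_right integrable_w(1))
      also have "\<dots> = C\<^sup>2 * pi / (wt q)\<^sup>2"
        unfolding integral_mult_right_zero integral_wt_power_2 by simp
      finally show "norm (\<integral>z. norm (?F (fst (q, z)) (snd (q, z))) \<partial>lborel) \<le> C\<^sup>2 * pi / (wt q)\<^sup>2"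
        by (simp del: of_real_add add: integral_nonneg_AE)
    qed
  qed
  have inner: "(\<integral>q. ?F q z \<partial>lborel) = cnj (g z) / (2 * of_real (wt z)) * (\<integral>q. cnj (g q) * mu z q \<partial>lborel)" for z
  proof -
    have "(\<integral>q. ?F q z \<partial>lborel) = (\<integral>q. cnj (g z) * (of_real (w z - w q) * kap q z / (of_real (wt q))\<^sup>2) \<partial>lborel)"
      unfolding cross_term_def by (rule Bochner_Integration.integral_cong) (simp_all add: mult_ac)
    also have "\<dots> = cnj (g z) * (1 / (2 * of_real (wt z)) * (\<integral>q. cnj (g q) * mu z q \<partial>lborel))"
      unfolding integral_mult_right_zero integral_diff_kap ..
    finally show ?thesis by simp
  qed
  \<comment> \<open>Since \<open>mu z\<close> has modulus 1 / \<open>wt q\<close> off the diagonal,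
    this bound does not depend on \<open>z\<close>; that is why the double integral splits into a
    product of two copies of \<open>G\<close>.\<close>
  have mu_le: "norm (\<integral>q. cnj (g q) * mu z q \<partial>lborel) \<le> G" for z
  proof -
    have "norm (\<integral>q. cnj (g q) * mu z q \<partial>lborel) \<le> (\<integral>q. norm (cnj (g q) * mu z q) \<partial>lborel)"
      by (rule integral_norm_bound)
    also have "\<dots> \<le> G" unfolding G_def
    proof (intro integral_mono integrable_norm integrable_g_mu integrable_w)
      fix q show "norm (cnj (g q) * mu z q) \<le> norm (g q) / wt q"
      proof (cases "z = q")
        case False then show ?thesis unfolding norm_mult complex_mod_cnj norm_mu[OF False] by simp
      qed (simp add: mu_def add_nonneg_nonneg)
    qed
    finally show ?thesis .
  qed
  have "complex_of_real (2 * (pi * Q - M\<^sup>2))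
      = (\<integral>q. complex_of_real ((\<integral>z. (w z - w q)\<^sup>2 / (wt z)\<^sup>2 \<partial>lborel) / (wt q)\<^sup>2) \<partial>lborel)"
    unfolding double_integral_diff_sq[symmetric] by (rule integral_complex_of_real[symmetric])
  also have "\<dots> = (\<integral>q. - (\<integral>z. ?F q z \<partial>lborel) \<partial>lborel)"
    unfolding of_real_divide integral_diff_sq_eq of_real_power by simp
  also have "\<dots> = - (\<integral>q. \<integral>z. ?F q z \<partial>lborel \<partial>lborel)" by simp
  \<comment> \<open>With \<open>q\<close> innermost, \<open>inner\<close> replaces the remaining
    difference of values by a second gradient.\<close>
  also have "\<dots> = - (\<integral>z. \<integral>q. ?F q z \<partial>lborel \<partial>lborel)"
    using lborel_pair.Fubini_integral[of ?F] F_int by (simp add: case_prod_unfold)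
  finally have "norm (complex_of_real (2 * (pi * Q - M\<^sup>2))) = norm (\<integral>z. \<integral>q. ?F q z \<partial>lborel \<partial>lborel)"
    by (simp only: norm_minus_cancel)
  also have "\<dots> \<le> (\<integral>z. norm (\<integral>q. ?F q z \<partial>lborel) \<partial>lborel)"
    by (rule integral_norm_bound)
  also have "\<dots> \<le> (\<integral>z. G / 2 * (norm (g z) / wt z) \<partial>lborel)"
  proof (intro integral_mono integrable_norm integrable_mult_right integrable_w)
    show "integrable lborel (\<lambda>z. \<integral>q. ?F q z \<partial>lborel)"
      using lborel_pair.integrable_snd[of ?F] F_int by (simp add: case_prod_unfold)
    fix z
    have "norm (\<integral>q. ?F q z \<partial>lborel) = norm (g z) / (2 * wt z) * norm (\<integral>q. cnj (g q) * mu z q \<partial>lborel)"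
      unfolding inner norm_mult norm_divide complex_mod_cnj norm_of_real abs_of_pos[OF wt_pos(1)] by simp
    also have "\<dots> \<le> norm (g z) / (2 * wt z) * G"
      using wt_pos(1)[of z] by (intro mult_left_mono mu_le) auto
    finally show "norm (\<integral>q. ?F q z \<partial>lborel) \<le> G / 2 * (norm (g z) / wt z)" by (simp add: mult.commute)
  qed
  also have "\<dots> = G\<^sup>2 / 2" unfolding integral_mult_right_zero G_def[symmetric] by (simp add: power2_eq_square)
  finally have "\<bar>2 * (pi * Q - M\<^sup>2)\<bar> \<le> G\<^sup>2 / 2" by (simp only: norm_of_real)
  from abs_le_D1[OF this] show ?thesis by (simp add: right_diff_distrib)
qed

lemma M_pos: "M > 0"
proof -
  have "(\<integral>z. m * (1 / (wt z)\<^sup>2) \<partial>lborel) \<le> (\<integral>z. w z / (wt z)\<^sup>2 \<partial>lborel)"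
  proof (rule integral_mono)
    show "integrable lborel (\<lambda>z. m * (1 / (wt z)\<^sup>2))" by (intro integrable_mult_right integrable_w)
    show "integrable lborel (\<lambda>z. w z / (wt z)\<^sup>2)" by (rule integrable_w)
    show "m * (1 / (wt z)\<^sup>2) \<le> w z / (wt z)\<^sup>2" for z
      using divide_right_mono[OF w_lower(2), of "(wt z)\<^sup>2" z] by simp
  qed
  moreover have "(\<integral>z. m * (1 / (wt z)\<^sup>2) \<partial>lborel) = m * pi"
    by (subst integral_mult_right_zero) (simp only: integral_wt_power_2)
  ultimately have "m * pi \<le> M" by (simp only: M_def)
  moreover have "0 < m * pi" using w_lower(1) by simp
  ultimately show ?thesis by linarith
qed

text \<open>Weighted Cauchy-Schwarz, from integrating (|g| - t w / wt)^2 / w \<ge> 0; the value t =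
  G / M minimises the resulting quadratic polynomial.\<close>

lemma G_sq_le: "G\<^sup>2 \<le> P * M"
proof -
  define t where "t = G / M"
  have "0 \<le> (\<integral>z. ((norm (g z))\<^sup>2 / w z - (2 * t) * (norm (g z) / wt z)) + t\<^sup>2 * (w z / (wt z)\<^sup>2) \<partial>lborel)"
  proof (rule integral_nonneg_AE, rule AE_I2)
    fix z
    have "((norm (g z))\<^sup>2 / w z - (2 * t) * (norm (g z) / wt z)) + t\<^sup>2 * (w z / (wt z)\<^sup>2)
       = (norm (g z) - t * w z / wt z)\<^sup>2 / w z"
      using w_pos[of z] wt_pos(1)[of z]
      by (simp add: power2_diff add_divide_distrib diff_divide_distrib power_divide power_mult_distrib)
         (simp add: power2_eq_square mult_ac)
    then show "0 \<le> ((norm (g z))\<^sup>2 / w z - (2 * t) * (norm (g z) / wt z)) + t\<^sup>2 * (w z / (wt z)\<^sup>2)"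
      using w_pos[of z] by simp
  qed
  also have "\<dots> = (P - (2 * t) * G) + t\<^sup>2 * M"
    using integral_lincomb[OF integrable_w(5,4,2), of 1 "2 * t" "t\<^sup>2"]
    unfolding P_def M_def G_def by simp
  also have "\<dots> = P - G\<^sup>2 / M"
    using M_pos unfolding t_def by (simp add: power2_eq_square)
  finally show ?thesis using M_pos by (simp add: divide_le_eq)
qed

text \<open>Equals \<open>w z * (4 / (wt z)\<^sup>2 - \<Delta> (ln w) z)\<close>\<close>

definition energy_density :: "complex \<Rightarrow> real" where
  "energy_density z = 4 * w z / (wt z)\<^sup>2 - (Re (H z 1) + Im (H z \<i>)) + (norm (g z))\<^sup>2 / w z"

text \<open>The Laplacian is the divergence of \<open>g\<close>, and the decay of \<open>g\<close>
  leaves no flux at infinity.\<close>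

lemma energy_eq: "integral\<^sup>L lborel energy_density = 4 * M + P"
  and integrable_energy: "integrable lborel energy_density"
proof -
  have bound: "norm (H z h) \<le> C * norm h / (wt z * sqrt (wt z))" for z h by (rule H_bound)
  have decay: "norm (g z) \<le> C / sqrt (wt z)" for z
  proof -
    have "C * (1 / wt z) \<le> C * (1 / sqrt (wt z))" using C_nonneg by (intro mult_left_mono inv_wt_mono)
    then show ?thesis using g_bound[of z] by simp
  qed
  \<comment> \<open>Nothing is singular here; 0 is an arbitrary choice for the exceptional point
    that the integration lemmas ask for.\<close>
  have cont: "continuous_on (- {0}) (\<lambda>z. H z h)" for h
    using H_cont by (rule continuous_on_subset) simp
  note I = integrable_derivative[OF g_deriv cont bound decay] integral_derivative_eq_0[OF g_deriv cont bound decay]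
  have R: "integrable lborel (\<lambda>z. Re (H z 1))" "integrable lborel (\<lambda>z. Im (H z \<i>))"
    using I by (auto intro: integrable_Re integrable_Im)
  have z: "(\<integral>z. Re (H z 1) \<partial>lborel) = 0" "(\<integral>z. Im (H z \<i>) \<partial>lborel) = 0"
    using I by simp_all
  have ed: "energy_density z = (4 * (w z / (wt z)\<^sup>2) - (Re (H z 1) + Im (H z \<i>))) + (norm (g z))\<^sup>2 / w z" for z
    by (simp add: energy_density_def)
  show "integrable lborel energy_density"
    unfolding ed[abs_def] using R integrable_w by (intro Bochner_Integration.integrable_add Bochner_Integration.integrable_diff integrable_mult_right)
  show "integral\<^sup>L lborel energy_density = 4 * M + P"
    using integral_lincomb[OF integrable_w(2) Bochner_Integration.integrable_add[OF R] integrable_w(5), of 4 1 1] R z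
    unfolding ed[abs_def] M_def P_def by simp
qed

text \<open>The variance inequality and Cauchy-Schwarz give pi Q \<le> M^2 + P M / 4. The right side
  is below (M + P / 4)^2, so the square root is controlled linearly by exactly the combination in
  \<open>energy_eq\<close>.\<close>

theorem energy_ge: "4 * sqrt (pi * Q) \<le> integral\<^sup>L lborel energy_density"
proof -
  have P0: "0 \<le> P" unfolding P_def using w_pos by (intro integral_nonneg_AE AE_I2) (simp add: less_imp_le)
  have "pi * Q \<le> M\<^sup>2 + P * M / 4" using variance_le G_sq_le by linarith
  also have "\<dots> \<le> (M + P / 4)\<^sup>2" using P0 M_pos by (simp add: power2_eq_square algebra_simps)
  finally have "sqrt (pi * Q) \<le> M + P / 4" using P0 M_pos by (intro real_le_lsqrt) auto
  then show ?thesis unfolding energy_eq by simp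
qed

end

section \<open>Functions in two opposite charts\<close>

text \<open>Gradient and Hessian are explicit arguments: the Laplacian can be read off from them,
  and the calculus rules below compute them. The gradient is a complex number that represents the
  differential through the inner product.\<close>

definition C2_with :: "(complex \<Rightarrow> real) \<Rightarrow> (complex \<Rightarrow> complex) \<Rightarrow> (complex \<Rightarrow> complex \<Rightarrow> complex) \<Rightarrow> bool" where
  "C2_with f g H \<longleftrightarrow> (\<forall>z. (f has_derivative (\<lambda>h. g z \<bullet> h)) (at z)) \<and>
     (\<forall>z. (g has_derivative H z) (at z)) \<and> (\<forall>h. continuous_on UNIV (\<lambda>z. H z h))"

definition lap :: "(complex \<Rightarrow> complex \<Rightarrow> complex) \<Rightarrow> complex \<Rightarrow> real" where
  "lap H z = Re (H z 1) + Im (H z \<i>)"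

lemma C2_withD:
  assumes "C2_with f g H"
  shows "(f has_derivative (\<lambda>h. g z \<bullet> h)) (at z)" "(g has_derivative H z) (at z)"
    "continuous_on UNIV (\<lambda>z. H z h)" "continuous_on UNIV f" "continuous_on UNIV g" "linear (H z)"
proof -
  show f: "(f has_derivative (\<lambda>h. g z \<bullet> h)) (at z)" and g: "(g has_derivative H z) (at z)" for z
    using assms by (auto simp: C2_with_def)
  show "continuous_on UNIV (\<lambda>z. H z h)" using assms by (auto simp: C2_with_def)
  show "continuous_on UNIV f" by (meson f has_derivative_continuous continuous_at_imp_continuous_on)
  show "continuous_on UNIV g" by (meson g has_derivative_continuous continuous_at_imp_continuous_on)
  show "linear (H z)" using g has_derivative_linear by blast
qed

lemma C2_with_add:
  assumes "C2_with f g H" "C2_with f' g' H'"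
  shows "C2_with (\<lambda>z. f z + f' z) (\<lambda>z. g z + g' z) (\<lambda>z h. H z h + H' z h)"
  unfolding C2_with_def inner_add_left
  by (intro conjI allI has_derivative_add continuous_on_add C2_withD[OF assms(1)] C2_withD[OF assms(2)])

lemma C2_with_diff:
  assumes "C2_with f g H" "C2_with f' g' H'"
  shows "C2_with (\<lambda>z. f z - f' z) (\<lambda>z. g z - g' z) (\<lambda>z h. H z h - H' z h)"
  unfolding C2_with_def inner_diff_left
  by (intro conjI allI has_derivative_diff continuous_on_diff C2_withD[OF assms(1)] C2_withD[OF assms(2)])

lemma C2_with_diff_const:
  assumes "C2_with f g H"
  shows "C2_with (\<lambda>z. f z - c) g H"
  unfolding C2_with_def
  using has_derivative_diff[OF C2_withD(1)[OF assms] has_derivative_const] C2_withD(2,3)[OF assms] by simp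

lemma C2_with_exp:
  assumes "C2_with f g H"
  shows "C2_with (\<lambda>z. exp (f z)) (\<lambda>z. exp (f z) *\<^sub>R g z) (\<lambda>z h. (exp (f z) * (g z \<bullet> h)) *\<^sub>R g z + exp (f z) *\<^sub>R H z h)"
  unfolding C2_with_def
proof (intro conjI allI)
  note D = C2_withD[OF assms]
  have e: "((\<lambda>z. exp (f z)) has_derivative (\<lambda>h. exp (f z) * (g z \<bullet> h))) (at z)" for z
    using has_derivative_exp[OF D(1)[of z]] by (simp add: mult_ac)
  show "((\<lambda>z. exp (f z)) has_derivative (\<lambda>h. (exp (f z) *\<^sub>R g z) \<bullet> h)) (at z)" for z
    using e by simp
  show "((\<lambda>z. exp (f z) *\<^sub>R g z) has_derivative (\<lambda>h. (exp (f z) * (g z \<bullet> h)) *\<^sub>R g z + exp (f z) *\<^sub>R H z h)) (at z)" for z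
    using has_derivative_scaleR[OF e D(2)] by (simp add: add.commute)
  show "continuous_on UNIV (\<lambda>z. (exp (f z) * (g z \<bullet> h)) *\<^sub>R g z + exp (f z) *\<^sub>R H z h)" for h
    by (intro continuous_intros D)
qed

text \<open>Liouville's equation: 4 a^2 / D^2 is the conformal factor of the round metric pulled
  back under z \<mapsto> a (z - c). That this metric has curvature one means that the Laplacian of
  ln D equals this factor.\<close>

lemma C2_with_ln_quadratic:
  fixes a :: real and c :: complex
  defines "D \<equiv> \<lambda>z. 1 + a\<^sup>2 * (norm (z - c))\<^sup>2"
  shows "C2_with (\<lambda>z. ln (D z)) (\<lambda>z. (2 * a\<^sup>2 / D z) *\<^sub>R (z - c))
     (\<lambda>z h. (2 * a\<^sup>2 / D z) *\<^sub>R h - (4 * a^4 * ((z - c) \<bullet> h) / (D z)\<^sup>2) *\<^sub>R (z - c))"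
    and "lap (\<lambda>z h. (2 * a\<^sup>2 / D z) *\<^sub>R h - (4 * a^4 * ((z - c) \<bullet> h) / (D z)\<^sup>2) *\<^sub>R (z - c)) z = 4 * a\<^sup>2 / (D z)\<^sup>2"
proof -
  have pos: "D z > 0" for z by (simp add: D_def add_pos_nonneg)
  have D: "(D has_derivative (\<lambda>h. 2 * a\<^sup>2 * ((z - c) \<bullet> h))) (at z)" for z
  proof -
    have 1: "((\<lambda>z. z - c) has_derivative (\<lambda>h. h)) (at z)" by (auto intro!: derivative_eq_intros)
    have "((\<lambda>z. 1 + a\<^sup>2 * ((z - c) \<bullet> (z - c))) has_derivative (\<lambda>h. 0 + a\<^sup>2 * ((z - c) \<bullet> h + h \<bullet> (z - c)))) (at z)"
      by (intro has_derivative_add has_derivative_const has_derivative_mult_right has_derivative_inner[OF 1 1])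
    then show ?thesis unfolding D_def power2_norm_eq_inner by (simp add: inner_commute mult_ac)
  qed
  have contD: "continuous_on UNIV D"
    unfolding D_def by (intro continuous_intros)
  show "C2_with (\<lambda>z. ln (D z)) (\<lambda>z. (2 * a\<^sup>2 / D z) *\<^sub>R (z - c))
     (\<lambda>z h. (2 * a\<^sup>2 / D z) *\<^sub>R h - (4 * a^4 * ((z - c) \<bullet> h) / (D z)\<^sup>2) *\<^sub>R (z - c))"
    unfolding C2_with_def
  proof (intro conjI allI)
    fix z
    show "((\<lambda>z. ln (D z)) has_derivative (\<lambda>h. ((2 * a\<^sup>2 / D z) *\<^sub>R (z - c)) \<bullet> h)) (at z)"
      by (rule has_derivative_eq_rhs[OF has_derivative_ln[OF pos D[of z]]])
         (simp only: inner_scaleR_left fun_eq_iff, simp add: field_simps)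
    have 2: "((\<lambda>z. 2 * a\<^sup>2 / D z) has_derivative (\<lambda>h. - (4 * a^4 * ((z - c) \<bullet> h) / (D z)\<^sup>2))) (at z)"
    proof -
      have "((\<lambda>z. 2 * a\<^sup>2 / D z) has_derivative (\<lambda>h. (0 * D z - (2 * a\<^sup>2) * (2 * a\<^sup>2 * ((z - c) \<bullet> h))) / (D z * D z))) (at z)"
        using pos[of z] by (intro has_derivative_divide'[OF has_derivative_const D]) simp
      moreover have "(0 * D z - (2 * a\<^sup>2) * (2 * a\<^sup>2 * ((z - c) \<bullet> h))) / (D z * D z) = - (4 * a^4 * ((z - c) \<bullet> h) / (D z)\<^sup>2)" for h
        by (simp add: power2_eq_square power4_eq_xxxx)
      ultimately show ?thesis by simp
    qed
    have 1: "((\<lambda>z. z - c) has_derivative (\<lambda>h. h)) (at z)" by (auto intro!: derivative_eq_intros)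
    show "((\<lambda>z. (2 * a\<^sup>2 / D z) *\<^sub>R (z - c)) has_derivative
        (\<lambda>h. (2 * a\<^sup>2 / D z) *\<^sub>R h - (4 * a^4 * ((z - c) \<bullet> h) / (D z)\<^sup>2) *\<^sub>R (z - c))) (at z)"
      using has_derivative_scaleR[OF 2 1] by simp
  next
    fix h
    show "continuous_on UNIV (\<lambda>z. (2 * a\<^sup>2 / D z) *\<^sub>R h - (4 * a^4 * ((z - c) \<bullet> h) / (D z)\<^sup>2) *\<^sub>R (z - c))"
      using pos by (intro continuous_intros contD) (simp_all add: less_imp_neq[THEN not_sym])
  qed
  have n: "(Re (z - c))\<^sup>2 + (Im (z - c))\<^sup>2 = (norm (z - c))\<^sup>2" by (rule cmod_power2[symmetric])
  have "lap (\<lambda>z h. (2 * a\<^sup>2 / D z) *\<^sub>R h - (4 * a^4 * ((z - c) \<bullet> h) / (D z)\<^sup>2) *\<^sub>R (z - c)) z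
    = 4 * a\<^sup>2 / D z - 4 * a^4 * ((Re (z - c))\<^sup>2 + (Im (z - c))\<^sup>2) / (D z)\<^sup>2"
  proof -
    have "Re (k *\<^sub>R 1 - (e * (p \<bullet> 1) / d) *\<^sub>R p) + Im (k *\<^sub>R \<i> - (e * (p \<bullet> \<i>) / d) *\<^sub>R p)
        = 2 * k - e * ((Re p)\<^sup>2 + (Im p)\<^sup>2) / d" for k e d and p :: complex
      by (simp add: inner_complex_def power2_eq_square add_divide_distrib distrib_left mult_ac)
    from this[of "2 * a\<^sup>2 / D z" "4 * a^4" "z - c" "(D z)\<^sup>2"] show ?thesis unfolding lap_def by simp
  qed
  also have "\<dots> = (4 * a\<^sup>2 * D z - 4 * a^4 * (norm (z - c))\<^sup>2) / (D z)\<^sup>2"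
    unfolding n using pos[of z] by (simp add: power2_eq_square diff_divide_distrib)
  also have "4 * a\<^sup>2 * D z - 4 * a^4 * (norm (z - c))\<^sup>2 = 4 * a\<^sup>2"
    by (simp add: D_def algebra_simps power2_eq_square power4_eq_xxxx)
  finally show "lap (\<lambda>z h. (2 * a\<^sup>2 / D z) *\<^sub>R h - (4 * a^4 * ((z - c) \<bullet> h) / (D z)\<^sup>2) *\<^sub>R (z - c)) z = 4 * a\<^sup>2 / (D z)\<^sup>2" .
qed

lemma has_derivative_inverse_cnj:
  assumes "z \<noteq> 0"
  shows "((\<lambda>z. 1 / cnj z) has_derivative (\<lambda>h. - cnj h / (cnj z)\<^sup>2)) (at z)"
proof -
  have "((\<lambda>z. 1 / cnj z) has_derivative (\<lambda>h. (0 * cnj z - 1 * cnj h) / (cnj z * cnj z))) (at z)"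
    by (rule has_derivative_divide'[OF has_derivative_const has_derivative_cnj[OF has_derivative_ident]]) (use assms in simp)
  then show ?thesis by (simp add: power2_eq_square)
qed

text \<open>\<open>z \<mapsto> 1 / cnj z\<close> is the transition map between the two stereographic projections.\<close>

locale chart_pair =
  fixes u1 u2 :: "complex \<Rightarrow> real" and g1 g2 :: "complex \<Rightarrow> complex" and H1 H2 :: "complex \<Rightarrow> complex \<Rightarrow> complex"
  assumes C2_1: "C2_with u1 g1 H1" and C2_2: "C2_with u2 g2 H2"
    and pair: "\<And>z. z \<noteq> 0 \<Longrightarrow> u1 z = u2 (1 / cnj z)"
begin

lemma grad_eq:
  assumes "z \<noteq> 0" shows "g1 z = - cnj (g2 (1 / cnj z)) / (cnj z)\<^sup>2"
proof -
  have "((\<lambda>z. u2 (1 / cnj z)) has_derivative (\<lambda>h. g2 (1 / cnj z) \<bullet> (- cnj h / (cnj z)\<^sup>2))) (at z)"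
    by (rule has_derivative_compose[OF has_derivative_inverse_cnj[OF assms] C2_withD(1)[OF C2_2]])
  then have "(u1 has_derivative (\<lambda>h. g2 (1 / cnj z) \<bullet> (- cnj h / (cnj z)\<^sup>2))) (at z)"
    by (rule has_derivative_transform_within_open[where s = "- {0}"]) (use assms pair in auto)
  from fun_cong[OF has_derivative_unique[OF this C2_withD(1)[OF C2_1]]]
  have "g2 (1 / cnj z) \<bullet> (- cnj h / (cnj z)\<^sup>2) = g1 z \<bullet> h" for h .
  moreover have "g2 (1 / cnj z) \<bullet> (- cnj h / (cnj z)\<^sup>2) = (- cnj (g2 (1 / cnj z)) / (cnj z)\<^sup>2) \<bullet> h" for h
  proof -
    have "a \<bullet> (- cnj h * b) = (- cnj a * b) \<bullet> h" for a b :: complex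
      by (simp add: inner_complex_def algebra_simps)
    from this[of "g2 (1 / cnj z)" "1 / (cnj z)\<^sup>2"] show ?thesis by simp
  qed
  ultimately have "\<forall>h. g1 z \<bullet> h = (- cnj (g2 (1 / cnj z)) / (cnj z)\<^sup>2) \<bullet> h" by simp
  then show ?thesis by (simp only: vector_eq_rdot)
qed

lemma hess_eq:
  assumes "z \<noteq> 0"
  shows "H1 z h = - cnj (H2 (1 / cnj z) (- cnj h / (cnj z)\<^sup>2)) / (cnj z)\<^sup>2 + 2 * cnj (g2 (1 / cnj z)) * cnj h / (cnj z)^3"
proof -
  have 1: "((\<lambda>z. - cnj (g2 (1 / cnj z))) has_derivative (\<lambda>h. - cnj (H2 (1 / cnj z) (- cnj h / (cnj z)\<^sup>2)))) (at z)"
    by (intro has_derivative_minus has_derivative_cnj has_derivative_compose[OF has_derivative_inverse_cnj[OF assms] C2_withD(2)[OF C2_2]])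
  have 0: "(cnj has_derivative cnj) (at z)" using has_derivative_cnj[OF has_derivative_ident] by simp
  have 2: "((\<lambda>z. (cnj z)\<^sup>2) has_derivative (\<lambda>h. 2 * cnj z * cnj h)) (at z)"
    using has_derivative_mult[OF 0 0] by (simp add: power2_eq_square algebra_simps)
  have "((\<lambda>z. - cnj (g2 (1 / cnj z)) / (cnj z)\<^sup>2) has_derivative
     (\<lambda>h. (- cnj (H2 (1 / cnj z) (- cnj h / (cnj z)\<^sup>2)) * (cnj z)\<^sup>2 - (- cnj (g2 (1 / cnj z))) * (2 * cnj z * cnj h)) / ((cnj z)\<^sup>2 * (cnj z)\<^sup>2))) (at z)"
    by (rule has_derivative_divide'[OF 1 2]) (use assms in simp)
  then have "(g1 has_derivative
     (\<lambda>h. (- cnj (H2 (1 / cnj z) (- cnj h / (cnj z)\<^sup>2)) * (cnj z)\<^sup>2 - (- cnj (g2 (1 / cnj z))) * (2 * cnj z * cnj h)) / ((cnj z)\<^sup>2 * (cnj z)\<^sup>2))) (at z)"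
    by (rule has_derivative_transform_within_open[where s = "- {0}"]) (use assms grad_eq in auto)
  from fun_cong[OF has_derivative_unique[OF this C2_withD(2)[OF C2_1]], of h]
  have "H1 z h = (- cnj (H2 (1 / cnj z) (- cnj h / (cnj z)\<^sup>2)) * (cnj z)\<^sup>2 - (- cnj (g2 (1 / cnj z))) * (2 * cnj z * cnj h)) / ((cnj z)\<^sup>2 * (cnj z)\<^sup>2)"
    by (rule sym)
  also have "\<dots> = - cnj (H2 (1 / cnj z) (- cnj h / (cnj z)\<^sup>2)) / (cnj z)\<^sup>2 + 2 * cnj (g2 (1 / cnj z)) * cnj h / (cnj z)^3"
  proof -
    have "(- X * y\<^sup>2 - (- G) * (2 * y * k)) / (y\<^sup>2 * y\<^sup>2) = - X / y\<^sup>2 + 2 * G * k / y^3" if "y \<noteq> 0" for X y G k :: complex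
      using that by (simp add: field_simps power2_eq_square power3_eq_cube)
    from this[of "cnj z"] show ?thesis using assms by simp
  qed
  finally show ?thesis .
qed

text \<open>The inversion is anticonformal with derivative of modulus |z|^(-2), so the Laplacian
  scales by its square. The gradient term of \<open>hess_eq\<close> is a multiple of
  \<open>cnj h\<close> and has trace zero.\<close>

lemma lap_eq:
  assumes "z \<noteq> 0" shows "lap H1 z = lap H2 (1 / cnj z) / (norm z)^4"
proof -
  define v r where "v = 1 / cnj z" and "r = 1 / (cnj z)\<^sup>2"
  have lin: "H2 v h = Re h *\<^sub>R H2 v 1 + Im h *\<^sub>R H2 v \<i>" for h
  proof -
    interpret l: linear "H2 v" by (rule C2_withD(6)[OF C2_2])
    have "H2 v (Re h *\<^sub>R 1 + Im h *\<^sub>R \<i>) = Re h *\<^sub>R H2 v 1 + Im h *\<^sub>R H2 v \<i>"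
      unfolding l.add l.scaleR ..
    moreover have "Re h *\<^sub>R 1 + Im h *\<^sub>R \<i> = h" by (simp add: complex_eq_iff)
    ultimately show ?thesis by simp
  qed
  define d where "d = 2 * cnj (g2 v) / (cnj z)^3"
  have H1: "H1 z h = - cnj (H2 v (- cnj h * r)) * r + d * cnj h" for h
    using hess_eq[OF assms] by (simp add: v_def r_def d_def)
  have "lap H1 z = Re (- cnj (H2 v (- r)) * r) + Im (- cnj (H2 v (\<i> * r)) * r)"
    unfolding lap_def H1 by (simp add: complex_cnj_i del: complex_cnj_power)
  also have "\<dots> = ((Re r)\<^sup>2 + (Im r)\<^sup>2) * lap H2 v"
    unfolding lin[of "- r"] lin[of "\<i> * r"] lap_def by (simp add: power2_eq_square algebra_simps)
  also have "(Re r)\<^sup>2 + (Im r)\<^sup>2 = 1 / (norm z)^4"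
    unfolding cmod_power2[symmetric] r_def by (simp add: norm_divide norm_power power_divide flip: power_mult)
  finally show ?thesis by (simp add: v_def)
qed

section \<open>Decay at infinity from bounds in the opposite chart\<close>

lemma bounds_exist:
  obtains K where "K > 0" "\<And>z. norm z \<le> 2 \<Longrightarrow> \<bar>u1 z\<bar> \<le> K" "\<And>z. norm z \<le> 2 \<Longrightarrow> \<bar>u2 z\<bar> \<le> K"
    "\<And>z. norm z \<le> 2 \<Longrightarrow> norm (g1 z) \<le> K" "\<And>z. norm z \<le> 2 \<Longrightarrow> norm (g2 z) \<le> K"
    "\<And>z h. norm z \<le> 2 \<Longrightarrow> norm (H1 z h) \<le> K * norm h" "\<And>z h. norm z \<le> 2 \<Longrightarrow> norm (H2 z h) \<le> K * norm h"
proof -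
  have ex: "\<exists>K>0. \<forall>z. norm z \<le> 2 \<longrightarrow> \<bar>u z\<bar> \<le> K \<and> norm (g z) \<le> K \<and> (\<forall>h. norm (H z h) \<le> K * norm h)"
    if C2: "C2_with u g H" for u g H
  proof -
    note D = C2_withD[OF C2]
    have b: "\<exists>B. \<forall>z. norm z \<le> 2 \<longrightarrow> norm (F z) \<le> B" if "continuous_on UNIV F" for F :: "complex \<Rightarrow> 'b::real_normed_vector"
    proof -
      have "bounded (F ` cball 0 2)"
        by (intro compact_imp_bounded compact_continuous_image continuous_on_subset[OF that]) auto
      then obtain B where "\<forall>x\<in>cball 0 2. norm (F x) \<le> B" by (auto simp: bounded_iff)
      then show ?thesis by (intro exI[of _ B]) auto
    qed
    obtain B1 where B1: "\<And>z. norm z \<le> 2 \<Longrightarrow> norm (u z) \<le> B1" using b[OF D(4)] by blast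
    obtain B2 where B2: "\<And>z. norm z \<le> 2 \<Longrightarrow> norm (g z) \<le> B2" using b[OF D(5)] by blast
    obtain B3 where B3: "\<And>z. norm z \<le> 2 \<Longrightarrow> norm (H z 1) \<le> B3" using b[OF D(3)] by blast
    obtain B4 where B4: "\<And>z. norm z \<le> 2 \<Longrightarrow> norm (H z \<i>) \<le> B4" using b[OF D(3)] by blast
    note B = B1 B2 B3 B4
    define K where "K = 1 + \<bar>B1\<bar> + \<bar>B2\<bar> + \<bar>B3\<bar> + \<bar>B4\<bar>"
    show ?thesis
    proof (intro exI conjI allI impI)
      show "K > 0" by (simp add: K_def add_pos_nonneg)
      fix z :: complex assume z: "norm z \<le> 2"
      show "\<bar>u z\<bar> \<le> K" "norm (g z) \<le> K" using B(1,2)[OF z] by (auto simp: K_def)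
      fix h
      interpret l: linear "H z" by (rule D(6))
      have "H z (Re h *\<^sub>R 1 + Im h *\<^sub>R \<i>) = Re h *\<^sub>R H z 1 + Im h *\<^sub>R H z \<i>"
        unfolding l.add l.scaleR ..
      moreover have "Re h *\<^sub>R 1 + Im h *\<^sub>R \<i> = h" by (simp add: complex_eq_iff)
      ultimately have "norm (H z h) \<le> \<bar>Re h\<bar> * norm (H z 1) + \<bar>Im h\<bar> * norm (H z \<i>)"
        using norm_triangle_ineq[of "Re h *\<^sub>R H z 1" "Im h *\<^sub>R H z \<i>"] by simp
      also have "\<dots> \<le> norm h * \<bar>B3\<bar> + norm h * \<bar>B4\<bar>"
        using B(3,4)[OF z] by (intro add_mono mult_mono abs_Re_le_cmod abs_Im_le_cmod) auto
      also have "\<dots> \<le> K * norm h"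
        by (simp add: K_def algebra_simps)
      finally show "norm (H z h) \<le> K * norm h" .
    qed
  qed
  obtain K1 where K1: "K1 > 0" "\<And>z. norm z \<le> 2 \<Longrightarrow> \<bar>u1 z\<bar> \<le> K1 \<and> norm (g1 z) \<le> K1 \<and> (\<forall>h. norm (H1 z h) \<le> K1 * norm h)"
    using ex[OF C2_1] by blast
  obtain K2 where K2: "K2 > 0" "\<And>z. norm z \<le> 2 \<Longrightarrow> \<bar>u2 z\<bar> \<le> K2 \<and> norm (g2 z) \<le> K2 \<and> (\<forall>h. norm (H2 z h) \<le> K2 * norm h)"
    using ex[OF C2_2] by blast
  show ?thesis
  proof (rule that[of "K1 + K2"])
    fix z h :: complex assume z: "norm z \<le> 2"
    have "norm (H1 z h) \<le> K1 * norm h" "norm (H2 z h) \<le> K2 * norm h" using K1(2) K2(2) z by auto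
    then show "norm (H1 z h) \<le> (K1 + K2) * norm h" "norm (H2 z h) \<le> (K1 + K2) * norm h"
      using K1(1) K2(1) by (auto simp: distrib_right add_increasing add_increasing2)
  qed (use K1 K2 in \<open>fastforce+\<close>)
qed

text \<open>Inside the unit disc compactness suffices. Outside, a point is moved by inversion into
  the unit disc of the other chart, and the powers of |z| in \<open>grad_eq\<close> and
  \<open>hess_eq\<close> become the decay in \<open>wt\<close>. The constants are generous so that a
  single one serves for all bounds.\<close>

lemma estimates:
  obtains C where "C > 0" "\<And>z. norm (g1 z) \<le> C / wt z"
    "\<And>z h. norm (H1 z h) \<le> C * norm h / (wt z * sqrt (wt z))"
    "\<And>z q. \<bar>u1 z - u1 q\<bar> \<le> C * chd z q"
proof -
  obtain K where K: "K > 0" "\<And>z. norm z \<le> 2 \<Longrightarrow> \<bar>u1 z\<bar> \<le> K" "\<And>z. norm z \<le> 2 \<Longrightarrow> \<bar>u2 z\<bar> \<le> K"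
    "\<And>z. norm z \<le> 2 \<Longrightarrow> norm (g1 z) \<le> K" "\<And>z. norm z \<le> 2 \<Longrightarrow> norm (g2 z) \<le> K"
    "\<And>z h. norm z \<le> 2 \<Longrightarrow> norm (H1 z h) \<le> K * norm h" "\<And>z h. norm z \<le> 2 \<Longrightarrow> norm (H2 z h) \<le> K * norm h"
    using bounds_exist by blast
  have inv: "norm (1 / cnj z) \<le> 1" if "1 \<le> norm z" for z :: complex
    using that by (auto simp: norm_divide divide_le_eq)
  have s_small: "sqrt (wt z) \<le> 2" "wt z \<le> 2" if "norm z \<le> 1" for z
  proof -
    have "(norm z)\<^sup>2 \<le> 1" using that by (simp add: power_le_one)
    then show "wt z \<le> 2" by simp
    then show "sqrt (wt z) \<le> 2" by (intro real_le_lsqrt) auto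
  qed
  have s_big: "wt z \<le> 2 * (norm z)\<^sup>2" "sqrt (wt z) \<le> 2 * norm z" if "1 \<le> norm z" for z
  proof -
    have "1 \<le> (norm z)\<^sup>2" using that by (simp add: one_le_power)
    then show "wt z \<le> 2 * (norm z)\<^sup>2" by simp
    then show "sqrt (wt z) \<le> 2 * norm z" by (intro real_le_lsqrt) (auto simp: power_mult_distrib)
  qed
  have g: "norm (g1 z) \<le> 16 * K / wt z" for z
  proof (cases "norm z \<le> 1")
    case True
    have "norm (g1 z) * wt z \<le> K * 2"
      using True K s_small[OF True] by (intro mult_mono) auto
    then show ?thesis using K(1) wt_pos(1)[of z] by (simp add: le_divide_eq)
  next
    case False
    then have z: "1 \<le> norm z" "z \<noteq> 0" by auto
    have "norm (g1 z) = norm (g2 (1 / cnj z)) / (norm z)\<^sup>2"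
      unfolding grad_eq[OF z(2)] by (simp add: norm_divide norm_power)
    also have "\<dots> \<le> K / (norm z)\<^sup>2" using inv[OF z(1)] by (intro divide_right_mono K) auto
    also have "\<dots> = (2 * K) / (2 * (norm z)\<^sup>2)" by simp
    also have "\<dots> \<le> 2 * K / wt z"
      using s_big(1)[OF z(1)] K(1) z(2) wt_pos(1)[of z] by (intro divide_left_mono) auto
    also have "\<dots> \<le> 16 * K / wt z"
      using K(1) wt_pos(1)[of z] by (intro divide_right_mono) auto
    finally show ?thesis .
  qed
  have H: "norm (H1 z h) \<le> 16 * K * norm h / (wt z * sqrt (wt z))" for z h
  proof (cases "norm z \<le> 1")
    case True
    have "norm (H1 z h) * (wt z * sqrt (wt z)) \<le> (K * norm h) * (2 * 2)"
      using True K s_small[OF True] by (intro mult_mono) auto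
    also have "\<dots> \<le> 16 * K * norm h" using K(1) by simp
    finally show ?thesis using wt_pos(1)[of z] by (subst le_divide_eq) auto
  next
    case False
    then have z: "1 \<le> norm z" "z \<noteq> 0" by auto
    have "norm (H1 z h) \<le> norm (H2 (1 / cnj z) (- cnj h / (cnj z)\<^sup>2)) / (norm z)\<^sup>2 + 2 * norm (g2 (1 / cnj z)) * norm h / (norm z)^3"
      unfolding hess_eq[OF z(2)] by (rule order_trans[OF norm_triangle_ineq]) (simp add: norm_divide norm_power norm_mult)
    also have "\<dots> \<le> (K * norm (- cnj h / (cnj z)\<^sup>2)) / (norm z)\<^sup>2 + 2 * K * norm h / (norm z)^3"
      using inv[OF z(1)] K(1) by (intro add_mono divide_right_mono mult_mono K) auto
    also have "(K * norm (- cnj h / (cnj z)\<^sup>2)) / (norm z)\<^sup>2 = K * norm h / (norm z)^4"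
      by (simp add: norm_divide norm_power flip: power_mult power_add)
    also have "K * norm h / (norm z)^4 \<le> K * norm h / (norm z)^3"
      using z K(1) by (intro divide_left_mono power_increasing) auto
    also have "K * norm h / (norm z)^3 + 2 * K * norm h / (norm z)^3 = 3 * K * norm h / (norm z)^3"
      by (simp add: add_divide_distrib[symmetric])
    also have "\<dots> \<le> 16 * K * norm h / (wt z * sqrt (wt z))"
    proof -
      have "wt z * sqrt (wt z) \<le> (2 * (norm z)\<^sup>2) * (2 * norm z)"
        using s_big[OF z(1)] by (intro mult_mono) auto
      also have "\<dots> = 4 * (norm z)^3" by (simp add: power2_eq_square power3_eq_cube)
      finally have "(3 * K * norm h) * (wt z * sqrt (wt z)) \<le> (3 * K * norm h) * (4 * (norm z)^3)"
        using K(1) by (intro mult_left_mono) auto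
      also have "\<dots> \<le> (16 * K * norm h) * (norm z)^3" using K(1) by (simp add: mult_right_mono)
      finally show ?thesis using wt_pos(1)[of z] z by (simp add: frac_le_eq divide_le_eq le_divide_eq mult_ac del: mult_le_cancel_left)
    qed
    finally show ?thesis by simp
  qed
  have lip: "\<bar>u z - u q\<bar> \<le> K * norm (z - q)" if C2: "C2_with u g' H'" and b: "\<And>z. norm z \<le> 2 \<Longrightarrow> norm (g' z) \<le> K"
    and "norm z \<le> 2" "norm q \<le> 2" for u g' H' z q
  proof -
    have "norm (u z - u q) \<le> K * norm (z - q)"
    proof (rule differentiable_bound[where S = "cball 0 2" and f' = "\<lambda>x h. g' x \<bullet> h"])
      fix x :: complex assume x: "x \<in> cball 0 2"
      show "(u has_derivative (\<lambda>h. g' x \<bullet> h)) (at x within cball 0 2)"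
        by (rule has_derivative_at_withinI[OF C2_withD(1)[OF C2]])
      show "onorm (\<lambda>h. g' x \<bullet> h) \<le> K"
      proof (rule onorm_le)
        fix h
        have "norm (g' x \<bullet> h) \<le> norm (g' x) * norm h" using Cauchy_Schwarz_ineq2 by simp
        also have "\<dots> \<le> K * norm h" using b[of x] x by (intro mult_right_mono) auto
        finally show "norm (g' x \<bullet> h) \<le> K * norm h" .
      qed
    qed (use that in auto)
    then show ?thesis by simp
  qed
  have u_bound: "\<bar>u1 z\<bar> \<le> K" for z
  proof (cases "norm z \<le> 1")
    case False
    then have "z \<noteq> 0" "1 \<le> norm z" by auto
    then show ?thesis using inv[of z] K(3)[of "1 / cnj z"] pair[of z] by simp
  qed (use K in auto)
  have chord_le: "norm (z - q) = chd z q * (sqrt (wt z) * sqrt (wt q))" for z q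
    using chd_bounds(4)[of z q] by simp
  \<comment> \<open>The points are at chordal distance at least 1/8, since |q| / 2 \<le> |z - q|
    \<le> 4 |q| \<open>chd z q\<close>. The oscillation 2 K of \<open>u1\<close> is then at most 16
    K \<open>chd z q\<close>.\<close>
  have far: "\<bar>u1 z - u1 q\<bar> \<le> 16 * K * chd z q" if "norm z \<le> 1" "2 \<le> norm q" for z q
  proof -
    have "norm q / 2 \<le> norm q - norm z" using that by simp
    also have "\<dots> \<le> norm (z - q)" by (metis norm_minus_commute norm_triangle_ineq2)
    also have "\<dots> \<le> chd z q * (2 * (2 * norm q))"
      unfolding chord_le using s_small[OF that(1)] s_big[of q] that(2) chd_bounds
      by (intro mult_left_mono mult_mono) auto
    finally have "norm q * 1 \<le> norm q * (8 * chd z q)" by (simp add: mult_ac)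
    then have "1 \<le> 8 * chd z q" using that(2) by (subst (asm) mult_le_cancel_left_pos) auto
    then have "2 * K * 1 \<le> 2 * K * (8 * chd z q)" using K(1) by (intro mult_left_mono) auto
    moreover have "\<bar>u1 z - u1 q\<bar> \<le> 2 * K" using u_bound[of z] u_bound[of q] by linarith
    ultimately show ?thesis by simp
  qed
  have ch: "\<bar>u1 z - u1 q\<bar> \<le> 16 * K * chd z q" for z q
  proof -
    \<comment> \<open>Radius 2 makes the two charts overlap: a pair that lies in no common disc or
      exterior is separated by the annulus between radii 1 and 2.\<close>
    consider "norm z \<le> 2" "norm q \<le> 2" | "1 \<le> norm z" "1 \<le> norm q" | "norm z \<le> 1" "2 \<le> norm q" | "norm q \<le> 1" "2 \<le> norm z"
      by linarith
    then show ?thesis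
    proof cases
      case 1
      have s: "sqrt (wt x) \<le> 4" if "norm x \<le> 2" for x
      proof -
        have "(norm x)\<^sup>2 \<le> 2\<^sup>2" using that by (intro power_mono) auto
        then show ?thesis by (intro real_le_lsqrt) auto
      qed
      have "\<bar>u1 z - u1 q\<bar> \<le> K * norm (z - q)" using lip[OF C2_1 K(4)] 1 by blast
      also have "\<dots> \<le> K * (chd z q * (4 * 4))"
        unfolding chord_le using s 1 chd_bounds K(1) by (intro mult_left_mono mult_mono) auto
      finally show ?thesis by (simp add: mult_ac)
    next
      case 2
      then have nz: "z \<noteq> 0" "q \<noteq> 0" by auto
      have "\<bar>u1 z - u1 q\<bar> \<le> K * norm (1 / cnj z - 1 / cnj q)"
        unfolding pair[OF nz(1)] pair[OF nz(2)]
        by (rule lip[OF C2_2 K(5)]) (use inv[OF 2(1)] inv[OF 2(2)] in auto)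
      also have "norm (1 / cnj z - 1 / cnj q) = norm (z - q) / (norm z * norm q)"
      proof -
        have "1 / cnj z - 1 / cnj q = cnj (q - z) / (cnj z * cnj q)" using nz by (simp add: field_simps)
        then show ?thesis by (simp add: norm_divide norm_mult norm_minus_commute del: complex_cnj_diff)
      qed
      also have "K * (norm (z - q) / (norm z * norm q)) \<le> K * (chd z q * ((2 * norm z) * (2 * norm q)) / (norm z * norm q))"
        unfolding chord_le using s_big 2 chd_bounds K(1)
        by (intro mult_left_mono divide_right_mono mult_mono) auto
      also have "\<dots> = 4 * K * chd z q" using nz by simp
      also have "\<dots> \<le> 16 * K * chd z q" using K(1) chd_bounds(1)[of z q] by (simp add: mult_right_mono)
      finally show ?thesis .
    next
      case 3 then show ?thesis by (rule far)
    next
      case 4 then show ?thesis using far[of q z] by (simp add: chd_commute abs_minus_commute)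
    qed
  qed
  show ?thesis by (rule that[of "16 * K"]) (use K(1) g H ch in auto)
qed

end

section \<open>Boosts\<close>

text \<open>An affine map changes |z| by at most a factor and a summand, hence \<open>wt\<close> by
  a bounded factor. One direction is enough: decay at the image point has to become decay at
  z.\<close>

lemma wt_affine_le:
  fixes c :: complex and a :: real
  assumes "a > 0"
  obtains k where "k \<ge> 1" "\<And>z. sqrt (wt z) \<le> k * sqrt (wt (c + (1 / a) *\<^sub>R z))"
proof
  define K where "K = 1 + 2 * a\<^sup>2 + 2 * a\<^sup>2 * (norm c)\<^sup>2"
  have K: "K \<ge> 1" by (simp add: K_def)
  show "sqrt K \<ge> 1" using K by simp
  fix z
  define y where "y = c + (1 / a) *\<^sub>R z"
  have z: "z = a *\<^sub>R (y - c)" using assms by (simp add: y_def)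
  have "norm z \<le> a * (norm y + norm c)"
    unfolding z using assms norm_triangle_ineq4[of y c] by simp
  then have "(norm z)\<^sup>2 \<le> (a * (norm y + norm c))\<^sup>2" by (intro power_mono) auto
  also have "\<dots> \<le> a\<^sup>2 * (2 * ((norm y)\<^sup>2 + (norm c)\<^sup>2))"
    unfolding power_mult_distrib using zero_le_power2[of "norm y - norm c"]
    by (intro mult_left_mono) (auto simp: power2_sum power2_diff)
  finally have "wt z \<le> 1 + a\<^sup>2 * (2 * ((norm y)\<^sup>2 + (norm c)\<^sup>2))" by simp
  also have "\<dots> \<le> K * wt y"
    by (simp add: K_def algebra_simps)
  finally have "sqrt (wt z) \<le> sqrt (K * wt y)" by simp
  then show "sqrt (wt z) \<le> sqrt K * sqrt (wt (c + (1 / a) *\<^sub>R z))" unfolding real_sqrt_mult y_def .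
qed

lemma C2_with_affine:
  assumes "C2_with f g H"
  shows "C2_with (\<lambda>z. f (c + s *\<^sub>R z)) (\<lambda>z. s *\<^sub>R g (c + s *\<^sub>R z)) (\<lambda>z h. s\<^sup>2 *\<^sub>R H (c + s *\<^sub>R z) h)"
  unfolding C2_with_def
proof (intro conjI allI)
  note D = C2_withD[OF assms]
  fix z
  have A: "((\<lambda>z. c + s *\<^sub>R z) has_derivative (\<lambda>h. s *\<^sub>R h)) (at z)"
    by (auto intro!: derivative_eq_intros)
  show "((\<lambda>z. f (c + s *\<^sub>R z)) has_derivative (\<lambda>h. s *\<^sub>R g (c + s *\<^sub>R z) \<bullet> h)) (at z)"
    using has_derivative_compose[OF A D(1)] by simp
  have "((\<lambda>z. s *\<^sub>R g (c + s *\<^sub>R z)) has_derivative (\<lambda>h. s *\<^sub>R H (c + s *\<^sub>R z) (s *\<^sub>R h))) (at z)"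
    by (rule has_derivative_scaleR_right[OF has_derivative_compose[OF A D(2)]])
  then show "((\<lambda>z. s *\<^sub>R g (c + s *\<^sub>R z)) has_derivative (\<lambda>h. s\<^sup>2 *\<^sub>R H (c + s *\<^sub>R z) h)) (at z)"
    by (simp add: linear_cmul[OF D(6)] power2_eq_square)
next
  fix h
  show "continuous_on UNIV (\<lambda>z. s\<^sup>2 *\<^sub>R H (c + s *\<^sub>R z) h)"
    by (intro continuous_intros continuous_on_compose2[OF C2_withD(3)[OF assms]]) auto
qed

lemma lap_scale: "lap (\<lambda>z h. s *\<^sub>R H (c z) h) z = s * lap H (c z)"
  by (simp add: lap_def distrib_left)

text \<open>Gradient, Hessian and chordal bounds survive the substitution with a larger constant.
  The positive lower bound is a minimum over two closed unit discs, one in each chart, which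
  together cover the sphere.\<close>

lemma (in chart_pair) sphere_profile_affine:
  assumes pos: "\<And>z. u1 z > 0" "\<And>z. u2 z > 0" and a: "a > 0"
  obtains C m where "sphere_profile (\<lambda>z. u1 (c + (1 / a) *\<^sub>R z)) (\<lambda>z. (1 / a) *\<^sub>R g1 (c + (1 / a) *\<^sub>R z))
    (\<lambda>z h. (1 / a)\<^sup>2 *\<^sub>R H1 (c + (1 / a) *\<^sub>R z) h) C m"
proof -
  obtain C where C: "C > 0" "\<And>z. norm (g1 z) \<le> C / wt z"
    "\<And>z h. norm (H1 z h) \<le> C * norm h / (wt z * sqrt (wt z))"
    "\<And>z q. \<bar>u1 z - u1 q\<bar> \<le> C * chd z q"
    using estimates by blast
  obtain k where k: "k \<ge> 1" "\<And>z. sqrt (wt z) \<le> k * sqrt (wt (c + (1 / a) *\<^sub>R z))"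
    using wt_affine_le[OF a] by blast
  have ex: "\<exists>m>0. \<forall>z. norm z \<le> 1 \<longrightarrow> m \<le> u z" if "continuous_on UNIV u" "\<And>z. u z > 0" for u :: "complex \<Rightarrow> real"
  proof -
    have "continuous_on (cball 0 1) u" by (rule continuous_on_subset[OF that(1)]) auto
    then obtain z0 where "\<forall>z\<in>cball 0 1. u z0 \<le> u z"
      using continuous_attains_inf[of "cball 0 1" u] by auto
    then show ?thesis using that(2)[of z0] by (intro exI[of _ "u z0"]) auto
  qed
  obtain m1 m2 where m: "m1 > 0" "m2 > 0" "\<And>z. norm z \<le> 1 \<Longrightarrow> m1 \<le> u1 z" "\<And>z. norm z \<le> 1 \<Longrightarrow> m2 \<le> u2 z"
    using ex[OF C2_withD(4)[OF C2_1] pos(1)] ex[OF C2_withD(4)[OF C2_2] pos(2)] by blast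
  define m where "m = min m1 m2"
  have lower: "m \<le> u1 z" for z
  proof (cases "norm z \<le> 1")
    case True then show ?thesis using m(3)[OF True] by (simp add: m_def)
  next
    case False
    then have "z \<noteq> 0" "norm (1 / cnj z) \<le> 1" by (auto simp: norm_divide divide_le_eq)
    then show ?thesis using m(4)[of "1 / cnj z"] pair[of z] by (simp add: m_def)
  qed
  define A where "A z = c + (1 / a) *\<^sub>R z" for z
  have kA: "sqrt (wt z) \<le> k * sqrt (wt (A z))" for z unfolding A_def by (rule k)
  have inv1: "1 / sqrt (wt (A z)) \<le> k / sqrt (wt z)" for z
    using kA[of z] sqrt_wt(4)[of z] sqrt_wt(4)[of "A z"] by (simp add: divide_le_eq le_divide_eq mult.commute)
  have inv2: "1 / wt (A z) \<le> k\<^sup>2 / wt z" for z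
  proof -
    have "(1 / sqrt (wt (A z)))\<^sup>2 \<le> (k / sqrt (wt z))\<^sup>2"
      using inv1 sqrt_wt(4)[of "A z"] by (intro power_mono) (auto simp: less_imp_le)
    then show ?thesis unfolding power_divide sqrt_wt(3) by simp
  qed
  have inv3: "1 / (wt (A z) * sqrt (wt (A z))) \<le> k^3 / (wt z * sqrt (wt z))" for z
  proof -
    have "1 / wt (A z) * (1 / sqrt (wt (A z))) \<le> k\<^sup>2 / wt z * (k / sqrt (wt z))"
      using inv1 inv2 wt_pos(1)[of "A z"] wt_pos(1)[of z] by (intro mult_mono) auto
    then show ?thesis by (simp add: power2_eq_square power3_eq_cube mult_ac)
  qed
  define C' where "C' = C * (k\<^sup>2 / a + k^3 / a\<^sup>2)"
  have C': "C * k\<^sup>2 / a \<le> C'" "C * k^3 / a\<^sup>2 \<le> C'"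
    using C(1) k(1) a by (auto simp: C'_def distrib_left)
  have "sphere_profile (\<lambda>z. u1 (A z)) (\<lambda>z. (1 / a) *\<^sub>R g1 (A z)) (\<lambda>z h. (1 / a)\<^sup>2 *\<^sub>R H1 (A z) h) C' m"
  proof
    have C2: "C2_with (\<lambda>z. u1 (A z)) (\<lambda>z. (1 / a) *\<^sub>R g1 (A z)) (\<lambda>z h. (1 / a)\<^sup>2 *\<^sub>R H1 (A z) h)"
      unfolding A_def by (rule C2_with_affine[OF C2_1])
    fix z q h :: complex
    show "((\<lambda>z. u1 (A z)) has_derivative (\<lambda>h. (1 / a) *\<^sub>R g1 (A z) \<bullet> h)) (at z)"
      "((\<lambda>z. (1 / a) *\<^sub>R g1 (A z)) has_derivative (\<lambda>h. (1 / a)\<^sup>2 *\<^sub>R H1 (A z) h)) (at z)"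
      "continuous_on UNIV (\<lambda>z. (1 / a)\<^sup>2 *\<^sub>R H1 (A z) h)"
      using C2_withD(1-3)[OF C2] by blast+
    show "0 < m" "m \<le> u1 (A z)" using m lower by (auto simp: m_def)
    have "norm ((1 / a) *\<^sub>R g1 (A z)) \<le> C * (1 / wt (A z)) / a"
      using divide_right_mono[OF C(2)[of "A z"], of a] a by simp
    also have "\<dots> \<le> C * (k\<^sup>2 / wt z) / a"
      using C(1) a by (intro divide_right_mono mult_left_mono inv2) auto
    also have "\<dots> = (C * k\<^sup>2 / a) / wt z" by simp
    also have "\<dots> \<le> C' / wt z" using C' wt_pos(1)[of z] by (intro divide_right_mono) auto
    finally show "norm ((1 / a) *\<^sub>R g1 (A z)) \<le> C' / wt z" .
    have "norm ((1 / a)\<^sup>2 *\<^sub>R H1 (A z) h) = norm (H1 (A z) h) / a\<^sup>2"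
      by (simp add: power_divide)
    also have "\<dots> \<le> C * norm h * (1 / (wt (A z) * sqrt (wt (A z)))) / a\<^sup>2"
      using divide_right_mono[OF C(3)[of "A z" h], of "a\<^sup>2"] by simp
    also have "\<dots> \<le> C * norm h * (k^3 / (wt z * sqrt (wt z))) / a\<^sup>2"
      using C(1) by (intro divide_right_mono mult_left_mono inv3) auto
    also have "\<dots> = (C * k^3 / a\<^sup>2) * (norm h / (wt z * sqrt (wt z)))" by (simp add: mult_ac)
    also have "\<dots> \<le> C' * (norm h / (wt z * sqrt (wt z)))"
      using C' wt_pos(1)[of z] by (intro mult_right_mono) auto
    finally show "norm ((1 / a)\<^sup>2 *\<^sub>R H1 (A z) h) \<le> C' * norm h / (wt z * sqrt (wt z))" by simp
    have n: "norm (A z - A q) = norm (z - q) / a"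
    proof -
      have "A z - A q = (1 / a) *\<^sub>R (z - q)" by (simp add: A_def scaleR_right_diff_distrib)
      then show ?thesis using a by simp
    qed
    have "chd (A z) (A q) = norm (z - q) / a * (1 / sqrt (wt (A z)) * (1 / sqrt (wt (A q))))"
      unfolding chd_def n by simp
    also have "\<dots> \<le> norm (z - q) / a * (k / sqrt (wt z) * (k / sqrt (wt q)))"
      using a k(1) inv1 sqrt_wt(4) by (intro mult_left_mono mult_mono) (auto simp: less_imp_le)
    also have "\<dots> = k\<^sup>2 / a * chd z q" by (simp add: chd_def power2_eq_square)
    finally have "C * chd (A z) (A q) \<le> C * (k\<^sup>2 / a * chd z q)" using C(1) by (intro mult_left_mono) auto
    also have "\<dots> \<le> C' * chd z q" using mult_right_mono[OF C'(1) chd_bounds(1)[of z q]] by simp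
    finally show "\<bar>u1 (A z) - u1 (A q)\<bar> \<le> C' * chd z q" using C(4)[of "A z" "A q"] by linarith
  qed
  then show ?thesis using that unfolding A_def by blast
qed

lemma integral_affine:
  fixes F :: "complex \<Rightarrow> real"
  assumes a: "a > 0" and F: "integrable lborel (\<lambda>z. F (c + (1 / a) *\<^sub>R z))"
  shows "(\<integral>z. F (c + (1 / a) *\<^sub>R z) \<partial>lborel) = a\<^sup>2 * integral\<^sup>L lborel F"
    and "integrable lborel F"
proof -
  have profile_measurable: "(\<lambda>z. F (c + (1 / a) *\<^sub>R z)) \<in> borel_measurable borel" using F by auto
  have "(\<lambda>y. F (c + (1 / a) *\<^sub>R (a *\<^sub>R (y - c)))) \<in> borel_measurable borel"
    by (rule measurable_compose[OF _ profile_measurable]) measurable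
  then have [measurable]: "F \<in> borel_measurable borel" using a by simp
  have eq: "lborel = density (distr lborel borel (\<lambda>z. c + (1 / a) *\<^sub>R z)) (\<lambda>_. ennreal (1 / a\<^sup>2))"
    using lborel_affine[of "1 / a" c] a by (simp add: power2_eq_square)
  have "integral\<^sup>L lborel F = (\<integral>z. (1 / a\<^sup>2) *\<^sub>R F (c + (1 / a) *\<^sub>R z) \<partial>lborel)"
    by (subst eq, subst integral_density) (auto simp: integral_distr)
  then show "(\<integral>z. F (c + (1 / a) *\<^sub>R z) \<partial>lborel) = a\<^sup>2 * integral\<^sup>L lborel F" using a by simp
  show "integrable lborel F"
    by (subst eq, subst integrable_density) (use F in \<open>auto simp: integrable_distr_eq\<close>)
qed

section \<open>Boost factors\<close>

definition lnq :: "real \<Rightarrow> complex \<Rightarrow> complex \<Rightarrow> real" where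
  "lnq a c z = ln (1 + a\<^sup>2 * (norm (z - c))\<^sup>2)"

text \<open>The map z \<mapsto> a (z - c) pulls the length element 2 |dz| / wt z back to itself
  divided by \<open>rho a c z\<close>. At the same time \<open>rho\<close> is the restriction of the
  linear function t - b.x to the sphere.\<close>

definition rho :: "real \<Rightarrow> complex \<Rightarrow> complex \<Rightarrow> real" where
  "rho a c z = (1 + a\<^sup>2 * (norm (z - c))\<^sup>2) / (a * wt z)"

lemma exp_lnq:
  assumes "a > 0" shows "exp (lnq a c z - lnq 1 0 z - ln a) = rho a c z"
proof -
  have "1 + a\<^sup>2 * (norm (z - c))\<^sup>2 > 0" by (simp add: add_pos_nonneg)
  then show ?thesis using assms wt_pos(1)[of z]
    unfolding lnq_def rho_def exp_diff by simp
qed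

text \<open>Inversion changes the sign of x_3. If \<open>a\<close> stands for t - b_3 and
  \<open>a * c\<close> for b_1 + i b_2, then \<open>b\<close> is t + b_3, and the planar part b_1 +
  i b_2 is unchanged, whence the centre \<open>(a / b) * c\<close>. In particular the boost factor
  is smooth at infinity.\<close>

lemma rho_inversion:
  fixes a :: real and c z :: complex
  assumes a: "a > 0" and z: "z \<noteq> 0"
  defines "b \<equiv> a * (norm c)\<^sup>2 + 1 / a"
  shows "rho a c z = rho b ((a / b) *\<^sub>R c) (1 / cnj z)"
proof -
  have b: "b > 0" using a by (simp add: b_def add_nonneg_pos)
  define v where "v = 1 / cnj z"
  have v: "v \<noteq> 0" "z = 1 / cnj v" using z by (simp_all add: v_def)
  define n where "n = (Re v)\<^sup>2 + (Im v)\<^sup>2"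
  have n: "n > 0" "(norm v)\<^sup>2 = n" using v(1) cmod_power2[of v] unfolding n_def by (metis zero_less_norm_iff zero_less_power, simp)
  have nz: "(norm z)\<^sup>2 = 1 / n" unfolding v(2) by (simp add: norm_divide power_divide n)
  have zc: "(norm (z - c))\<^sup>2 = (1 - 2 * (v \<bullet> c) + n * (norm c)\<^sup>2) / n"
  proof -
    have zv: "z = (1 / n) *\<^sub>R v" unfolding v(2) using v(1) n
      by (simp add: complex_eq_iff divide_complex_def n_def)
    have "(norm (z - c))\<^sup>2 = (norm z)\<^sup>2 - 2 * (z \<bullet> c) + (norm c)\<^sup>2"
      by (simp add: power2_norm_eq_inner inner_diff_left inner_diff_right inner_commute)
    also have "z \<bullet> c = (v \<bullet> c) / n" unfolding zv by simp
    finally show ?thesis unfolding nz using n(1) by (simp add: field_simps)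
  qed
  have "rho a c z = (n + a\<^sup>2 * (1 - 2 * (v \<bullet> c) + n * (norm c)\<^sup>2)) / (a * (1 + n))"
  proof -
    have "(1 + s * (X / n)) / (a * (1 + 1 / n)) = (n + s * X) / (a * (1 + n))" for s X
    proof -
      have "1 + s * (X / n) = (n + s * X) / n" "a * (1 + 1 / n) = a * (1 + n) / n"
        using n(1) by (simp_all add: field_simps)
      then show ?thesis using n(1) by simp
    qed
    then show ?thesis unfolding rho_def zc nz .
  qed
  also have "\<dots> = (n * b - 2 * a * (v \<bullet> c) + a) / (1 + n)"
    unfolding b_def using a n(1) by (simp add: field_simps power2_eq_square)
  also have "\<dots> = (1 + b\<^sup>2 * (norm (v - (a / b) *\<^sub>R c))\<^sup>2) / (b * (1 + n))"
  proof -
    have 1: "(norm (v - (a / b) *\<^sub>R c))\<^sup>2 = n - 2 * (a / b) * (v \<bullet> c) + (a / b)\<^sup>2 * (norm c)\<^sup>2"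
    proof -
      have "(norm (v - s *\<^sub>R c))\<^sup>2 = (norm v)\<^sup>2 - 2 * s * (v \<bullet> c) + s\<^sup>2 * (norm c)\<^sup>2" for s
        unfolding power2_norm_eq_inner inner_diff_left inner_diff_right inner_scaleR_left inner_scaleR_right inner_commute[of c v]
        by (simp add: power2_eq_square algebra_simps)
      then show ?thesis unfolding n .
    qed
    have ab: "a * b = a\<^sup>2 * (norm c)\<^sup>2 + 1" using a by (simp add: b_def power2_eq_square distrib_left)
    have "1 + b\<^sup>2 * (norm (v - (a / b) *\<^sub>R c))\<^sup>2 = 1 + b\<^sup>2 * n - 2 * a * b * (v \<bullet> c) + a\<^sup>2 * (norm c)\<^sup>2"
      unfolding 1 using b by (simp add: power2_eq_square algebra_simps)
    also have "\<dots> = b * (n * b - 2 * a * (v \<bullet> c) + a)" using ab by (simp add: power2_eq_square algebra_simps)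
    finally show ?thesis using b by simp
  qed
  finally show ?thesis unfolding rho_def v_def[symmetric] n .
qed

lemma C2_with_lnq: obtains g H where "C2_with (lnq a c) g H" "\<And>z. lap H z = 4 * a\<^sup>2 / (1 + a\<^sup>2 * (norm (z - c))\<^sup>2)\<^sup>2"
  using C2_with_ln_quadratic[of a c] unfolding lnq_def[abs_def] by blast

lemma lap_add: "lap (\<lambda>z h. H z h + H' z h) z = lap H z + lap H' z"
  and lap_diff: "lap (\<lambda>z h. H z h - H' z h) z = lap H z - lap H' z"
  by (simp_all add: lap_def)

lemma lap_exp:
  "lap (\<lambda>z h. (exp (f z) * (g z \<bullet> h)) *\<^sub>R g z + exp (f z) *\<^sub>R H z h) z = exp (f z) * ((norm (g z))\<^sup>2 + lap H z)"
  unfolding cmod_power2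
  by (simp add: lap_def inner_complex_def power2_eq_square algebra_simps)

context chart_pair
begin

text \<open>\<open>K\<^sub>f * exp (3 * f)\<close> times the area element of the round metric\<close>

definition curv_density :: "complex \<Rightarrow> real" where
  "curv_density z = exp (u1 z) * (4 / (wt z)\<^sup>2 - lap H1 z)"

text \<open>In the coordinate a (z - c) the function w = exp u1 * \<open>rho\<close> has energy
  density equal, up to the Jacobian, to \<open>curv_density\<close> times \<open>rho\<close>, while
  the integral of w^2 is that of exp (2 u1). The boosted inequality is thus \<open>energy_ge\<close>
  for another profile.\<close>

theorem boosted_energy:
  assumes a: "a > 0" and norm: "(\<integral>z. exp (2 * u1 z) / (wt z)\<^sup>2 \<partial>lborel) = pi"
  shows "4 * pi \<le> (\<integral>z. curv_density z * rho a c z \<partial>lborel)"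
    and "integrable lborel (\<lambda>z. curv_density z * rho a c z)"
proof -
  define b d where "b = a * (norm c)\<^sup>2 + 1 / a" and "d = (a / b) *\<^sub>R c"
  have b: "b > 0" using a by (simp add: b_def add_nonneg_pos)
  obtain ga Ha where La: "C2_with (lnq a c) ga Ha" "\<And>z. lap Ha z = 4 * a\<^sup>2 / (1 + a\<^sup>2 * (norm (z - c))\<^sup>2)\<^sup>2"
    using C2_with_lnq by blast
  obtain gb Hb where Lb: "C2_with (lnq b d) gb Hb" using C2_with_lnq by blast
  obtain g0 H0 where L0: "C2_with (lnq 1 0) g0 H0" "\<And>z. lap H0 z = 4 / (wt z)\<^sup>2"
    using C2_with_lnq[of 1 0] by auto
  \<comment> \<open>The logarithm of exp u1 * \<open>rho\<close>, kept as a sum so that its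
    Laplacian is that of \<open>u1\<close> plus the difference of two Liouville terms.\<close>
  define F1 where "F1 z = u1 z + (lnq a c z - lnq 1 0 z) - ln a" for z
  define F2 where "F2 z = u2 z + (lnq b d z - lnq 1 0 z) - ln b" for z
  define G1 where "G1 z = g1 z + (ga z - g0 z)" for z
  define K1 where "K1 z h = H1 z h + (Ha z h - H0 z h)" for z h
  have F1: "C2_with F1 G1 K1"
    unfolding F1_def[abs_def] G1_def[abs_def] K1_def[abs_def]
    by (intro C2_with_diff_const C2_with_add C2_with_diff C2_1 La L0)
  have F2: "C2_with F2 (\<lambda>z. g2 z + (gb z - g0 z)) (\<lambda>z h. H2 z h + (Hb z h - H0 z h))"
    unfolding F2_def[abs_def]
    by (intro C2_with_diff_const C2_with_add C2_with_diff C2_2 Lb L0)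
  have eF1: "exp (F1 z) = exp (u1 z) * rho a c z" for z
    unfolding exp_lnq[OF a, symmetric] exp_add[symmetric] by (simp add: F1_def algebra_simps)
  have eF2: "exp (F2 z) = exp (u2 z) * rho b d z" for z
    unfolding exp_lnq[OF b, symmetric] exp_add[symmetric] by (simp add: F2_def algebra_simps)
  interpret E: chart_pair "\<lambda>z. exp (F1 z)" "\<lambda>z. exp (F2 z)" "\<lambda>z. exp (F1 z) *\<^sub>R G1 z"
    "\<lambda>z. exp (F2 z) *\<^sub>R (g2 z + (gb z - g0 z))"
    "\<lambda>z h. (exp (F1 z) * (G1 z \<bullet> h)) *\<^sub>R G1 z + exp (F1 z) *\<^sub>R K1 z h"
    "\<lambda>z h. (exp (F2 z) * ((g2 z + (gb z - g0 z)) \<bullet> h)) *\<^sub>R (g2 z + (gb z - g0 z)) + exp (F2 z) *\<^sub>R (H2 z h + (Hb z h - H0 z h))"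
  proof
    fix z :: complex assume z: "z \<noteq> 0"
    show "exp (F1 z) = exp (F2 (1 / cnj z))"
      unfolding eF1 eF2 pair[OF z] rho_inversion[OF a z, of c] b_def d_def ..
  qed (intro C2_with_exp F1 F2)+
  define A where "A z = c + (1 / a) *\<^sub>R z" for z
  obtain C m where "sphere_profile (\<lambda>z. exp (F1 (A z))) (\<lambda>z. (1 / a) *\<^sub>R (exp (F1 (A z)) *\<^sub>R G1 (A z)))
    (\<lambda>z h. (1 / a)\<^sup>2 *\<^sub>R ((exp (F1 (A z)) * (G1 (A z) \<bullet> h)) *\<^sub>R G1 (A z) + exp (F1 (A z)) *\<^sub>R K1 (A z) h)) C m"
    unfolding A_def by (rule E.sphere_profile_affine[OF exp_gt_zero exp_gt_zero a, of c])
  then interpret S: sphere_profile "\<lambda>z. exp (F1 (A z))" "\<lambda>z. (1 / a) *\<^sub>R (exp (F1 (A z)) *\<^sub>R G1 (A z))"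
    "\<lambda>z h. (1 / a)\<^sup>2 *\<^sub>R ((exp (F1 (A z)) * (G1 (A z) \<bullet> h)) *\<^sub>R G1 (A z) + exp (F1 (A z)) *\<^sub>R K1 (A z) h)" C m .
  have wtA: "1 + a\<^sup>2 * (norm (A z - c))\<^sup>2 = wt z" for z
    using a by (simp add: A_def power_divide)
  have ed: "S.energy_density z = (1 / a\<^sup>2) * (curv_density (A z) * rho a c (A z))" for z
  proof -
    have n: "(norm ((1 / a) *\<^sub>R (exp (F1 (A z)) *\<^sub>R G1 (A z))))\<^sup>2 / exp (F1 (A z)) = (1 / a\<^sup>2) * (exp (F1 (A z)) * (norm (G1 (A z)))\<^sup>2)"
      using a by (simp add: power_mult_distrib power_divide) (simp add: power2_eq_square)
    have l: "lap (\<lambda>z h. (1 / a)\<^sup>2 *\<^sub>R ((exp (F1 (A z)) * (G1 (A z) \<bullet> h)) *\<^sub>R G1 (A z) + exp (F1 (A z)) *\<^sub>R K1 (A z) h)) z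
        = (1 / a\<^sup>2) * (exp (F1 (A z)) * ((norm (G1 (A z)))\<^sup>2 + lap K1 (A z)))"
      using lap_scale[of "(1 / a)\<^sup>2" "\<lambda>z h. (exp (F1 z) * (G1 z \<bullet> h)) *\<^sub>R G1 z + exp (F1 z) *\<^sub>R K1 z h" A z]
      unfolding lap_exp by (simp add: power_divide)
    \<comment> \<open>After division by a^2 the term in \<open>wt z\<close> cancels the curvature
      term of the new round metric; the other supplies the curvature term of the old one.\<close>
    have k: "lap K1 (A z) = lap H1 (A z) + (4 * a\<^sup>2 / (wt z)\<^sup>2 - 4 / (wt (A z))\<^sup>2)"
      unfolding K1_def[abs_def] lap_add lap_diff La(2) L0(2) wtA ..
    have "S.energy_density z = 4 * exp (F1 (A z)) / (wt z)\<^sup>2 - (1 / a\<^sup>2) * (exp (F1 (A z)) * lap K1 (A z))"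
      unfolding S.energy_density_def n l[unfolded lap_def[of "\<lambda>z h. (1 / a)\<^sup>2 *\<^sub>R ((exp (F1 (A z)) * (G1 (A z) \<bullet> h)) *\<^sub>R G1 (A z) + exp (F1 (A z)) *\<^sub>R K1 (A z) h)"]]
      by (simp add: distrib_left)
    also have "\<dots> = (1 / a\<^sup>2) * (exp (F1 (A z)) * (4 / (wt (A z))\<^sup>2 - lap H1 (A z)))"
      unfolding k using a by (simp add: distrib_left right_diff_distrib)
    finally show ?thesis unfolding eF1 curv_density_def by (simp add: mult_ac)
  qed
  have int1: "integrable lborel (\<lambda>z. curv_density (A z) * rho a c (A z))"
    using integrable_mult_right[OF S.integrable_energy, of "a\<^sup>2"] a unfolding ed[abs_def] by simp
  note I = integral_affine[OF a int1[unfolded A_def]]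
  show "integrable lborel (\<lambda>z. curv_density z * rho a c z)" by (rule I(2))
  have E: "integral\<^sup>L lborel S.energy_density = (\<integral>z. curv_density z * rho a c z \<partial>lborel)"
    unfolding ed[abs_def] integral_mult_right_zero using I(1) a unfolding A_def by simp
  \<comment> \<open>The square of \<open>rho\<close> is the ratio between the two round area
    densities, so the normalisation is invariant under the boost.\<close>
  have q: "(exp (F1 (A z)))\<^sup>2 / (wt z)\<^sup>2 = (1 / a\<^sup>2) * (exp (2 * u1 (A z)) / (wt (A z))\<^sup>2)" for z
  proof -
    have r: "rho a c (A z) = wt z / (a * wt (A z))" unfolding rho_def wtA ..
    have "(exp (F1 (A z)))\<^sup>2 / (wt z)\<^sup>2 = (exp (u1 (A z)))\<^sup>2 * ((wt z)\<^sup>2 / (a\<^sup>2 * (wt (A z))\<^sup>2)) / (wt z)\<^sup>2"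
      unfolding eF1 r power_mult_distrib power_divide ..
    also have "\<dots> = (1 / a\<^sup>2) * ((exp (u1 (A z)))\<^sup>2 / (wt (A z))\<^sup>2)"
    proof -
      have "X * (W / (Y * Z)) / W = 1 / Y * (X / Z)" if "W \<noteq> 0" for X W Y Z :: real
        using that by simp
      then show ?thesis using wt_pos(1)[of z] by simp
    qed
    also have "(exp (u1 (A z)))\<^sup>2 = exp (2 * u1 (A z))" by (simp flip: exp_double)
    finally show ?thesis .
  qed
  have int2: "integrable lborel (\<lambda>z. exp (2 * u1 (A z)) / (wt (A z))\<^sup>2)"
    using integrable_mult_right[OF S.integrable_w(3), of "a\<^sup>2"] a unfolding q by simp
  have "S.Q = pi"
    unfolding S.Q_def q integral_mult_right_zero
    using integral_affine(1)[OF a int2[unfolded A_def]] norm a unfolding A_def by simp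
  then show "4 * pi \<le> (\<integral>z. curv_density z * rho a c z \<partial>lborel)"
    using S.energy_ge unfolding E by simp
qed

end

text \<open>On the unit hyperboloid a future timelike vector P attains its Minkowski length at its
  own direction. A vector that is not timelike is excluded by evaluating along an almost null
  direction.\<close>

lemma reversed_Cauchy_Schwarz_converse:
  fixes k P0 P1 P2 P3 :: real
  assumes k: "k > 0"
    and le: "\<And>t b1 b2 b3. t > 0 \<Longrightarrow> t\<^sup>2 = 1 + b1\<^sup>2 + b2\<^sup>2 + b3\<^sup>2 \<Longrightarrow> k \<le> t * P0 - b1 * P1 - b2 * P2 - b3 * P3"
  shows "k\<^sup>2 \<le> P0\<^sup>2 - (P1\<^sup>2 + P2\<^sup>2 + P3\<^sup>2)"
proof -
  define p where "p = sqrt (P1\<^sup>2 + P2\<^sup>2 + P3\<^sup>2)"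
  have p: "p \<ge> 0" "p\<^sup>2 = P1\<^sup>2 + P2\<^sup>2 + P3\<^sup>2" by (simp_all add: p_def)
  have P0: "k \<le> P0" using le[of 1 0 0 0] by simp
  have "p < P0"
  proof (rule ccontr)
    assume "\<not> p < P0"
    then have pP: "P0 \<le> p" "p > 0" using P0 k by auto
    \<comment> \<open>\<open>t\<close> and \<open>s\<close> are the hyperbolic cosine and sine of -
      ln e, so t - s = e. The choice of \<open>e\<close> makes (t - s) * p equal to k / 2, which is
      less than k.\<close>
    define e where "e = k / (2 * p)"
    define t s where "t = (1 / e + e) / 2" and "s = (1 / e - e) / 2"
    have e: "e > 0" using k pP by (simp add: e_def)
    have t: "t > 0" using e by (simp add: t_def add_pos_pos)
    have "t\<^sup>2 - s\<^sup>2 = 1"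
    proof -
      have "t\<^sup>2 - s\<^sup>2 = (t + s) * (t - s)" by (simp add: power2_eq_square algebra_simps)
      also have "\<dots> = 1 / e * e"
        by (rule arg_cong2[of _ _ _ _ "(*)"]) (simp_all add: t_def s_def field_simps)
      finally show ?thesis using e by simp
    qed
    moreover have "(s * P1 / p)\<^sup>2 + (s * P2 / p)\<^sup>2 + (s * P3 / p)\<^sup>2 = s\<^sup>2"
    proof -
      have "(s * P1 / p)\<^sup>2 + (s * P2 / p)\<^sup>2 + (s * P3 / p)\<^sup>2 = s\<^sup>2 * (P1\<^sup>2 + P2\<^sup>2 + P3\<^sup>2) / p\<^sup>2"
        by (simp add: power_mult_distrib power_divide add_divide_distrib distrib_left)
      then show ?thesis unfolding p(2)[symmetric] using pP by simp
    qed
    ultimately have "k \<le> t * P0 - (s * P1 / p) * P1 - (s * P2 / p) * P2 - (s * P3 / p) * P3"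
      by (intro le[OF t]) linarith
    also have "\<dots> = t * P0 - s * (P1\<^sup>2 + P2\<^sup>2 + P3\<^sup>2) / p"
      by (simp add: power2_eq_square add_divide_distrib distrib_left)
    also have "\<dots> = t * P0 - s * p" unfolding p(2)[symmetric] using pP by (simp add: power2_eq_square)
    also have "\<dots> \<le> t * p - s * p" using t pP by (simp add: mult_left_mono)
    also have "\<dots> = (t - s) * p" by (simp add: left_diff_distrib)
    also have "t - s = e" by (simp add: t_def s_def field_simps)
    also have "e * p = k / 2" using pP by (simp add: e_def)
    finally show False using k by simp
  qed
  then have lt: "p\<^sup>2 < P0\<^sup>2" using p(1) by (intro power_strict_mono) auto
  \<comment> \<open>The Minkowski length of P; testing with P / N gives exactly N.\<close>
  define N where "N = sqrt (P0\<^sup>2 - p\<^sup>2)"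
  have N: "N > 0" "N\<^sup>2 = P0\<^sup>2 - p\<^sup>2" using lt by (simp_all add: N_def)
  have "(P0 / N)\<^sup>2 = 1 + (P1 / N)\<^sup>2 + (P2 / N)\<^sup>2 + (P3 / N)\<^sup>2"
  proof -
    have "1 + (P1 / N)\<^sup>2 + (P2 / N)\<^sup>2 + (P3 / N)\<^sup>2 = (N\<^sup>2 + p\<^sup>2) / N\<^sup>2"
      using N(1) unfolding p(2) by (simp add: power_divide add_divide_distrib)
    then show ?thesis unfolding N(2) by (simp add: power_divide N(2))
  qed
  then have "k \<le> P0 / N * P0 - P1 / N * P1 - P2 / N * P2 - P3 / N * P3"
    using N P0 k by (intro le) auto
  also have "\<dots> = (P0\<^sup>2 - p\<^sup>2) / N" unfolding p(2)
    by (simp add: power2_eq_square diff_divide_distrib add_divide_distrib)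
  also have "\<dots> = N" unfolding N(2)[symmetric] using N(1) by (simp add: power2_eq_square)
  finally have "k\<^sup>2 \<le> N\<^sup>2" using k by (intro power_mono) auto
  then show ?thesis unfolding N(2) p(2) .
qed

section \<open>Coordinate functions in the plane and the Lorentz inequality\<close>

definition X1 :: "complex \<Rightarrow> real" where "X1 z = 2 * Re z / wt z"
definition X2 :: "complex \<Rightarrow> real" where "X2 z = 2 * Im z / wt z"
definition X3 :: "complex \<Rightarrow> real" where "X3 z = ((norm z)\<^sup>2 - 1) / wt z"

lemma X_bounds: "\<bar>X1 z\<bar> \<le> 1" "\<bar>X2 z\<bar> \<le> 1" "\<bar>X3 z\<bar> \<le> 1"
proof -
  have "2 * \<bar>x\<bar> \<le> wt z" if "\<bar>x\<bar> \<le> norm z" for x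
  proof -
    have "0 \<le> (norm z - 1)\<^sup>2" by simp
    then have "2 * norm z \<le> wt z" by (simp add: power2_diff)
    then show ?thesis using that by linarith
  qed
  then have "2 * \<bar>Re z\<bar> \<le> wt z" "2 * \<bar>Im z\<bar> \<le> wt z" using abs_Re_le_cmod abs_Im_le_cmod by blast+
  moreover have "\<bar>(norm z)\<^sup>2 - 1\<bar> \<le> wt z" using zero_le_power2[of "norm z"] by linarith
  ultimately show "\<bar>X1 z\<bar> \<le> 1" "\<bar>X2 z\<bar> \<le> 1" "\<bar>X3 z\<bar> \<le> 1"
    unfolding X1_def X2_def X3_def abs_divide abs_of_pos[OF wt_pos(1)]
    using wt_pos(1)[of z] by (auto simp: divide_le_eq)
qed

lemma X_measurable: "X1 \<in> borel_measurable borel" "X2 \<in> borel_measurable borel" "X3 \<in> borel_measurable borel"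
proof -
  have nz: "1 + (norm z)\<^sup>2 \<noteq> 0" for z :: complex using wt_pos(1)[of z] by linarith
  show "X1 \<in> borel_measurable borel" "X2 \<in> borel_measurable borel" "X3 \<in> borel_measurable borel"
    unfolding X1_def[abs_def] X2_def[abs_def] X3_def[abs_def]
    by (intro borel_measurable_continuous_onI continuous_intros nz; simp add: nz)+
qed

text \<open>Expanding the quadratic leaves the constant 1 + b_1^2 + b_2^2, and the hyperboloid
  equation turns it into (t - b_3) (t + b_3). The factor t - b_3 then cancels.\<close>

lemma rho_eq_boost:
  assumes a: "t - b3 > 0" and hyp: "t\<^sup>2 = 1 + b1\<^sup>2 + b2\<^sup>2 + b3\<^sup>2"
  shows "rho (t - b3) ((1 / (t - b3)) *\<^sub>R Complex b1 b2) z = t - b1 * X1 z - b2 * X2 z - b3 * X3 z"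
proof -
  define a where "a = t - b3"
  define n where "n = (norm z)\<^sup>2"
  have a: "a > 0" using assms by (simp add: a_def)
  have n: "n \<ge> 0" "n = (Re z)\<^sup>2 + (Im z)\<^sup>2" by (simp_all add: n_def cmod_power2)
  have "a\<^sup>2 * (norm (z - (1 / a) *\<^sub>R Complex b1 b2))\<^sup>2 = (norm (a *\<^sub>R (z - (1 / a) *\<^sub>R Complex b1 b2)))\<^sup>2"
    by (simp add: power_mult_distrib)
  also have "a *\<^sub>R (z - (1 / a) *\<^sub>R Complex b1 b2) = a *\<^sub>R z - Complex b1 b2"
    using a by (simp add: scaleR_right_diff_distrib)
  also have "(norm (a *\<^sub>R z - Complex b1 b2))\<^sup>2 = a\<^sup>2 * n - 2 * a * (b1 * Re z + b2 * Im z) + b1\<^sup>2 + b2\<^sup>2"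
    unfolding cmod_power2 n(2) by (simp add: power2_eq_square algebra_simps)
  finally have E: "a\<^sup>2 * (norm (z - (1 / a) *\<^sub>R Complex b1 b2))\<^sup>2 = a\<^sup>2 * n - 2 * a * (b1 * Re z + b2 * Im z) + b1\<^sup>2 + b2\<^sup>2" .
  have "a * (t + b3) = 1 + b1\<^sup>2 + b2\<^sup>2"
    using hyp by (simp add: a_def power2_eq_square algebra_simps)
  then have "1 + (a\<^sup>2 * n - 2 * a * x + b1\<^sup>2 + b2\<^sup>2) = a * (a * n - 2 * x + (t + b3))" for x
    by (simp add: power2_eq_square algebra_simps)
  from this[of "b1 * Re z + b2 * Im z"]
  have "1 + a\<^sup>2 * (norm (z - (1 / a) *\<^sub>R Complex b1 b2))\<^sup>2
      = a * (a * n - 2 * (b1 * Re z + b2 * Im z) + (t + b3))"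
    unfolding E .
  then have "rho a ((1 / a) *\<^sub>R Complex b1 b2) z = (a * n - 2 * (b1 * Re z + b2 * Im z) + (t + b3)) / wt z"
    using a unfolding rho_def by simp
  also have "\<dots> = (t * wt z - b1 * (2 * Re z) - b2 * (2 * Im z) - b3 * ((norm z)\<^sup>2 - 1)) / wt z"
    by (simp add: a_def n_def algebra_simps)
  also have "\<dots> = t - b1 * X1 z - b2 * X2 z - b3 * X3 z"
  proof -
    have "(t * W - b1 * A - b2 * B - b3 * D) / W = t - b1 * (A / W) - b2 * (B / W) - b3 * (D / W)" if "W > 0" for W A B D
      using that by (simp add: diff_divide_distrib)
    then show ?thesis unfolding X1_def X2_def X3_def by (simp only: wt_pos)
  qed
  finally show ?thesis unfolding a_def .
qed

theorem (in chart_pair) lorentz_inequality: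
  assumes "(\<integral>z. exp (2 * u1 z) / (wt z)\<^sup>2 \<partial>lborel) = pi"
  shows "(4 * pi)\<^sup>2 \<le> (integral\<^sup>L lborel curv_density)\<^sup>2 - ((\<integral>z. curv_density z * X1 z \<partial>lborel)\<^sup>2
    + (\<integral>z. curv_density z * X2 z \<partial>lborel)\<^sup>2 + (\<integral>z. curv_density z * X3 z \<partial>lborel)\<^sup>2)"
proof (rule reversed_Cauchy_Schwarz_converse)
  \<comment> \<open>The trivial boost, which yields integrability of \<open>curv_density\<close>
    itself.\<close>
  have rho1: "rho 1 0 z = 1" for z using wt_pos(1)[of z] by (simp add: rho_def)
  have int: "integrable lborel curv_density"
    using boosted_energy(2)[OF _ assms, of 1 0] unfolding rho1 by simp
  have intX: "integrable lborel (\<lambda>z. curv_density z * X z)" if "X \<in> borel_measurable borel" "\<And>z. \<bar>X z\<bar> \<le> 1" for X :: "complex \<Rightarrow> real"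
  proof (rule Bochner_Integration.integrable_bound[OF int])
    show "(\<lambda>z. curv_density z * X z) \<in> borel_measurable lborel" using int that(1) by auto
    show "AE z in lborel. norm (curv_density z * X z) \<le> norm (curv_density z)"
      using that(2) by (intro AE_I2) (simp add: abs_mult mult_left_le)
  qed
  note I = intX[OF X_measurable(1) X_bounds(1)] intX[OF X_measurable(2) X_bounds(2)] intX[OF X_measurable(3) X_bounds(3)]
  fix t b1 b2 b3 :: real
  assume t: "t > 0" and hyp: "t\<^sup>2 = 1 + b1\<^sup>2 + b2\<^sup>2 + b3\<^sup>2"
  have "b3\<^sup>2 < t\<^sup>2"
    using hyp zero_le_power2[of b1] zero_le_power2[of b2] by linarith
  then have "b3 < t" using t by (rule power2_less_imp_less[OF _ less_imp_le])
  then have a: "t - b3 > 0" by simp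
  have "4 * pi \<le> (\<integral>z. curv_density z * rho (t - b3) ((1 / (t - b3)) *\<^sub>R Complex b1 b2) z \<partial>lborel)"
    by (rule boosted_energy(1)[OF a assms])
  also have "\<dots> = (\<integral>z. t * curv_density z - b1 * (curv_density z * X1 z) - b2 * (curv_density z * X2 z) - b3 * (curv_density z * X3 z) \<partial>lborel)"
    unfolding rho_eq_boost[OF a hyp] by (simp add: algebra_simps)
  also have "\<dots> = t * integral\<^sup>L lborel curv_density - b1 * (\<integral>z. curv_density z * X1 z \<partial>lborel)
      - b2 * (\<integral>z. curv_density z * X2 z \<partial>lborel) - b3 * (\<integral>z. curv_density z * X3 z \<partial>lborel)"
    using int I by simp
  finally show "4 * pi \<le> \<dots>" .
qed simp

section \<open>Stereographic charts\<close>

definition vc :: "complex \<Rightarrow> real^2" where "vc z = vector [Re z, Im z]"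
definition cv :: "real^2 \<Rightarrow> complex" where "cv y = Complex (y $ 1) (y $ 2)"

lemma vc_cv [simp]: "vc (cv y) = y" "cv (vc z) = z"
  by (simp_all add: vc_def cv_def vec_eq_iff forall_2 complex_eq_iff)

lemma vc_nth [simp]: "vc z $ 1 = Re z" "vc z $ 2 = Im z"
  by (simp_all add: vc_def)

lemma vc_inner: "vc z \<bullet> vc w = z \<bullet> w"
  by (simp add: inner_vec_def sum_2 inner_complex_def)

lemma norm_vc [simp]: "norm (vc z) = norm z"
  by (simp add: norm_eq_sqrt_inner vc_inner)

lemma norm_cv [simp]: "norm (cv y) = norm y"
  by (metis norm_vc vc_cv(1))

lemma linear_vc: "linear vc" and linear_cv: "linear cv"
  by (auto intro!: linearI simp: vec_eq_iff forall_2 cv_def complex_eq_iff)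

lemma bounded_linear_vc: "bounded_linear vc" and bounded_linear_cv: "bounded_linear cv"
  using linear_vc linear_cv by (auto simp: linear_conv_bounded_linear)

lemma cv_axis: "cv (axis 1 1) = 1" "cv (axis 2 1) = \<i>"
  by (simp_all add: cv_def axis_def complex_eq_iff)

lemma vc_eq_axis: "vc h = Re h *\<^sub>R axis 1 1 + Im h *\<^sub>R axis 2 1"
  by (simp add: vec_eq_iff forall_2 axis_def)

lemma vc_measurable: "vc \<in> borel_measurable borel"
  using bounded_linear_vc by (intro borel_measurable_continuous_onI linear_continuous_on)

lemma lborel_real2_eq: "(lborel :: (real^2) measure) = distr lborel borel vc"
proof (rule lborel_eqI)
  fix l u :: "real^2"
  assume le: "\<And>b. b \<in> Basis \<Longrightarrow> l \<bullet> b \<le> u \<bullet> b"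
  have B: "(Basis :: (real^2) set) = {axis 1 1, axis 2 1}"
    by (auto simp: Basis_vec_def UNIV_2)
  have ne: "axis 1 1 \<noteq> (axis 2 1 :: real^2)" by (simp add: axis_eq_axis)
  have "vc -` box l u = box (cv l) (cv u)"
    by (auto simp: box_def Basis_complex_def B inner_axis inner_complex_def cv_def)
  then show "emeasure (distr lborel borel vc) (box l u) = ennreal (prod ((\<bullet>) (u - l)) Basis)"
    using le[of "axis 1 1"] le[of "axis 2 1"] vc_measurable ne
    by (simp add: emeasure_distr emeasure_lborel_box_eq B Basis_complex_def inner_axis cv_def)
qed simp

text \<open>Holds without an integrability assumption: \<open>vc\<close> is a bimeasurable
  bijection, so for nonmeasurable \<open>F\<close> both integrals take the default value 0.\<close>

lemma integral_real2:
  fixes F :: "real^2 \<Rightarrow> real"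
  shows "integral\<^sup>L lborel F = (\<integral>z. F (vc z) \<partial>lborel)"
proof (cases "F \<in> borel_measurable borel")
  case True
  then show ?thesis
    by (subst lborel_real2_eq, subst integral_distr) (use vc_measurable in auto)
next
  case False
  have "\<not> (\<lambda>z. F (vc z)) \<in> borel_measurable borel"
  proof
    assume "(\<lambda>z. F (vc z)) \<in> borel_measurable borel"
    moreover have "cv \<in> borel_measurable borel"
      using bounded_linear_cv by (intro borel_measurable_continuous_onI linear_continuous_on)
    ultimately have "(\<lambda>y. F (vc (cv y))) \<in> borel_measurable borel"
      by (rule measurable_compose[rotated])
    then show False using False by simp
  qed
  then have "\<not> integrable lborel F" "\<not> integrable lborel (\<lambda>z. F (vc z))" using False by auto
  then show ?thesis by (simp add: not_integrable_integral_eq)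
qed

section \<open>Inverse stereographic projection\<close>

definition embed3 :: "real^2 \<Rightarrow> real^3" where "embed3 y = vector [y $ 1, y $ 2, 0]"

text \<open>The height (|y|^2 - 1) / (|y|^2 + 1) is written as 1 - 2 / (1 + |y|^2), so that both
  summands involve the same scalar function and share its derivative.\<close>

definition sphere_param :: "real \<Rightarrow> real^2 \<Rightarrow> real^3" where
  "sphere_param s y = (2 / (1 + (norm y)\<^sup>2)) *\<^sub>R embed3 y + (s * (1 - 2 / (1 + (norm y)\<^sup>2))) *\<^sub>R axis 3 1"

lemma embed3_nth [simp]: "embed3 y $ 1 = y $ 1" "embed3 y $ 2 = y $ 2" "embed3 y $ 3 = 0"
  by (simp_all add: embed3_def)

lemma axis3_nth [simp]: "(axis 3 1 :: real^3) $ 1 = 0" "(axis 3 1 :: real^3) $ 2 = 0" "(axis 3 1 :: real^3) $ 3 = 1"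
  by (simp_all add: axis_def)

lemma norm_real2_sq: "(norm (y :: real^2))\<^sup>2 = (y $ 1)\<^sup>2 + (y $ 2)\<^sup>2"
  unfolding power2_norm_eq_inner by (simp add: inner_vec_def sum_2 power2_eq_square)

lemma norm_real3_sq: "(norm (y :: real^3))\<^sup>2 = (y $ 1)\<^sup>2 + (y $ 2)\<^sup>2 + (y $ 3)\<^sup>2"
  unfolding power2_norm_eq_inner by (simp add: inner_vec_def sum_3 power2_eq_square)

text \<open>The equation \<open>s * s = 1\<close> treats the projections from both poles at
  once.\<close>

context
  fixes s :: real
  assumes s: "s * s = 1"
begin

lemma sphere_param_in: "sphere_param s y \<in> fst (stereo_chart s)" and stereo_sphere_param: "snd (stereo_chart s) (sphere_param s y) = y"
proof -
  define n where "n = 1 + (norm y)\<^sup>2"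
  have n: "n > 0" by (simp add: n_def add_pos_nonneg)
  have y: "(y $ 1)\<^sup>2 + (y $ 2)\<^sup>2 = n - 1" by (simp add: n_def norm_real2_sq)
  have c: "sphere_param s y $ 1 = 2 / n * y $ 1" "sphere_param s y $ 2 = 2 / n * y $ 2" "sphere_param s y $ 3 = s * (1 - 2 / n)"
    by (simp_all add: sphere_param_def n_def)
  have "(norm (sphere_param s y))\<^sup>2 = (2 / n)\<^sup>2 * ((y $ 1)\<^sup>2 + (y $ 2)\<^sup>2) + (s * s) * (1 - 2 / n)\<^sup>2"
    unfolding norm_real3_sq c by (simp add: power_mult_distrib distrib_left power2_eq_square)
  also have "\<dots> = 1" unfolding y s using n by (simp add: field_simps power2_eq_square)
  finally have "norm (sphere_param s y) = 1" by (simp add: power2_eq_1_iff) (metis norm_ge_zero not_one_le_zero le_minus_one_simps(3))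
  moreover have k: "1 - s * sphere_param s y $ 3 = 2 / n"
    unfolding c mult.assoc[symmetric] s by simp
  then have "sphere_param s y \<noteq> vector [0, 0, s]" using s n by auto
  ultimately show "sphere_param s y \<in> fst (stereo_chart s)" by (simp add: stereo_chart_def)
  show "snd (stereo_chart s) (sphere_param s y) = y"
    using n by (simp add: stereo_chart_def vec_eq_iff forall_2 k) (simp add: c)
qed

lemma sphere_param_stereo:
  assumes "p \<in> fst (stereo_chart s)" shows "sphere_param s (snd (stereo_chart s) p) = p"
proof -
  define u where "u = 1 - s * p $ 3"
  have p: "(p $ 1)\<^sup>2 + (p $ 2)\<^sup>2 + (p $ 3)\<^sup>2 = 1" "p \<noteq> vector [0, 0, s]"
    using assms norm_real3_sq[of p] by (auto simp: stereo_chart_def)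
  have sp: "s * p $ 3 = 1 - u" by (simp add: u_def)
  have p3: "p $ 3 = s * (1 - u)"
  proof -
    have "p $ 3 = (s * s) * p $ 3" using s by simp
    then show ?thesis by (simp only: mult.assoc sp)
  qed
  \<comment> \<open>The pole is the only point of the sphere whose third coordinate is
    \<open>s\<close>.\<close>
  have u: "u \<noteq> 0"
  proof
    assume "u = 0"
    then have "p $ 3 = s" using p3 by simp
    moreover have "s\<^sup>2 = 1" using s by (simp add: power2_eq_square)
    ultimately have "(p $ 1)\<^sup>2 + (p $ 2)\<^sup>2 = 0" using p(1) by simp
    then have "p $ 1 = 0" "p $ 2 = 0" by (simp_all add: sum_power2_eq_zero_iff)
    then show False using p(2) \<open>p $ 3 = s\<close> by (simp add: vec_eq_iff forall_3)
  qed
  define y where "y = snd (stereo_chart s) p"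
  have y: "y $ 1 = p $ 1 / u" "y $ 2 = p $ 2 / u" by (simp_all add: y_def stereo_chart_def u_def)
  have n: "1 + (norm y)\<^sup>2 = 2 / u"
  proof -
    have "(p $ 3)\<^sup>2 = (1 - u)\<^sup>2" unfolding p3 using s by (simp add: power_mult_distrib power2_eq_square)
    then have "(p $ 1)\<^sup>2 + (p $ 2)\<^sup>2 = 2 * u - u\<^sup>2" using p(1) by (simp add: power2_diff)
    then have "(norm y)\<^sup>2 = (2 * u - u\<^sup>2) / u\<^sup>2"
      unfolding norm_real2_sq y power_divide by (simp add: add_divide_distrib[symmetric])
    also have "\<dots> = 2 / u - 1" using u by (simp add: power2_eq_square diff_divide_distrib)
    finally show ?thesis by simp
  qed
  show ?thesis unfolding y_def[symmetric] sphere_param_def n using u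
    by (simp add: vec_eq_iff forall_3 y p3 right_diff_distrib)
qed

lemma cimage_stereo: "cimage (stereo_chart s) = UNIV"
proof -
  have "y \<in> snd (stereo_chart s) ` fst (stereo_chart s)" for y
    using imageI[OF sphere_param_in[of y], of "snd (stereo_chart s)"] unfolding stereo_sphere_param .
  then show ?thesis unfolding cimage_def by blast
qed

lemma cinv_stereo: "cinv (stereo_chart s) = sphere_param s"
proof
  fix y
  have "inj_on (snd (stereo_chart s)) (fst (stereo_chart s))"
    by (metis inj_onI sphere_param_stereo)
  then show "cinv (stereo_chart s) y = sphere_param s y"
    unfolding cinv_def using inv_into_f_f[OF _ sphere_param_in] stereo_sphere_param by metis
qed

end

section \<open>Curvature of conformal metrics\<close>

lemma matrix_inv_scaled_id:
  assumes "e \<noteq> 0" shows "matrix_inv (e *\<^sub>R (mat 1 :: real^2^2)) = (1 / e) *\<^sub>R mat 1"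
proof -
  have mult: "(e *\<^sub>R (mat 1 :: real^2^2)) ** B = e *\<^sub>R B" for B :: "real^2^2" and e
    by (simp add: vec_eq_iff matrix_matrix_mult_def mat_def forall_2 sum_2)
  have "\<exists>B. (e *\<^sub>R (mat 1 :: real^2^2)) ** B = mat 1 \<and> B ** (e *\<^sub>R mat 1) = mat 1"
    by (rule exI[of _ "(1 / e) *\<^sub>R mat 1"]) (use assms in \<open>simp add: mult\<close>)
  then have "(e *\<^sub>R (mat 1 :: real^2^2)) ** matrix_inv (e *\<^sub>R mat 1) = mat 1"
    unfolding matrix_inv_def by (rule someI2_ex) blast
  then have "e *\<^sub>R matrix_inv (e *\<^sub>R (mat 1 :: real^2^2)) = mat 1" unfolding mult .
  then have "(1 / e) *\<^sub>R (e *\<^sub>R matrix_inv (e *\<^sub>R (mat 1 :: real^2^2))) = (1 / e) *\<^sub>R mat 1" by simp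
  then show ?thesis using assms by simp
qed

lemma partial_deriv_eq:
  assumes "(F has_derivative F') (at y)"
  shows "partial_deriv UNIV i F y = F' (axis i 1)"
  unfolding partial_deriv_def using frechet_derivative_at[OF assms] by simp

lemma has_derivative_cv: "(cv has_derivative cv) (at y)"
  by (rule bounded_linear.has_derivative[OF bounded_linear_cv has_derivative_ident, simplified])

text \<open>The background is the flat metric, which contributes no curvature; the stereographic
  factor of the round metric is meant to be absorbed into \<Phi>.\<close>

theorem gauss_curv_conformal:
  assumes C2: "C2_with \<Phi> g H"
  shows "gauss_curv UNIV (\<lambda>y. exp (2 * \<Phi> (cv y)) *\<^sub>R mat 1) y = - lap H (cv y) / exp (2 * \<Phi> (cv y))"
proof -
  define E where "E y = exp (2 * \<Phi> (cv y))" for y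
  define G where "G y = E y *\<^sub>R (mat 1 :: real^2^2)" for y
  define p where "p i y = g (cv y) \<bullet> cv (axis i 1)" for i :: 2 and y
  note D = C2_withD[OF C2]
  have E: "E y \<noteq> 0" for y by (simp add: E_def)
  have dE: "((\<lambda>y. E y * c) has_derivative (\<lambda>h. E y * (2 * (g (cv y) \<bullet> cv h)) * c)) (at y)" for y c
  proof -
    have "((\<lambda>y. 2 * \<Phi> (cv y)) has_derivative (\<lambda>h. 2 * (g (cv y) \<bullet> cv h))) (at y)"
      by (intro has_derivative_mult_right has_derivative_compose[OF has_derivative_cv D(1)])
    from has_derivative_mult_left[OF has_derivative_exp[OF this], of c]
    show ?thesis unfolding E_def by (simp add: mult_ac)
  qed
  have Gnth: "G y $ j $ l = E y * (if j = l then 1 else 0)" for y j l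
    by (simp add: G_def mat_def)
  have dG: "partial_deriv UNIV i (\<lambda>z. G z $ j $ l) y = E y * (2 * p i y) * (if j = l then 1 else 0)" for i j l y
    unfolding Gnth p_def by (rule partial_deriv_eq[OF dE])
  have inv: "matrix_inv (G y) $ k $ l = 1 / E y * (if k = l then 1 else 0)" for k l y
    unfolding G_def matrix_inv_scaled_id[OF E] by (simp add: mat_def)
  \<comment> \<open>The usual symbols of a conformally flat metric, with \<open>p i\<close> the i-th
    partial derivative of \<Phi>. The metric is diagonal, so only the summand l = k
    survives.\<close>
  have chr: "christoffel UNIV G k i j y = (if j = k then p i y else 0) + (if i = k then p j y else 0) - (if i = j then p k y else 0)" for k i j y
    unfolding christoffel_def dG inv
    using E[of y] exhaust_2[of k] exhaust_2[of i] exhaust_2[of j]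
    by (auto simp: sum_2)
  have p12: "p 1 y = Re (g (cv y))" "p 2 y = Im (g (cv y))" for y
    by (simp_all add: p_def cv_axis inner_complex_def)
  have dg: "((\<lambda>y. g (cv y)) has_derivative (\<lambda>h. H (cv y) (cv h))) (at y)"
    by (rule has_derivative_compose[OF has_derivative_cv D(2)])
  have c22: "christoffel UNIV G 1 2 2 = (\<lambda>y. - Re (g (cv y)))" and c12: "christoffel UNIV G 1 1 2 = (\<lambda>y. Im (g (cv y)))"
    by (simp_all add: fun_eq_iff chr p12)
  have d1: "partial_deriv UNIV 1 (christoffel UNIV G 1 2 2) y = - Re (H (cv y) 1)"
    unfolding c22 by (subst partial_deriv_eq[OF has_derivative_minus[OF has_derivative_Re[OF dg]]]) (simp add: cv_axis)
  have d2: "partial_deriv UNIV 2 (christoffel UNIV G 1 1 2) y = Im (H (cv y) \<i>)"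
    unfolding c12 by (subst partial_deriv_eq[OF has_derivative_Im[OF dg]]) (simp add: cv_axis)
  \<comment> \<open>The quadratic terms in the Christoffel symbols cancel in dimension two, leaving
    only the two derivatives.\<close>
  have "riemann UNIV G 1 2 1 2 y = - lap H (cv y)"
    unfolding riemann_def d1 d2 by (simp add: chr sum_2 lap_def)
  then have "(\<Sum>l\<in>UNIV. G y $ 1 $ l * riemann UNIV G l 2 1 2 y) = E y * (- lap H (cv y))"
    by (simp add: sum_2 Gnth)
  moreover have "det (G y) = E y * E y"
    by (simp add: det_2 Gnth)
  ultimately have "gauss_curv UNIV G y = - lap H (cv y) / E y"
    unfolding gauss_curv_def using E[of y] by simp
  then show ?thesis unfolding G_def[abs_def] E_def .
qed

section \<open>Smooth functions and the round metric in charts\<close>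

text \<open>\<open>smooth_on\<close> supplies only local extensions, each with derivatives taken
  within its own neighbourhood. Since these are open, the derivatives are the ordinary ones and give
  global partial derivatives up to order two.\<close>

lemma smooth_on_UNIV_C2:
  fixes F :: "real^2 \<Rightarrow> real"
  assumes "smooth_on UNIV F"
  obtains g H where "C2_with (\<lambda>z. F (vc z)) g H"
proof -
  define P where "P i = partial_deriv UNIV i F" for i :: 2
  define R where "R i j = partial_deriv UNIV j (P i)" for i j :: 2
  have loc: "F differentiable (at x) \<and> (\<forall>i. P i differentiable (at x)) \<and> (\<forall>i j. isCont (R i j) x)" for x
  proof -
    obtain V G where V: "open V" "x \<in> V" "\<forall>k. Ck_on k V G" "\<forall>y\<in>UNIV \<inter> V. G y = F y"
      using assms unfolding smooth_on_def by blast
    have at: "at y within V = at y" if "y \<in> V" for y using that V(1) by (rule at_within_open)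
    have "Ck_on (Suc (Suc 0)) V G" using V(3) by blast
    then have G: "\<And>y. y \<in> V \<Longrightarrow> G differentiable (at y)"
      "\<And>i y. y \<in> V \<Longrightarrow> partial_deriv V i G differentiable (at y)"
      "\<And>i j. continuous_on V (partial_deriv V j (partial_deriv V i G))"
      using at by (auto simp: differentiable_on_def)
    \<comment> \<open>Used at two levels: for \<open>F\<close> against its local extension, and for
      the first partial derivatives of both.\<close>
    have tr: "A differentiable (at y) \<and> partial_deriv UNIV i A y = partial_deriv V i B y"
      if B: "B differentiable (at y)" and y: "y \<in> V" and eq: "\<And>y. y \<in> V \<Longrightarrow> B y = A y" for A B :: "real^2 \<Rightarrow> real" and y i
    proof -
      have B': "(B has_derivative frechet_derivative B (at y)) (at y)" using B by (simp only: frechet_derivative_works[symmetric])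
      have A': "(A has_derivative frechet_derivative B (at y)) (at y)"
        by (rule has_derivative_transform_within_open[OF B' V(1) y]) (use eq in auto)
      then show ?thesis using partial_deriv_eq[OF A', of i] at[OF y]
        by (auto simp: partial_deriv_def differentiable_def)
    qed
    have F: "F differentiable (at y) \<and> P i y = partial_deriv V i G y" if "y \<in> V" for y i
      unfolding P_def by (rule tr[OF G(1)[OF that] that]) (use V(4) in auto)
    have P: "P i differentiable (at y) \<and> R i j y = partial_deriv V j (partial_deriv V i G) y" if "y \<in> V" for y i j
      unfolding R_def by (rule tr[OF G(2)[OF that] that]) (use F in auto)
    have "continuous_on V (R i j)" for i j
      using G(3)[of j i] by (rule continuous_on_eq) (use P in auto)
    then have "isCont (R i j) x" for i j
      using V(1,2) by (simp add: continuous_on_eq_continuous_at)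
    then show ?thesis using F P V(2) by blast
  qed
  have expand: "(A has_derivative (\<lambda>h. Re (cv h) * partial_deriv UNIV 1 A x + Im (cv h) * partial_deriv UNIV 2 A x)) (at x)"
    if "A differentiable (at x)" for A :: "real^2 \<Rightarrow> real" and x
  proof -
    have A: "(A has_derivative frechet_derivative A (at x)) (at x)" using that by (simp only: frechet_derivative_works[symmetric])
    interpret l: linear "frechet_derivative A (at x)" using A by (rule has_derivative_linear)
    have "frechet_derivative A (at x) h = Re (cv h) * partial_deriv UNIV 1 A x + Im (cv h) * partial_deriv UNIV 2 A x" for h
    proof -
      have "h = Re (cv h) *\<^sub>R axis 1 1 + Im (cv h) *\<^sub>R axis 2 1" using vc_eq_axis[of "cv h"] by simp
      then have "frechet_derivative A (at x) h = frechet_derivative A (at x) (Re (cv h) *\<^sub>R axis 1 1 + Im (cv h) *\<^sub>R axis 2 1)" by (rule arg_cong)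
      then show ?thesis unfolding l.add l.scaleR by (simp add: partial_deriv_def)
    qed
    then show ?thesis by (intro has_derivative_eq_rhs[OF A] ext)
  qed
  have vc: "(vc has_derivative vc) (at z)" for z
    by (rule bounded_linear.has_derivative[OF bounded_linear_vc has_derivative_ident, simplified])
  have along: "((\<lambda>z. A (vc z)) has_derivative (\<lambda>h. Re h * partial_deriv UNIV 1 A (vc z) + Im h * partial_deriv UNIV 2 A (vc z))) (at z)"
    if "\<And>x. A differentiable (at x)" for A :: "real^2 \<Rightarrow> real" and z
    using has_derivative_compose[OF vc expand[OF that]] by simp
  define g where "g z = Complex (P 1 (vc z)) (P 2 (vc z))" for z
  define H where "H z h = Complex (Re h * R 1 1 (vc z) + Im h * R 1 2 (vc z)) (Re h * R 2 1 (vc z) + Im h * R 2 2 (vc z))" for z h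
  have "C2_with (\<lambda>z. F (vc z)) g H"
    unfolding C2_with_def
  proof (intro conjI allI)
    fix z
    show "((\<lambda>z. F (vc z)) has_derivative (\<lambda>h. g z \<bullet> h)) (at z)"
      using along[of F z] loc by (simp add: g_def inner_complex_def P_def mult.commute)
    have P: "((\<lambda>z. P i (vc z)) has_derivative (\<lambda>h. Re h * R i 1 (vc z) + Im h * R i 2 (vc z))) (at z)" for i
      using along[of "P i" z] loc by (simp add: R_def)
    show "(g has_derivative H z) (at z)"
      unfolding g_def[abs_def] H_def Complex_eq
      by (intro has_derivative_add has_derivative_mult_right has_derivative_of_real P)
  next
    fix h
    have "continuous_on UNIV (\<lambda>z. R i j (vc z))" for i j
      by (rule continuous_on_compose2[of UNIV])
         (use loc bounded_linear_vc in \<open>auto intro: continuous_at_imp_continuous_on linear_continuous_on\<close>)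
    then show "continuous_on UNIV (\<lambda>z. H z h)"
      unfolding H_def Complex_eq by (intro continuous_intros)
  qed
  then show ?thesis by (rule that)
qed

lemma bounded_linear_embed3: "bounded_linear embed3"
proof -
  have "linear embed3" by (intro linearI) (auto simp: vec_eq_iff forall_3)
  then show ?thesis by (simp add: linear_conv_bounded_linear)
qed

lemma embed3_inner: "embed3 y \<bullet> embed3 z = y \<bullet> z" "embed3 y \<bullet> axis 3 1 = 0" "axis 3 1 \<bullet> embed3 y = 0"
  by (simp_all add: inner_vec_def sum_2 sum_3)

definition sphere_param' :: "real \<Rightarrow> real^2 \<Rightarrow> real^2 \<Rightarrow> real^3" where
  "sphere_param' s y h = (2 / (1 + (norm y)\<^sup>2)) *\<^sub>R embed3 h
     + (- (4 * (y \<bullet> h) / (1 + (norm y)\<^sup>2)\<^sup>2)) *\<^sub>R (embed3 y - s *\<^sub>R axis 3 1)"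

lemma sphere_param_has_derivative: "(sphere_param s has_derivative sphere_param' s y) (at y)"
proof -
  have nz: "1 + (norm y)\<^sup>2 \<noteq> 0" using zero_le_power2[of "norm y"] by linarith
  have n: "((\<lambda>y. 1 + (norm y)\<^sup>2) has_derivative (\<lambda>h. 2 * (y \<bullet> h))) (at y)"
  proof -
    have "((\<lambda>y. 1 + y \<bullet> y) has_derivative (\<lambda>h. 0 + (y \<bullet> h + h \<bullet> y))) (at y)"
      by (intro has_derivative_add has_derivative_const has_derivative_inner has_derivative_ident)
    then show ?thesis unfolding power2_norm_eq_inner by (simp add: inner_commute)
  qed
  have r: "((\<lambda>y. 2 / (1 + (norm y)\<^sup>2)) has_derivative (\<lambda>h. - (4 * (y \<bullet> h) / (1 + (norm y)\<^sup>2)\<^sup>2))) (at y)"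
    using has_derivative_divide'[OF has_derivative_const[of 2] n nz] by (simp add: power2_eq_square)
  have e: "(embed3 has_derivative embed3) (at y)"
    by (rule bounded_linear.has_derivative[OF bounded_linear_embed3 has_derivative_ident, simplified])
  have "((\<lambda>y. (2 / (1 + (norm y)\<^sup>2)) *\<^sub>R embed3 y + (s * (1 - 2 / (1 + (norm y)\<^sup>2))) *\<^sub>R axis 3 1) has_derivative
     (\<lambda>h. ((2 / (1 + (norm y)\<^sup>2)) *\<^sub>R embed3 h + (- (4 * (y \<bullet> h) / (1 + (norm y)\<^sup>2)\<^sup>2)) *\<^sub>R embed3 y)
       + (s * (0 - (- (4 * (y \<bullet> h) / (1 + (norm y)\<^sup>2)\<^sup>2)))) *\<^sub>R axis 3 1)) (at y)"
    by (intro has_derivative_add has_derivative_scaleR[OF r e] has_derivative_scaleR_left has_derivative_mult_right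
          has_derivative_diff has_derivative_const r)
  then show ?thesis
    unfolding sphere_param_def[abs_def] sphere_param'_def[abs_def] by (simp add: algebra_simps)
qed

text \<open>Conformality of the stereographic projection. The vector \<open>e\<close> from the pole
  to the point of the equatorial plane has squared length \<open>n\<close>, so the two mixed terms
  and the last one cancel.\<close>

lemma sphere_param'_inner:
  assumes s: "s * s = 1"
  shows "sphere_param' s y h \<bullet> sphere_param' s y k = 4 / (1 + (norm y)\<^sup>2)\<^sup>2 * (h \<bullet> k)"
proof -
  define n where "n = 1 + (norm y)\<^sup>2"
  have n: "n > 0" by (simp add: n_def add_pos_nonneg)
  define e where "e = embed3 y - s *\<^sub>R axis 3 1"
  have ee: "e \<bullet> e = n"
  proof -
    have "e \<bullet> e = y \<bullet> y + (s * s) * ((axis 3 1 :: real^3) \<bullet> axis 3 1)"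
      unfolding e_def inner_diff_left inner_diff_right inner_scaleR_left inner_scaleR_right embed3_inner by simp
    then show ?thesis unfolding s n_def power2_norm_eq_inner by (simp add: inner_axis_axis)
  qed
  have eh: "e \<bullet> embed3 h = y \<bullet> h" "embed3 h \<bullet> e = y \<bullet> h" for h
    by (simp_all add: e_def inner_diff_left inner_diff_right embed3_inner inner_commute)
  have "sphere_param' s y h \<bullet> sphere_param' s y k
    = (2 / n) * (2 / n) * (h \<bullet> k) - (2 / n) * (4 * (y \<bullet> k) / n\<^sup>2) * (y \<bullet> h)
      - (4 * (y \<bullet> h) / n\<^sup>2) * (2 / n) * (y \<bullet> k) + (4 * (y \<bullet> h) / n\<^sup>2) * (4 * (y \<bullet> k) / n\<^sup>2) * n"
  proof -
    have "(a *\<^sub>R E1 + (- p) *\<^sub>R e) \<bullet> (a *\<^sub>R E2 + (- q) *\<^sub>R e)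
        = a * a * (E1 \<bullet> E2) - a * q * (E1 \<bullet> e) - p * a * (e \<bullet> E2) + p * q * (e \<bullet> e)"
      for a p q and E1 E2 :: "real^3"
      unfolding inner_add_left inner_add_right inner_scaleR_left inner_scaleR_right by (simp add: algebra_simps)
    then show ?thesis
      unfolding sphere_param'_def n_def[symmetric] e_def[symmetric] by (simp only: eh ee embed3_inner)
  qed
  also have "\<dots> = 4 / n\<^sup>2 * (h \<bullet> k)"
  proof -
    have "(2 / n) * (4 * b / n\<^sup>2) * a = 8 * (a * b) / n^3" "(4 * a / n\<^sup>2) * (2 / n) * b = 8 * (a * b) / n^3"
      "(4 * a / n\<^sup>2) * (4 * b / n\<^sup>2) * n = 16 * (a * b) / n^3" "(2 / n) * (2 / n) * c = 4 / n\<^sup>2 * c" for a b c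
      using n by (simp_all add: power2_eq_square power3_eq_cube mult_ac)
    then show ?thesis by simp
  qed
  finally show ?thesis unfolding n_def .
qed

lemma round_metric_stereo:
  assumes s: "s * s = 1"
  shows "round_metric (stereo_chart s) y = (4 / (1 + (norm y)\<^sup>2)\<^sup>2) *\<^sub>R mat 1"
proof -
  have "frechet_derivative (sphere_param s) (at y) = sphere_param' s y"
    using frechet_derivative_at[OF sphere_param_has_derivative] by simp
  then have J: "jacobian (cinv (stereo_chart s)) (at y within cimage (stereo_chart s)) = matrix (sphere_param' s y)"
    unfolding cimage_stereo[OF s] cinv_stereo[OF s] jacobian_def by simp
  have "(transpose (matrix (sphere_param' s y)) ** matrix (sphere_param' s y)) $ i $ j
     = sphere_param' s y (axis i 1) \<bullet> sphere_param' s y (axis j 1)" for i j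
    by (simp add: matrix_matrix_mult_def transpose_def matrix_def inner_vec_def)
  then show ?thesis
    unfolding round_metric_def J Let_def vec_eq_iff
    by (auto simp: sphere_param'_inner[OF s] mat_def inner_axis_axis)
qed

section \<open>Curvature and integrals of the sphere in the plane\<close>

lemma lnq_1_0: "lnq 1 0 z = ln (wt z)"
  by (simp add: lnq_def)

lemma exp_conformal: "exp (2 * (u - lnq 1 0 z + ln 2)) = exp (2 * u) * (4 / (wt z)\<^sup>2)"
proof -
  have "exp (u - lnq 1 0 z + ln 2) = exp u * 2 / wt z"
    using wt_pos(1)[of z] by (simp add: lnq_1_0 exp_add exp_diff)
  then have "exp (2 * (u - lnq 1 0 z + ln 2)) = (exp u * 2 / wt z)\<^sup>2"
    unfolding exp_double by simp
  also have "\<dots> = exp (2 * u) * (4 / (wt z)\<^sup>2)"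
    by (simp add: power_mult_distrib power_divide exp_double)
  finally show ?thesis .
qed

lemma gauss_curv_chart:
  assumes s: "s * s = 1" and C2: "C2_with (\<lambda>z. f (sphere_param s (vc z))) g H"
  shows "gauss_curv (cimage (stereo_chart s)) (conformal_metric f (stereo_chart s)) (vc z)
    = (4 / (wt z)\<^sup>2 - lap H z) / (exp (2 * f (sphere_param s (vc z))) * (4 / (wt z)\<^sup>2))"
proof -
  obtain g0 H0 where L0: "C2_with (lnq 1 0) g0 H0" "\<And>z. lap H0 z = 4 / (wt z)\<^sup>2"
    using C2_with_lnq[of 1 0] by auto
  \<comment> \<open>The logarithm of exp f * 2 / wt, the length factor of the conformal metric
    relative to the flat one. Its Laplacian differs from that of f by the Liouville term of
    \<open>lnq 1 0\<close>.\<close>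
  define \<Phi> where "\<Phi> z = f (sphere_param s (vc z)) - lnq 1 0 z - (- ln 2)" for z
  have \<Phi>: "C2_with \<Phi> (\<lambda>z. g z - g0 z) (\<lambda>z h. H z h - H0 z h)"
    unfolding \<Phi>_def[abs_def] by (intro C2_with_diff_const C2_with_diff C2 L0)
  have e: "exp (2 * \<Phi> z) = exp (2 * f (sphere_param s (vc z))) * (4 / (wt z)\<^sup>2)" for z
    unfolding \<Phi>_def using exp_conformal[of "f (sphere_param s (vc z))" z] by simp
  have "conformal_metric f (stereo_chart s) = (\<lambda>y. exp (2 * \<Phi> (cv y)) *\<^sub>R mat 1)"
    unfolding e conformal_metric_def[abs_def] round_metric_stereo[OF s] cinv_stereo[OF s] by simp
  then have "gauss_curv (cimage (stereo_chart s)) (conformal_metric f (stereo_chart s)) (vc z)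
     = - lap (\<lambda>z h. H z h - H0 z h) z / exp (2 * \<Phi> z)"
    unfolding cimage_stereo[OF s] using gauss_curv_conformal[OF \<Phi>, of "vc z"] by simp
  then show ?thesis unfolding lap_diff L0(2) e by simp
qed

lemma sphere_param_inversion:
  assumes "z \<noteq> 0"
  shows "sphere_param 1 (vc z) = sphere_param (-1) (vc (1 / cnj z))"
proof -
  define m where "m = (norm z)\<^sup>2"
  have m: "m > 0" using assms by (simp add: m_def)
  have i: "1 / cnj z = (1 / m) *\<^sub>R z"
  proof -
    have "z * cnj z = of_real m" by (simp add: m_def complex_norm_square[symmetric])
    then have "1 / cnj z = z / of_real m" using assms m by (simp add: field_simps)
    then show ?thesis by (simp add: scaleR_conv_of_real)
  qed
  have n: "1 + (norm (vc (1 / cnj z)))\<^sup>2 = (1 + m) / m"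
    using m by (simp add: norm_divide power_divide m_def add_divide_distrib)
  have m1: "1 + m \<noteq> 0" using m by linarith
  show ?thesis
    unfolding sphere_param_def n unfolding norm_vc m_def[symmetric] i
    using m m1 by (simp add: vec_eq_iff forall_3) (simp add: field_simps)
qed

lemma sphere_integral_eq:
  "sphere_integral F = (\<integral>z. F (sphere_param 1 (vc z)) * (4 / (wt z)\<^sup>2) \<partial>lborel)"
proof -
  have "sqrt (det (round_metric (stereo_chart 1) y)) = 4 / (1 + (norm y)\<^sup>2)\<^sup>2" for y
  proof -
    have "det (round_metric (stereo_chart 1) y) = (4 / (1 + (norm y)\<^sup>2)\<^sup>2)\<^sup>2"
      by (simp add: round_metric_stereo det_2 mat_def power2_eq_square)
    then show ?thesis by (simp only: real_sqrt_abs) simp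
  qed
  then have "sphere_integral F = (\<integral>y. F (sphere_param 1 y) * (4 / (1 + (norm y)\<^sup>2)\<^sup>2) \<partial>lborel)"
    unfolding area_integral_def Let_def by (simp add: cinv_stereo)
  then show ?thesis unfolding integral_real2 by simp
qed

text \<open>\<open>chart_at\<close> is an unspecified choice, so the formula has to be verified in
  either chart. In the opposite chart it is carried over by \<open>lap_eq\<close>: the Laplacian
  times the squared weight does not change under inversion.\<close>

theorem gauss_curvature_sphere:
  assumes "chart_pair (\<lambda>z. f (sphere_param 1 (vc z))) (\<lambda>z. f (sphere_param (-1) (vc z))) g1 g2 H1 H2"
  shows "gauss_curvature S2 (conformal_metric f) (sphere_param 1 (vc z))
    = (4 / (wt z)\<^sup>2 - lap H1 z) / (exp (2 * f (sphere_param 1 (vc z))) * (4 / (wt z)\<^sup>2))"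
proof -
  interpret chart_pair "\<lambda>z. f (sphere_param 1 (vc z))" "\<lambda>z. f (sphere_param (-1) (vc z))" g1 g2 H1 H2 by fact
  define p where "p = sphere_param 1 (vc z)"
  define c where "c = chart_at S2 p"
  have p1: "p \<in> fst (stereo_chart 1)" unfolding p_def by (rule sphere_param_in) simp
  have "c \<in> charts S2 \<and> p \<in> fst c"
    unfolding c_def chart_at_def by (rule someI[of _ "stereo_chart 1"]) (use p1 in \<open>simp add: S2_def\<close>)
  then have c: "c = stereo_chart 1 \<or> c = stereo_chart (-1)" "p \<in> fst c" by (auto simp: S2_def)
  have K: "gauss_curvature S2 (conformal_metric f) p = gauss_curv (cimage c) (conformal_metric f c) (snd c p)"
    unfolding gauss_curvature_def c_def Let_def ..
  show ?thesis
  proof (cases "c = stereo_chart 1")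
    case True
    have "snd c p = vc z" unfolding True p_def by (rule stereo_sphere_param) simp
    then show ?thesis using K gauss_curv_chart[OF _ C2_1, of z] unfolding True p_def by simp
  next
    case False
    then have c2: "c = stereo_chart (-1)" using c by simp
    \<comment> \<open>The parameter 0 corresponds to the pole (0, 0, -1), which the opposite chart
      omits.\<close>
    have z: "z \<noteq> 0"
    proof
      assume "z = 0"
      then have "p = vector [0, 0, -1]"
        by (simp add: p_def sphere_param_def vec_eq_iff forall_3)
      then show False using c(2) unfolding c2 by (simp add: stereo_chart_def)
    qed
    define v where "v = 1 / cnj z"
    have pv: "p = sphere_param (-1) (vc v)" unfolding p_def v_def by (rule sphere_param_inversion[OF z])
    have "snd c p = vc v" unfolding c2 pv by (rule stereo_sphere_param) simp
    then have "gauss_curvature S2 (conformal_metric f) p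
        = (4 / (wt v)\<^sup>2 - lap H2 v) / (exp (2 * f p) * (4 / (wt v)\<^sup>2))"
      using K gauss_curv_chart[OF _ C2_2, of v] unfolding c2 pv by simp
    also have "\<dots> = (4 - lap H2 v * (wt v)\<^sup>2) / (exp (2 * f p) * 4)"
    proof -
      have "(4 / W - l) / (e * (4 / W)) = (4 - l * W) / (e * 4)" if "W > 0" "e > 0" for W l e :: real
        using that by (simp add: field_simps)
      then show ?thesis using wt_pos(1)[of v] by simp
    qed
    also have "lap H2 v * (wt v)\<^sup>2 = lap H1 z * (wt z)\<^sup>2"
    proof -
      have n: "(norm z)\<^sup>2 > 0" using z by simp
      have "wt v = wt z / (norm z)\<^sup>2"
        using n by (simp add: v_def norm_divide power_divide add_divide_distrib)
      moreover have "lap H1 z = lap H2 v / ((norm z)\<^sup>2)\<^sup>2"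
        using lap_eq[OF z] by (simp add: v_def flip: power_mult)
      ultimately show ?thesis using n by (simp add: power_divide)
    qed
    also have "(4 - lap H1 z * (wt z)\<^sup>2) / (exp (2 * f p) * 4) = (4 / (wt z)\<^sup>2 - lap H1 z) / (exp (2 * f p) * (4 / (wt z)\<^sup>2))"
    proof -
      have "(4 / W - l) / (e * (4 / W)) = (4 - l * W) / (e * 4)" if "W > 0" "e > 0" for W l e :: real
        using that by (simp add: field_simps)
      then show ?thesis using wt_pos(1)[of z] by simp
    qed
    finally show ?thesis unfolding p_def .
  qed
qed

theorem mainTheorem2:
  fixes f :: "real^3 \<Rightarrow> real"
  assumes "penrose_inequality"
    and "smooth_fun S2 f"
    and "1 / (4 * pi) * sphere_integral (\<lambda>x. exp (2 * f x)) = 1"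
  defines "K \<equiv> gauss_curvature S2 (conformal_metric f)"
  shows "(1 / (4 * pi) * sphere_integral (\<lambda>x. K x * exp (3 * f x)))\<^sup>2
         - (\<Sum>i\<in>UNIV. (1 / (4 * pi) * sphere_integral (\<lambda>x. K x * exp (3 * f x) * x $ i))\<^sup>2) \<ge> 1"
proof -
  have smooth: "smooth_on UNIV (\<lambda>y. f (sphere_param s y))" if "s = 1 \<or> s = -1" for s
  proof -
    have "s * s = 1" using that by auto
    moreover have "smooth_on (cimage (stereo_chart s)) (f \<circ> cinv (stereo_chart s))"
      using assms(2) that by (auto simp: smooth_fun_def S2_def)
    ultimately show ?thesis by (simp add: cimage_stereo cinv_stereo comp_def)
  qed
  obtain g1 H1 where 1: "C2_with (\<lambda>z. f (sphere_param 1 (vc z))) g1 H1"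
    using smooth_on_UNIV_C2[OF smooth[of 1]] by auto
  obtain g2 H2 where 2: "C2_with (\<lambda>z. f (sphere_param (-1) (vc z))) g2 H2"
    using smooth_on_UNIV_C2[OF smooth[of "-1"]] by auto
  interpret chart_pair "\<lambda>z. f (sphere_param 1 (vc z))" "\<lambda>z. f (sphere_param (-1) (vc z))" g1 g2 H1 H2
    by unfold_locales (use 1 2 sphere_param_inversion in auto)
  \<comment> \<open>The denominator of the curvature cancels the area element and two of the three
    powers of exp f.\<close>
  have K: "K (sphere_param 1 (vc z)) * exp (3 * f (sphere_param 1 (vc z))) * (4 / (wt z)\<^sup>2) = curv_density z" for z
  proof -
    have "A / (exp (2 * u) * W) * exp (3 * u) * W = exp u * A" if "W > 0" for A W u :: real
    proof -
      have "exp (3 * u) = exp (2 * u) * exp u" by (simp flip: exp_add)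
      then show ?thesis using that by simp
    qed
    then show ?thesis
      unfolding K_def gauss_curvature_sphere[OF chart_pair_axioms] curv_density_def
      using wt_pos(1)[of z] by simp
  qed
  have KX: "sphere_integral (\<lambda>x. K x * exp (3 * f x) * x $ i) = (\<integral>z. curv_density z * sphere_param 1 (vc z) $ i \<partial>lborel)" for i
    unfolding sphere_integral_eq K[symmetric] by (simp add: mult_ac)
  have K0: "sphere_integral (\<lambda>x. K x * exp (3 * f x)) = integral\<^sup>L lborel curv_density"
    unfolding sphere_integral_eq K ..
  have X: "sphere_param 1 (vc z) $ 1 = X1 z" "sphere_param 1 (vc z) $ 2 = X2 z" "sphere_param 1 (vc z) $ 3 = X3 z" for z
    using wt_pos(1)[of z] by (simp_all add: sphere_param_def X1_def X2_def X3_def field_simps)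
  have "(\<integral>z. exp (2 * f (sphere_param 1 (vc z))) / (wt z)\<^sup>2 \<partial>lborel) = pi"
  proof -
    have "sphere_integral (\<lambda>x. exp (2 * f x)) = (\<integral>z. 4 * (exp (2 * f (sphere_param 1 (vc z))) / (wt z)\<^sup>2) \<partial>lborel)"
      unfolding sphere_integral_eq by (simp add: mult.commute)
    also have "\<dots> = 4 * (\<integral>z. exp (2 * f (sphere_param 1 (vc z))) / (wt z)\<^sup>2 \<partial>lborel)"
      by (rule integral_mult_right_zero)
    finally show ?thesis using assms(3) by simp
  qed
  from lorentz_inequality[OF this]
  have "(4 * pi)\<^sup>2 / (4 * pi)\<^sup>2 \<le> ((integral\<^sup>L lborel curv_density)\<^sup>2 - ((\<integral>z. curv_density z * X1 z \<partial>lborel)\<^sup>2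
    + (\<integral>z. curv_density z * X2 z \<partial>lborel)\<^sup>2 + (\<integral>z. curv_density z * X3 z \<partial>lborel)\<^sup>2)) / (4 * pi)\<^sup>2"
    by (rule divide_right_mono) simp
  then show ?thesis
    unfolding K0 sum_3 KX X power_mult_distrib power_divide
    by (simp add: diff_divide_distrib add_divide_distrib)
qed

end
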